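(* Let $\Omega$ be a locally compact Hausdorff space and $E$ a Banach space. Let $F$ be a weakly sequentially complete Banach space, or a dual Banach space containing no isomorphic copy of $\ell_\infty^{\mathbb{R}}$. For every continuous linear operator $T\colon C_0(\Omega,E)\to F$ there exists a unique regular Borel i-measure $\mu\colon \mathfrak{B}(\Omega)\to\mathcal{L}(E,F)$ such that $$T f = \int_\Omega f\,\mathrm{d}\mu \qquad (f\in C_0(\Omega,E)). \quad ( * )$$ Conversely, if $F$ is an arbitrary Banach space and $\mu\colon\mathfrak{B}(\Omega)\to\mathcal{L}(E,F)$ is an arbitrary regular i-measure, then $( * )$ correctly defines a continuous linear operator $T\colon C_0(\Omega,E)\to F$ such that $\|T\| = \|\mu\|_\Omega$.
   Context: All Banach spaces are over a fixed field $\mathbb{K}$ of real or complex numbers. $\mathcal{L}(E,F)$ is the Banach space of continuous linear operators $E\to F$. $C_0(\Omega,E)$ is the space of continuous functions $\Omega\to E$ vanishing at infinity, with the sup-norm. $\mathfrak{B}(\Omega)$ is the Borel $\sigma$-algebra. $\ell_\infty^{\mathbb{R}}$ is the Banach space of bounded real sequences. A Banach space is weakly sequentially complete if every weakly Cauchy sequence in it converges weakly. Independent convergence: for $T_n\in\mathcal{L}(E,F)$, the series $\sum_{n=1}^\infty T_n$ is independently convergent if $\sum_{n=1}^\infty T_n x_n$ converges in the norm of $F$ for every bounded sequence $(x_n)$ in $E$. i-measure: for a $\sigma$-algebra $\mathfrak{M}$ of subsets of a set $Z$, a set function $\mu\colon\mathfrak{M}\to\mathcal{L}(E,F)$ is an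 i-measure if for any sequence of pairwise disjoint sets $A_n\in\mathfrak{M}$, $\mu(\bigcup_{n} A_n)x=\sum_{n}\mu(A_n)x$ for each $x\in E$ and the series $\sum_n\mu(A_n)$ is independently convergent. Its total semivariation is $$\|\mu\|_Z=\sup\Bigl\{\Bigl\|\sum_{n=1}^N\mu(A_n)x_n\Bigr\| : N<\infty,\ A_n\in\mathfrak{M}\text{ pairwise disjoint},\ x_n\in E,\ \|x_n\|\le 1\Bigr\}$$ (it is known to be finite for every i-measure). Integral: $\ell_\infty(Z,E)$ is the space of bounded functions $Z\to E$ with the sup-norm; $S_{\mathfrak{M}}(Z,E)$ is the set of $f\in\ell_\infty(Z,E)$ such that $f(Z)$ is countable and $f^{-1}(\{e\})\in\mathfrak{M}$ for every $e\in E$. For such $f$, $\int_Z f\,\mathrm{d}\mu=\sum_{e\in E}\mu(f^{-1}(\{e\}))e$ (unconditionally convergent). $M_{\mathfrak{M}}(Z,E)$ is the space of bounded $f\colon Z\to E$ such that $f(Z)$ is separable and $\psi\circ f$ is $\mathfrak{M}$-measurable for each $\psi\in E^*$; it is the uniform closure of $S_{\mathfrak{M}}(Z,E)$. The map $f\mapsto\int_Z f\,\mathrm{d}\mu$ is linear and continuous on $S_{\mathfrak{M}}(Z,E)$ with norm $\|\mu\|_Z$, and for $f\in M_{\mathfrak{M}}(Z,E)$ the integral $\int_Z f\,\mathrm{d}\mu$ is defined by the unique continuous extension. Note $C_0(\Omega,E)\subset M_{\mathfrak{B}(\Omega)}(\Omega,E)$. Regularity: an i-measure $\mu$ on $\mathfrak{B}(\Omega)$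 is regular if every $A\in\mathfrak{B}(\Omega)$ includes a $\sigma$-compact set $K$ (a countable union of compact sets) such that $\mu$ vanishes on every Borel set contained in $A\setminus K$. *)

theory Defs
  imports "HOL-Analysis.Analysis"
begin

section \<open>The scalar field\<close>

text \<open>
  Exactly the real field and the complex field belong to this class, up to isometric
  isomorphism; a type variable of this class plays the role of the scalar field.
\<close>

class real_or_complex = real_normed_field +
  assumes real_or_complex:
    "(\<forall>z::'a. \<exists>a. z = a *\<^sub>R 1) \<or>
     (\<exists>j::'a. j * j = - 1 \<and>
       (\<forall>z. \<exists>a b. z = a *\<^sub>R 1 + b *\<^sub>R j) \<and>
       (\<forall>a b. norm (a *\<^sub>R 1 + b *\<^sub>R j) = sqrt (a * a + b * b)))"

instance real :: real_or_complex
  by standard simp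

instance complex :: real_or_complex
proof
  have "\<i> * \<i> = - 1 \<and> (\<forall>z. \<exists>a b. z = a *\<^sub>R 1 + b *\<^sub>R \<i>) \<and>
    (\<forall>a b. norm (a *\<^sub>R 1 + b *\<^sub>R \<i>) = sqrt (a * a + b * b))"
    by (auto simp: complex_eq_iff cmod_def power2_eq_square)
  then show "(\<forall>z::complex. \<exists>a. z = a *\<^sub>R 1) \<or>
    (\<exists>j::complex. j * j = - 1 \<and> (\<forall>z. \<exists>a b. z = a *\<^sub>R 1 + b *\<^sub>R j) \<and>
      (\<forall>a b. norm (a *\<^sub>R 1 + b *\<^sub>R j) = sqrt (a * a + b * b)))"
    by blast
qed


section \<open>Normed spaces over the scalar field, their operators and duals\<close>

text \<open>
  A Banach space over \<open>'k\<close> is a type \<open>'a::banach\<close> together with a scalar multiplication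
  \<open>'k \<Rightarrow> 'a \<Rightarrow> 'a\<close> satisfying this locale: the real structure of the type is the one obtained by
  restriction of scalars.
\<close>

locale normed_over = vector_space scale
  for scale :: "'k::real_or_complex \<Rightarrow> 'a::real_normed_vector \<Rightarrow> 'a" +
  assumes scale_of_real: "scale (of_real r) x = r *\<^sub>R x"
    and norm_scale: "norm (scale c x) = norm c * norm x"

definition linops ::
  "('k::real_or_complex \<Rightarrow> 'a::real_normed_vector \<Rightarrow> 'a) \<Rightarrow>
   ('k \<Rightarrow> 'b::real_normed_vector \<Rightarrow> 'b) \<Rightarrow> ('a \<Rightarrow>\<^sub>L 'b) set"
  where "linops sA sB = {T. Vector_Spaces.linear sA sB (blinfun_apply T)}"

definition dual ::
  "('k::real_or_complex \<Rightarrow> 'a::real_normed_vector \<Rightarrow> 'a) \<Rightarrow> ('a \<Rightarrow>\<^sub>L 'k) set"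
  where "dual sA = linops sA (*)"

definition weakly_Cauchy ::
  "('k::real_or_complex \<Rightarrow> 'a::real_normed_vector \<Rightarrow> 'a) \<Rightarrow> (nat \<Rightarrow> 'a) \<Rightarrow> bool"
  where "weakly_Cauchy sA x \<longleftrightarrow> (\<forall>\<psi>\<in>dual sA. Cauchy (\<lambda>n. blinfun_apply \<psi> (x n)))"

definition weakly_converges ::
  "('k::real_or_complex \<Rightarrow> 'a::real_normed_vector \<Rightarrow> 'a) \<Rightarrow> (nat \<Rightarrow> 'a) \<Rightarrow> 'a \<Rightarrow> bool"
  where "weakly_converges sA x l \<longleftrightarrow>
    (\<forall>\<psi>\<in>dual sA. (\<lambda>n. blinfun_apply \<psi> (x n)) \<longlonglongrightarrow> blinfun_apply \<psi> l)"

definition weakly_sequentially_complete ::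
  "('k::real_or_complex \<Rightarrow> 'a::real_normed_vector \<Rightarrow> 'a) \<Rightarrow> bool"
  where "weakly_sequentially_complete sA \<longleftrightarrow>
    (\<forall>x. weakly_Cauchy sA x \<longrightarrow> (\<exists>l. weakly_converges sA x l))"

text \<open>\<open>F\<close> is (isometrically isomorphic over \<open>'k\<close> to) the dual of \<open>G\<close>.\<close>

definition is_dual_of ::
  "('k::real_or_complex \<Rightarrow> 'f::real_normed_vector \<Rightarrow> 'f) \<Rightarrow>
   ('k \<Rightarrow> 'g::real_normed_vector \<Rightarrow> 'g) \<Rightarrow> bool"
  where "is_dual_of sF sG \<longleftrightarrow>
    (\<exists>J :: 'f \<Rightarrow> 'g \<Rightarrow>\<^sub>L 'k.
      bij_betw J UNIV (dual sG) \<and>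
      (\<forall>y z. J (y + z) = J y + J z) \<and>
      (\<forall>c y x. blinfun_apply (J (sF c y)) x = c * blinfun_apply (J y) x) \<and>
      (\<forall>y. norm (J y) = norm y))"

text \<open>
  Since \<open>nat\<close> is discrete, \<open>nat \<Rightarrow>\<^sub>C real\<close> is the space of bounded real sequences with the
  sup-norm. The copy is a real-linear one, also when \<open>'f\<close> is a complex space.
\<close>

definition contains_real_linfty :: "'f::real_normed_vector itself \<Rightarrow> bool"
  where "contains_real_linfty _ \<longleftrightarrow>
    (\<exists>U :: (nat \<Rightarrow>\<^sub>C real) \<Rightarrow>\<^sub>L 'f.
      \<exists>c>0. \<forall>x. c * norm x \<le> norm (blinfun_apply U x))"


section \<open>Continuous functions vanishing at infinity\<close>

definition vanishes_at_infinity :: "('z::topological_space \<Rightarrow> 'e::real_normed_vector) \<Rightarrow> bool"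
  where "vanishes_at_infinity f \<longleftrightarrow>
    (\<forall>\<epsilon>>0. \<exists>K. compact K \<and> (\<forall>z. z \<notin> K \<longrightarrow> norm (f z) < \<epsilon>))"

lemma vanishes_at_infinity_dominated:
  assumes "vanishes_at_infinity f" "B \<ge> 0" "\<And>z. norm (g z) \<le> B * norm (f z)"
  shows "vanishes_at_infinity g"
  unfolding vanishes_at_infinity_def
proof (intro allI impI)
  fix \<epsilon> :: real assume "\<epsilon> > 0"
  then have "\<epsilon> / (B + 1) > 0"
    using assms(2) by simp
  then obtain K where K: "compact K" "\<And>z. z \<notin> K \<Longrightarrow> norm (f z) < \<epsilon> / (B + 1)"
    using assms(1) unfolding vanishes_at_infinity_def by meson
  have "norm (g z) < \<epsilon>" if "z \<notin> K" for z
  proof -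
    have "norm (g z) \<le> (B + 1) * norm (f z)"
      using assms(3)[of z] by (simp add: algebra_simps add_increasing)
    also have "\<dots> < \<epsilon>"
      using K(2)[OF that] assms(2) by (simp add: pos_less_divide_eq mult.commute)
    finally show ?thesis .
  qed
  then show "\<exists>K. compact K \<and> (\<forall>z. z \<notin> K \<longrightarrow> norm (g z) < \<epsilon>)"
    using K(1) by blast
qed

lemma vanishes_at_infinity_add:
  assumes "vanishes_at_infinity f" "vanishes_at_infinity g"
  shows "vanishes_at_infinity (\<lambda>z. f z + g z)"
  unfolding vanishes_at_infinity_def
proof (intro allI impI)
  fix \<epsilon> :: real assume "\<epsilon> > 0"
  then have "\<epsilon> / 2 > 0" by simp
  then obtain K L where K: "compact K" "\<And>z. z \<notin> K \<Longrightarrow> norm (f z) < \<epsilon> / 2"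
    and L: "compact L" "\<And>z. z \<notin> L \<Longrightarrow> norm (g z) < \<epsilon> / 2"
    using assms unfolding vanishes_at_infinity_def by meson
  have "norm (f z + g z) < \<epsilon>" if "z \<notin> K \<union> L" for z
    using K(2)[of z] L(2)[of z] that norm_triangle_ineq[of "f z" "g z"] by auto
  then show "\<exists>K. compact K \<and> (\<forall>z. z \<notin> K \<longrightarrow> norm (f z + g z) < \<epsilon>)"
    using compact_Un[OF K(1) L(1)] by blast
qed

typedef (overloaded) ('z, 'e) c0fun =
  "{f :: 'z::topological_space \<Rightarrow> 'e::real_normed_vector.
     continuous_on UNIV f \<and> vanishes_at_infinity f}"
  morphisms apply_c0 Abs_c0
proof
  show "(\<lambda>_. 0) \<in> {f :: 'z \<Rightarrow> 'e. continuous_on UNIV f \<and> vanishes_at_infinity f}"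
    by (auto simp: vanishes_at_infinity_def)
qed

setup_lifting type_definition_c0fun

lemma c0_bounded: "bdd_above (range (\<lambda>z. norm (apply_c0 f z)))"
proof -
  have cont: "continuous_on UNIV (apply_c0 f)" and van: "vanishes_at_infinity (apply_c0 f)"
    using apply_c0[of f] by auto
  obtain K where K: "compact K" "\<And>z. z \<notin> K \<Longrightarrow> norm (apply_c0 f z) < 1"
    using van unfolding vanishes_at_infinity_def by (meson zero_less_one)
  have "compact (apply_c0 f ` K)"
    using K(1) cont compact_continuous_image continuous_on_subset by blast
  then obtain B where B: "\<And>z. z \<in> K \<Longrightarrow> norm (apply_c0 f z) \<le> B"
    using compact_imp_bounded bounded_iff by (metis image_eqI)
  have "norm (apply_c0 f z) \<le> max 1 B" for z
    using K(2)[of z] B[of z] by fastforce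
  then show ?thesis
    by (auto intro!: bdd_aboveI)
qed

instantiation c0fun :: (topological_space, real_normed_vector) real_vector
begin

lift_definition zero_c0fun :: "('a, 'b) c0fun" is "\<lambda>_. 0"
  by (auto simp: vanishes_at_infinity_def)

lift_definition plus_c0fun :: "('a, 'b) c0fun \<Rightarrow> ('a, 'b) c0fun \<Rightarrow> ('a, 'b) c0fun"
  is "\<lambda>f g z. f z + g z"
  by (auto intro: continuous_intros vanishes_at_infinity_add)

lift_definition uminus_c0fun :: "('a, 'b) c0fun \<Rightarrow> ('a, 'b) c0fun" is "\<lambda>f z. - f z"
  by (auto intro: continuous_intros vanishes_at_infinity_dominated[of _ 1])

lift_definition minus_c0fun :: "('a, 'b) c0fun \<Rightarrow> ('a, 'b) c0fun \<Rightarrow> ('a, 'b) c0fun"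
  is "\<lambda>f g z. f z - g z"
proof -
  fix f g :: "'a \<Rightarrow> 'b"
  assume f: "continuous_on UNIV f \<and> vanishes_at_infinity f"
    and g: "continuous_on UNIV g \<and> vanishes_at_infinity g"
  have "vanishes_at_infinity (\<lambda>z. - g z)"
    using g by (auto intro: vanishes_at_infinity_dominated[of g 1])
  then have "vanishes_at_infinity (\<lambda>z. f z + - g z)"
    using f vanishes_at_infinity_add by blast
  then show "continuous_on UNIV (\<lambda>z. f z - g z) \<and> vanishes_at_infinity (\<lambda>z. f z - g z)"
    using f g by (auto intro: continuous_intros)
qed

lift_definition scaleR_c0fun :: "real \<Rightarrow> ('a, 'b) c0fun \<Rightarrow> ('a, 'b) c0fun"
  is "\<lambda>r f z. r *\<^sub>R f z"
  subgoal for r f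
    by (auto intro: continuous_intros vanishes_at_infinity_dominated[of f "\<bar>r\<bar>"])
  done

instance
  by standard (transfer; simp add: algebra_simps fun_eq_iff)+

end

instantiation c0fun :: (topological_space, real_normed_vector) real_normed_vector
begin

definition norm_c0fun :: "('a, 'b) c0fun \<Rightarrow> real"
  where "norm_c0fun f = (SUP z. norm (apply_c0 f z))"

definition dist_c0fun :: "('a, 'b) c0fun \<Rightarrow> ('a, 'b) c0fun \<Rightarrow> real"
  where "dist_c0fun f g = norm (f - g)"

definition sgn_c0fun :: "('a, 'b) c0fun \<Rightarrow> ('a, 'b) c0fun"
  where "sgn_c0fun f = f /\<^sub>R norm f"

definition uniformity_c0fun :: "(('a, 'b) c0fun \<times> ('a, 'b) c0fun) filter"
  where "uniformity_c0fun = (INF e\<in>{0<..}. principal {(f, g). dist f g < e})"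

definition open_c0fun :: "('a, 'b) c0fun set \<Rightarrow> bool"
  where "open_c0fun U \<longleftrightarrow> (\<forall>f\<in>U. \<forall>\<^sub>F (f', g) in uniformity. f' = f \<longrightarrow> g \<in> U)"

lemma norm_c0_le: "norm (apply_c0 f z) \<le> norm f"
  unfolding norm_c0fun_def by (rule cSUP_upper[OF UNIV_I c0_bounded])

lemma norm_c0_least: "(\<And>z. norm (apply_c0 f z) \<le> B) \<Longrightarrow> norm f \<le> B"
  unfolding norm_c0fun_def by (rule cSUP_least) auto

lemma norm_scaleR_c0_le: "norm (r *\<^sub>R f) \<le> \<bar>r\<bar> * norm f" for f :: "('a, 'b) c0fun"
  by (rule norm_c0_least) (simp add: scaleR_c0fun.rep_eq mult_left_mono norm_c0_le)

instance
proof
  fix f g :: "('a, 'b) c0fun" and r :: real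
  show "norm f = 0 \<longleftrightarrow> f = 0"
  proof
    assume "norm f = 0"
    then have "apply_c0 f z = 0" for z
      using norm_c0_le[of f z] by simp
    then have "apply_c0 f = apply_c0 0"
      by (simp add: zero_c0fun.rep_eq fun_eq_iff)
    then show "f = 0"
      by (simp add: apply_c0_inject)
  qed (simp add: norm_c0fun_def zero_c0fun.rep_eq)
  show "norm (f + g) \<le> norm f + norm g"
  proof (rule norm_c0_least)
    fix z
    show "norm (apply_c0 (f + g) z) \<le> norm f + norm g"
      using norm_triangle_ineq[of "apply_c0 f z" "apply_c0 g z"] norm_c0_le[of f z]
        norm_c0_le[of g z] by (simp add: plus_c0fun.rep_eq)
  qed
  show "norm (r *\<^sub>R f) = \<bar>r\<bar> * norm f"
  proof (cases "r = 0")
    case True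
    then show ?thesis
      by (simp add: norm_c0fun_def zero_c0fun.rep_eq)
  next
    case False
    have "norm f \<le> norm (r *\<^sub>R f) / \<bar>r\<bar>"
      using norm_scaleR_c0_le[of "inverse r" "r *\<^sub>R f"] False
      by (simp add: divide_inverse mult.commute)
    then have "\<bar>r\<bar> * norm f \<le> norm (r *\<^sub>R f)"
      using False by (simp add: field_simps)
    then show ?thesis
      using norm_scaleR_c0_le[of r f] by simp
  qed
qed (auto simp: dist_c0fun_def sgn_c0fun_def uniformity_c0fun_def open_c0fun_def)

end

text \<open>
  Scalar multiplication on \<open>C\<^sub>0\<close>; it is the pointwise one whenever \<open>sE\<close> satisfies
  \<open>normed_over\<close>.
\<close>

definition c0_scale ::
  "('k::real_or_complex \<Rightarrow> 'e::real_normed_vector \<Rightarrow> 'e) \<Rightarrow>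
   'k \<Rightarrow> ('z::topological_space, 'e) c0fun \<Rightarrow> ('z, 'e) c0fun"
  where "c0_scale sE c f = Abs_c0 (\<lambda>z. sE c (apply_c0 f z))"

lemma apply_c0_scale:
  assumes "normed_over sE"
  shows "apply_c0 (c0_scale sE c f) z = sE c (apply_c0 f z)"
proof -
  interpret normed_over sE by fact
  have "bounded_linear (sE c)"
  proof
    fix r :: real and x y
    show "sE c (x + y) = sE c x + sE c y"
      by (rule scale_right_distrib)
    show "sE c (r *\<^sub>R x) = r *\<^sub>R sE c x"
      by (metis scale_of_real scale_left_commute)
    show "\<exists>K. \<forall>x. norm (sE c x) \<le> norm x * K"
      by (rule exI[of _ "norm c"]) (simp add: norm_scale mult.commute)
  qed
  moreover have "continuous_on UNIV (apply_c0 f)" "vanishes_at_infinity (apply_c0 f)"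
    using apply_c0[of f] by auto
  ultimately have "continuous_on UNIV (\<lambda>z. sE c (apply_c0 f z))"
    "vanishes_at_infinity (\<lambda>z. sE c (apply_c0 f z))"
    by (auto intro: bounded_linear.continuous_on vanishes_at_infinity_dominated[of _ "norm c"]
        simp: norm_scale)
  then show ?thesis
    by (simp add: c0_scale_def Abs_c0_inverse)
qed

lemma normed_over_c0_scale:
  assumes "normed_over sE"
  shows "normed_over (c0_scale sE)"
proof -
  interpret normed_over sE by fact
  note app = apply_c0_scale[OF assms]
  have eqI: "f = g" if "\<And>z. apply_c0 f z = apply_c0 g z" for f g :: "('z::topological_space, 'b) c0fun"
    using that by (simp add: apply_c0_inject[symmetric] fun_eq_iff)
  show ?thesis
  proof
    fix r :: real and a b c :: 'a and f g :: "('z::topological_space, 'b) c0fun"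
    show "c0_scale sE a (f + g) = c0_scale sE a f + c0_scale sE a g"
      by (rule eqI) (simp add: app plus_c0fun.rep_eq scale_right_distrib)
    show "c0_scale sE (a + b) f = c0_scale sE a f + c0_scale sE b f"
      by (rule eqI) (simp add: app plus_c0fun.rep_eq scale_left_distrib)
    show "c0_scale sE a (c0_scale sE b f) = c0_scale sE (a * b) f"
      by (rule eqI) (simp add: app)
    show "c0_scale sE 1 f = f"
      by (rule eqI) (simp add: app)
    show "c0_scale sE (of_real r) f = r *\<^sub>R f"
      by (rule eqI) (simp add: app scale_of_real scaleR_c0fun.rep_eq)
    show "norm (c0_scale sE c f) = norm c * norm f"
    proof -
      have le: "norm (c0_scale sE c f) \<le> norm c * norm f" for c f
        by (rule norm_c0_least) (simp add: app norm_scale mult_left_mono norm_c0_le)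
      have "norm c * norm f \<le> norm (c0_scale sE c f)"
      proof (cases "c = 0")
        case False
        have "c0_scale sE (inverse c) (c0_scale sE c f) = f"
          by (rule eqI) (simp add: app False)
        then have "norm f \<le> inverse (norm c) * norm (c0_scale sE c f)"
          using le[of "inverse c" "c0_scale sE c f"] by (simp add: norm_inverse)
        then show ?thesis
          using False by (simp add: field_simps)
      qed simp
      then show ?thesis
        using le[of c f] by simp
    qed
  qed
qed


section \<open>i-measures\<close>

definition independently_convergent ::
  "(nat \<Rightarrow> 'e::real_normed_vector \<Rightarrow>\<^sub>L 'f::real_normed_vector) \<Rightarrow> bool"
  where "independently_convergent T \<longleftrightarrow>
    (\<forall>x :: nat \<Rightarrow> 'e. bounded (range x) \<longrightarrow> summable (\<lambda>n. blinfun_apply (T n) (x n)))"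

text \<open>
  Here and below \<open>M :: 'z measure\<close> only serves as a measurable space, that is, as the
  \<open>\<sigma>\<close>-algebra \<open>sets M\<close> on \<open>space M\<close>. Values of \<open>\<mu>\<close> outside \<open>sets M\<close> are irrelevant.
\<close>

definition i_measure ::
  "('k::real_or_complex \<Rightarrow> 'e::banach \<Rightarrow> 'e) \<Rightarrow> ('k \<Rightarrow> 'f::banach \<Rightarrow> 'f) \<Rightarrow>
   'z measure \<Rightarrow> ('z set \<Rightarrow> 'e \<Rightarrow>\<^sub>L 'f) \<Rightarrow> bool"
  where "i_measure sE sF M \<mu> \<longleftrightarrow>
    (\<forall>A\<in>sets M. \<mu> A \<in> linops sE sF) \<and>
    (\<forall>A :: nat \<Rightarrow> 'z set. range A \<subseteq> sets M \<longrightarrow> disjoint_family A \<longrightarrow>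
      (\<forall>x. (\<lambda>n. blinfun_apply (\<mu> (A n)) x) sums blinfun_apply (\<mu> (\<Union>n. A n)) x) \<and>
      independently_convergent (\<lambda>n. \<mu> (A n)))"

definition semivariation :: "'z measure \<Rightarrow> ('z set \<Rightarrow> 'e::banach \<Rightarrow>\<^sub>L 'f::banach) \<Rightarrow> ennreal"
  where "semivariation M \<mu> =
    Sup {ennreal (norm (\<Sum>n<N. blinfun_apply (\<mu> (A n)) (x n))) | (N::nat) A x.
      (\<forall>n<N. A n \<in> sets M \<and> norm (x n) \<le> 1) \<and> disjoint_family_on A {..<N}}"

definition regular_i_measure ::
  "('k::real_or_complex \<Rightarrow> 'e::banach \<Rightarrow> 'e) \<Rightarrow> ('k \<Rightarrow> 'f::banach \<Rightarrow> 'f) \<Rightarrow>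
   ('z::t2_space set \<Rightarrow> 'e \<Rightarrow>\<^sub>L 'f) \<Rightarrow> bool"
  where "regular_i_measure sE sF \<mu> \<longleftrightarrow>
    i_measure sE sF borel \<mu> \<and>
    (\<forall>A\<in>sets borel. \<exists>C :: nat \<Rightarrow> 'z set.
      (\<forall>n. compact (C n)) \<and> (\<Union>n. C n) \<subseteq> A \<and>
      (\<forall>B\<in>sets borel. B \<subseteq> A - (\<Union>n. C n) \<longrightarrow> \<mu> B = 0))"


section \<open>The integral\<close>

definition S_fun :: "'z measure \<Rightarrow> ('z \<Rightarrow> 'e::banach) set"
  where "S_fun M = {f. bounded (f ` space M) \<and> countable (f ` space M) \<and>
    (\<forall>e. f -` {e} \<inter> space M \<in> sets M)}"

definition S_integral ::
  "'z measure \<Rightarrow> ('z set \<Rightarrow> 'e::banach \<Rightarrow>\<^sub>L 'f::banach) \<Rightarrow> ('z \<Rightarrow> 'e) \<Rightarrow> 'f"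
  where "S_integral M \<mu> f = (\<Sum>\<^sub>\<infinity>e\<in>UNIV. blinfun_apply (\<mu> (f -` {e} \<inter> space M)) e)"

definition M_fun ::
  "('k::real_or_complex \<Rightarrow> 'e::banach \<Rightarrow> 'e) \<Rightarrow> 'z measure \<Rightarrow> ('z \<Rightarrow> 'e) set"
  where "M_fun sE M = {f. bounded (f ` space M) \<and>
    separable_space (top_of_set (f ` space M)) \<and>
    (\<forall>\<psi>\<in>dual sE. (\<lambda>z. blinfun_apply \<psi> (f z)) \<in> borel_measurable M)}"

text \<open>
  The integral is the unique extension of \<open>S_integral\<close> to \<open>M_fun\<close> that is continuous for the
  sup-norm (expressed through sequences); it is made a total function by \<open>extensional\<close>.
\<close>

definition i_integral ::
  "('k::real_or_complex \<Rightarrow> 'e::banach \<Rightarrow> 'e) \<Rightarrow> 'z measure \<Rightarrow>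
   ('z set \<Rightarrow> 'e \<Rightarrow>\<^sub>L 'f::banach) \<Rightarrow> ('z \<Rightarrow> 'e) \<Rightarrow> 'f"
  where "i_integral sE M \<mu> = (THE I.
    I \<in> extensional (M_fun sE M) \<and>
    (\<forall>f\<in>S_fun M. I f = S_integral M \<mu> f) \<and>
    (\<forall>f\<in>M_fun sE M. \<forall>s. range s \<subseteq> M_fun sE M \<longrightarrow>
      uniform_limit (space M) s f sequentially \<longrightarrow> (\<lambda>n. I (s n)) \<longlonglongrightarrow> I f))"

end

theory Submission
  imports Defs
begin

text \<open>
  Call \<open>\<parallel>U\<parallel> = sup \<parallel>T f\<parallel>\<close>, over the \<open>f\<close> in the unit ball of \<open>C\<^sub>0\<close> that vanish off the open set
  \<open>U\<close>, the semivariation of \<open>T\<close>. If \<open>\<parallel>T g\<^sub>n\<parallel> \<ge> \<delta>\<close> for functions \<open>g\<^sub>n\<close> in the unit ball with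
  disjoint supports, then the finite sums of the \<open>T g\<^sub>n\<close> are bounded. By Rosenthal's lemma a
  subsequence is almost biorthogonal to a bounded sequence of functionals: in a dual space its
  weak* sums then embed the bounded sequences into \<open>F\<close>, and in a weakly sequentially complete
  space its weak sum has positive distance from its span, so both alternatives exclude this.
  Hence every open \<open>U\<close> contains compact sets \<open>K\<close> with \<open>\<parallel>U - K\<parallel>\<close> arbitrarily small, and the sets
  that can be squeezed between compact and open sets of small difference form a
  \<open>\<sigma>\<close>-algebra. This permits extending \<open>T\<close> directly to Borel simple functions, by bounded
  approximation off open sets of small semivariation, and the values \<open>T (1\<^sub>A x)\<close> define the
  i-measure.

  Conversely, the semivariation of an i-measure is finite and continuous at the empty set:
  otherwise blocks of a disjoint sequence would contradict independent convergence. For a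
  regular i-measure this makes Urysohn functions nearly norming, whence the equality of norms;
  applied to a difference of two i-measures it also gives uniqueness.
\<close>

section \<open>The Hahn--Banach theorem\<close>

text \<open>The obstacle is that \<open>T\<close> sees only continuous functions. Its semivariation
  \<open>ov\<close> is defined through them and is subadditive only on open sets, so every error has
  to be confined to an open set \<open>V\<close>. There nothing but a norm bound \<open>C\<close> on
  the approximant helps, at a cost of \<open>C * ov V\<close>; hence \<open>C\<close> must be
  independent of the error. With such a bound the extended value is unique, and neither the bidual
  of the space of continuous functions nor a scalar Riesz theorem is required. Rosenthal's lemma
  enters because functionals chosen separately for the vectors \<open>T g\<^sub>n\<close> are
  unrelated to each other. After thinning, each functional sees essentially its own vector only, so
  one coefficient can be read off an infinite weak sum. Duality is handled with real functionals
  throughout: taking real parts identifies the dual over \<open>'k\<close> isometrically with the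
  real dual. Countable additivity comes from compactness: compact sets inside Borel sets that
  decrease to the empty set have empty intersection, so finitely many of them already do.\<close>

definition sublinear :: "('a::real_vector \<Rightarrow> real) \<Rightarrow> bool"
  where "sublinear p \<longleftrightarrow>
    (\<forall>x y. p (x + y) \<le> p x + p y) \<and> (\<forall>t x. 0 \<le> t \<longrightarrow> p (t *\<^sub>R x) = t * p x)"

lemma sublinear_zero: "sublinear p \<Longrightarrow> p 0 = 0"
  unfolding sublinear_def by (metis mult_zero_left order_refl scaleR_zero_left)

lemma sublinear_minus: "sublinear p \<Longrightarrow> - p (- x) \<le> p x"
proof -
  assume p: "sublinear p"
  then have "p (x + - x) \<le> p x + p (- x)" unfolding sublinear_def by blast
  then show ?thesis using sublinear_zero[OF p] by simp
qed

text \<open>\<open>q\<close> is the largest sublinear functional below \<open>p\<close> with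
  \<open>q (- x0) \<le> - p x0\<close>. If \<open>q = p\<close>, then \<open>p\<close> is odd at
  \<open>x0\<close>; so the lemma drives both the linearity of a minimal functional and the
  prescription of a value at one point.\<close>

lemma sublinear_decrease:
  assumes p: "sublinear p"
  obtains q where "sublinear q" "\<And>x. q x \<le> p x" "q (- x0) \<le> - p x0"
proof -
  define g where "g y t = p (y + t *\<^sub>R x0) - t * p x0" for y t
  define q where "q y = (INF t\<in>{0..}. g y t)" for y
  have add: "p (x + y) \<le> p x + p y" and hom: "0 \<le> t \<Longrightarrow> p (t *\<^sub>R x) = t * p x" for x y t
    using p unfolding sublinear_def by auto
  have lower: "- p (- y) \<le> g y t" if "0 \<le> t" for y t
    using add[of "y + t *\<^sub>R x0" "- y"] hom[OF that, of x0] by (simp add: g_def)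
  then have bdd: "bdd_below (g y ` {0..})" for y
    by (intro bdd_belowI2) auto
  have q_le: "q y \<le> g y t" if "0 \<le> t" for y t
    unfolding q_def using that by (intro cINF_lower[OF bdd]) auto
  have q_ge: "c \<le> q y" if "\<And>t. 0 \<le> t \<Longrightarrow> c \<le> g y t" for c y
    unfolding q_def using that by (intro cINF_greatest) auto
  have q_add: "q (x + y) \<le> q x + q y" for x y
  proof -
    have "q (x + y) - g x s \<le> g y t" if "0 \<le> s" "0 \<le> t" for s t
    proof -
      have "q (x + y) \<le> g (x + y) (s + t)"
        using that by (intro q_le) auto
      also have "\<dots> \<le> g x s + g y t"
        using add[of "x + s *\<^sub>R x0" "y + t *\<^sub>R x0"] unfolding g_def by (simp add: algebra_simps)
      finally show ?thesis by simp
    qed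
    then have "q (x + y) - g x s \<le> q y" if "0 \<le> s" for s
      using that by (intro q_ge) auto
    then have "q (x + y) - q y \<le> q x"
      by (intro q_ge) (smt (verit))
    then show ?thesis by simp
  qed
  have q_hom_le: "q (s *\<^sub>R y) \<le> s * q y" if "0 < s" for s y
  proof -
    have "q (s *\<^sub>R y) / s \<le> g y t" if t: "0 \<le> t" for t
    proof -
      have "q (s *\<^sub>R y) \<le> g (s *\<^sub>R y) (s * t)"
        using t \<open>0 < s\<close> by (intro q_le) auto
      also have "\<dots> = s * g y t"
        using hom[of s "y + t *\<^sub>R x0"] \<open>0 < s\<close> unfolding g_def by (simp add: algebra_simps)
      finally show ?thesis
        using \<open>0 < s\<close> by (simp add: field_simps)
    qed
    then have "q (s *\<^sub>R y) / s \<le> q y"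
      by (rule q_ge)
    then show ?thesis
      using that by (simp add: field_simps)
  qed
  have q_hom: "q (s *\<^sub>R y) = s * q y" if "0 \<le> s" for s y
  proof (cases "s = 0")
    case True
    have "q 0 = 0"
      using q_le[of 0 0] q_ge[of 0 0] hom sublinear_zero[OF p] unfolding g_def by fastforce
    with True show ?thesis by simp
  next
    case False
    then have "0 < s" using that by simp
    moreover have "q y \<le> inverse s * q (s *\<^sub>R y)"
      using q_hom_le[of "inverse s" "s *\<^sub>R y"] \<open>0 < s\<close> by simp
    ultimately show ?thesis
      using q_hom_le[of s y] by (simp add: field_simps)
  qed
  show thesis
  proof
    show "sublinear q"
      unfolding sublinear_def using q_add q_hom by blast
    show "q x \<le> p x" for x
      using q_le[of 0 x] by (simp add: g_def)
    show "q (- x0) \<le> - p x0"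
      using q_le[of 1 "- x0"] sublinear_zero[OF p] by (simp add: g_def)
  qed
qed

text \<open>A minimal sublinear functional below \<open>p\<close> is odd, as
  \<open>sublinear_decrease\<close> could otherwise lower it, and an odd sublinear functional is
  linear. Minimal ones exist by Zorn's lemma: the pointwise infimum of a chain is finite because the
  members stay above \<open>- p (- x)\<close>.\<close>

lemma sublinear_dominates_linear:
  assumes p: "sublinear p"
  obtains f where "linear f" "\<And>x. f x \<le> p x"
proof -
  define A where "A = {q. sublinear q \<and> q \<le> p}"
  \<comment> \<open>The order is reversed: Zorn's lemma yields maximal elements, and a minimal
    functional is sought.\<close>
  define P :: "('a \<Rightarrow> real) \<Rightarrow> ('a \<Rightarrow> real) \<Rightarrow> bool" where "P a b \<longleftrightarrow> b \<le> a" for a b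
  have po: "partial_order_on A (relation_of P A)"
    by (rule partial_order_on_relation_ofI) (auto simp: P_def)
  have ch: "\<exists>u\<in>A. \<forall>a\<in>C. P a u" if C: "C \<in> Chains (relation_of P A)" for C
  proof (cases "C = {}")
    case True
    then show ?thesis using p by (auto simp: A_def)
  next
    case False
    have CA: "C \<subseteq> A"
      using C by (auto simp: Chains_def relation_of_def)
    have tot: "a \<le> b \<or> b \<le> a" if "a \<in> C" "b \<in> C" for a b
      using C that by (auto simp: Chains_def relation_of_def P_def)
    define u where "u x = (INF q\<in>C. q x)" for x
    have bdd: "bdd_below ((\<lambda>q. q x) ` C)" for x
    proof (rule bdd_belowI2)
      fix q assume "q \<in> C"
      then have q: "sublinear q" "q \<le> p" using CA by (auto simp: A_def)
      then show "- p (- x) \<le> q x"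
        using sublinear_minus[OF q(1), of x] le_funD[OF q(2), of "- x"] by simp
    qed
    have u_le: "u x \<le> q x" if "q \<in> C" for q x
      unfolding u_def using that by (intro cINF_lower[OF bdd])
    have u_ge: "c \<le> u x" if "\<And>q. q \<in> C \<Longrightarrow> c \<le> q x" for c x
      unfolding u_def using that False by (intro cINF_greatest) auto
    have "sublinear u"
      unfolding sublinear_def
    proof (intro conjI allI impI)
      fix x y
      have "u (x + y) - a x \<le> b y" if ab: "a \<in> C" "b \<in> C" for a b
      proof -
        obtain c where c: "c \<in> C" "c \<le> a" "c \<le> b"
          using tot[OF ab] ab by auto
        then have "sublinear c" using CA by (auto simp: A_def)
        then have "c (x + y) \<le> c x + c y" by (auto simp: sublinear_def)
        then show ?thesis
          using u_le[OF c(1), of "x + y"] le_funD[OF c(2), of x] le_funD[OF c(3), of y] by simp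
      qed
      then have "u (x + y) - a x \<le> u y" if "a \<in> C" for a
        using that by (intro u_ge) auto
      then have "u (x + y) - u y \<le> u x"
        by (intro u_ge) (smt (verit))
      then show "u (x + y) \<le> u x + u y" by simp
    next
      fix t :: real and x assume "0 \<le> t"
      then have hom: "q (t *\<^sub>R x) = t * q x" if "q \<in> C" for q
        using CA that by (auto simp: A_def sublinear_def)
      show "u (t *\<^sub>R x) = t * u x"
      proof (cases "t = 0")
        case True
        then show ?thesis
          using INF_cong[OF refl hom, of C "\<lambda>q. q"] \<open>C \<noteq> {}\<close> by (simp add: u_def)
      next
        case False
        then have "0 < t" using \<open>0 \<le> t\<close> by simp
        have "u (t *\<^sub>R x) / t \<le> u x"
        proof (rule u_ge)
          fix q assume "q \<in> C"
          then show "u (t *\<^sub>R x) / t \<le> q x"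
            using u_le[of q "t *\<^sub>R x"] hom[of q] \<open>0 < t\<close> by (simp add: field_simps)
        qed
        moreover have "t * u x \<le> u (t *\<^sub>R x)"
        proof (rule u_ge)
          fix q assume "q \<in> C"
          then show "t * u x \<le> q (t *\<^sub>R x)"
            using u_le[of q x] hom[of q] \<open>0 < t\<close> by (simp add: mult_left_mono)
        qed
        ultimately show ?thesis
          using \<open>0 < t\<close> by (simp add: field_simps)
      qed
    qed
    moreover have "u \<le> p"
    proof -
      obtain q where "q \<in> C" using False by auto
      then have "q \<le> p" using CA by (auto simp: A_def)
      then show ?thesis using u_le[OF \<open>q \<in> C\<close>] by (meson le_fun_def order_trans)
    qed
    ultimately show ?thesis
      using u_le by (auto simp: A_def P_def le_fun_def)
  qed
  obtain f where f: "sublinear f" "f \<le> p" and min: "\<And>q. sublinear q \<Longrightarrow> q \<le> f \<Longrightarrow> q = f"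
  proof -
    obtain f where "f \<in> A" "\<forall>a\<in>A. P f a \<longrightarrow> a = f"
      using predicate_Zorn[OF po ch] by blast
    then show thesis
      using that[of f] by (auto simp: A_def P_def intro: order_trans)
  qed
  have neg: "f (- x) = - f x" for x
  proof -
    obtain q where "sublinear q" "\<And>x. q x \<le> f x" "q (- x) \<le> - f x"
      using sublinear_decrease[OF f(1)] by blast
    then have "f (- x) \<le> - f x"
      using min[of q] by (auto simp: le_fun_def)
    then show ?thesis
      using sublinear_minus[OF f(1), of x] by simp
  qed
  have add_le: "f (x + y) \<le> f x + f y" for x y
    using f(1) by (auto simp: sublinear_def)
  have add: "f (x + y) = f x + f y" for x y
    using add_le[of x y] add_le[of "x + y" "- y"] neg[of y] by simp
  have "f (t *\<^sub>R x) = t *\<^sub>R f x" for t x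
  proof (cases "0 \<le> t")
    case True
    then show ?thesis using f(1) by (auto simp: sublinear_def)
  next
    case False
    then have "0 \<le> - t" by simp
    then have "f ((- t) *\<^sub>R x) = (- t) * f x" using f(1) unfolding sublinear_def by blast
    then show ?thesis using neg[of "t *\<^sub>R x"] by simp
  qed
  then have "linear f"
    using add by (intro linearI) auto
  then show thesis
    using that f(2) by (auto simp: le_fun_def)
qed

text \<open>The distance to \<open>S\<close> is itself sublinear, so no extension from a subspace is
  carried out: a linear \<open>f\<close> below it vanishes on \<open>S\<close> and has norm at most
  one. Lowering it at \<open>x0\<close> first, by \<open>sublinear_decrease\<close>, forces
  \<open>f x0\<close> to be the full distance.\<close>

theorem Hahn_Banach_infdist:
  fixes S :: "'a::real_normed_vector set"
  assumes S: "subspace S"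
  obtains \<phi> :: "'a \<Rightarrow>\<^sub>L real"
  where "norm \<phi> \<le> 1" "\<And>x. x \<in> S \<Longrightarrow> \<phi> x = 0" "\<phi> x0 = infdist x0 S"
proof -
  define p where "p x = infdist x S" for x
  have ne: "S \<noteq> {}" using subspace_0[OF S] by auto
  have p_le: "p x \<le> dist x s" if "s \<in> S" for x s
    unfolding p_def using that by (rule infdist_le)
  have p_ge: "c \<le> p x" if "\<And>s. s \<in> S \<Longrightarrow> c \<le> dist x s" for c x
    unfolding p_def using ne that by (auto simp: infdist_def intro!: cINF_greatest)
  have p_norm: "p x \<le> norm x" for x
    using p_le[OF subspace_0[OF S]] by simp
  have p0: "p x = 0" if "x \<in> S" for x
    using p_le[OF that, of x] infdist_nonneg[of x S] by (simp add: p_def)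
  have hom_le: "p (t *\<^sub>R x) \<le> t * p x" if "0 < t" for t x
  proof -
    have "p (t *\<^sub>R x) / t \<le> p x"
    proof (rule p_ge)
      fix s assume "s \<in> S"
      then have "p (t *\<^sub>R x) \<le> dist (t *\<^sub>R x) (t *\<^sub>R s)"
        using subspace_scale[OF S] by (intro p_le) auto
      also have "\<dots> = t * dist x s"
        using that by (simp add: dist_norm flip: scaleR_right_diff_distrib)
      finally show "p (t *\<^sub>R x) / t \<le> dist x s"
        using that by (simp add: field_simps)
    qed
    then show ?thesis using that by (simp add: field_simps)
  qed
  have "sublinear p"
    unfolding sublinear_def
  proof (intro conjI allI impI)
    fix x y
    have "p (x + y) - dist x s \<le> dist y s'" if "s \<in> S" "s' \<in> S" for s s'
      using p_le[OF subspace_add[OF S that], of "x + y"] dist_triangle_add[of x y s s'] by simp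
    then have "p (x + y) - dist x s \<le> p y" if "s \<in> S" for s
      using that by (intro p_ge) auto
    then have "p (x + y) - p y \<le> p x"
      by (intro p_ge) (smt (verit))
    then show "p (x + y) \<le> p x + p y" by simp
  next
    fix t :: real and x assume "0 \<le> t"
    show "p (t *\<^sub>R x) = t * p x"
    proof (cases "t = 0")
      case True
      then show ?thesis using p0[OF subspace_0[OF S]] by simp
    next
      case False
      then have t: "0 < t" using \<open>0 \<le> t\<close> by simp
      have "p x \<le> inverse t * p (t *\<^sub>R x)"
        using hom_le[of "inverse t" "t *\<^sub>R x"] t by simp
      then show ?thesis
        using hom_le[OF t, of x] t by (simp add: field_simps)
    qed
  qed
  from sublinear_decrease[OF this, of x0] obtain q
    where q: "sublinear q" "\<And>x. q x \<le> p x" "q (- x0) \<le> - p x0" by blast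
  obtain f where f: "linear f" "\<And>x. f x \<le> q x"
    using sublinear_dominates_linear[OF q(1)] by blast
  have fp: "f x \<le> p x" for x
    using f(2) q(2) order_trans by blast
  have fneg: "f (- x) = - f x" for x
    using f(1) by (rule linear_neg)
  have bound: "\<bar>f x\<bar> \<le> norm x" for x
    using fp[of x] fp[of "- x"] p_norm[of x] p_norm[of "- x"] fneg[of x] by simp
  have bl: "bounded_linear f"
    using f(1) bound
    by (intro bounded_linear_intro[where K=1]) (auto simp: linear_add linear_scale)
  define \<phi> where "\<phi> = Blinfun f"
  have app: "blinfun_apply \<phi> = f"
    using bl by (simp add: \<phi>_def bounded_linear_Blinfun_apply)
  show thesis
  proof
    show "norm \<phi> \<le> 1"
      by (rule norm_blinfun_bound) (use bound app in auto)
    show "\<phi> x = 0" if "x \<in> S" for x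
      using fp[of x] fp[of "- x"] p0[OF that] p0[OF subspace_neg[OF S that]] fneg[of x] app by simp
    have "f x0 \<ge> p x0"
      using f(2)[of "- x0"] q(3) fneg[of x0] by simp
    then show "\<phi> x0 = infdist x0 S"
      using fp[of x0] app by (simp add: p_def)
  qed
qed

corollary norming_functional:
  fixes x :: "'a::real_normed_vector"
  obtains \<phi> :: "'a \<Rightarrow>\<^sub>L real" where "norm \<phi> \<le> 1" "\<phi> x = norm x"
  using Hahn_Banach_infdist[of "{0::'a}" x] subspace_single_0 by auto

section \<open>Scalar and real functionals\<close>

text \<open>Treats both fields at once: over the reals \<open>j\<close> and \<open>im\<close> are
  zero, so the decomposition and the formula for \<open>im\<close> hold for either field.\<close>

lemma real_or_complex_coordinates:
  obtains re im :: "'k::real_or_complex \<Rightarrow>\<^sub>L real" and j :: 'k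
  where "\<And>z. z = re z *\<^sub>R 1 + im z *\<^sub>R j" "\<And>z. im z = - re (j * z)"
    "\<And>a. re (a *\<^sub>R 1) = a" "norm re \<le> 1" "j * j = - 1 \<or> j = 0" "j = 0 \<Longrightarrow> im = 0"
proof -
  consider (r) "\<forall>z::'k. \<exists>a. z = a *\<^sub>R 1"
    | (c) j :: 'k where "j * j = - 1" "\<forall>z. \<exists>a b. z = a *\<^sub>R 1 + b *\<^sub>R j"
       "\<forall>a b. norm (a *\<^sub>R 1 + b *\<^sub>R j) = sqrt (a * a + b * b)"
    using real_or_complex[where 'a='k] by blast
  then show thesis
  proof cases
    case r
    then obtain f where f: "\<And>z::'k. z = f z *\<^sub>R 1" by metis
    have fe: "f (a *\<^sub>R 1) = a" for a
      using f[of "a *\<^sub>R 1"] by simp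
    have bl: "bounded_linear f"
    proof (rule bounded_linear_intro[where K=1])
      fix x y :: 'k and c :: real
      show "f (x + y) = f x + f y"
        using fe[of "f x + f y"] f[of x] f[of y] by (simp add: scaleR_left_distrib)
      show "f (c *\<^sub>R x) = c *\<^sub>R f x"
        using fe[of "c * f x"] f[of x] by (metis real_scaleR_def scaleR_scaleR)
      show "norm (f x) \<le> norm x * 1"
        using arg_cong[OF f[of x], of norm] by simp
    qed
    then have app: "blinfun_apply (Blinfun f) = f"
      by (rule bounded_linear_Blinfun_apply)
    show thesis
    proof (rule that[of "Blinfun f" 0 0])
      show "norm (Blinfun f) \<le> 1"
      proof (rule norm_blinfun_bound)
        show "norm (blinfun_apply (Blinfun f) z) \<le> 1 * norm z" for z
          using arg_cong[OF f[of z], of norm] by (simp add: app)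
      qed simp
      show "z = blinfun_apply (Blinfun f) z *\<^sub>R 1 + blinfun_apply 0 z *\<^sub>R 0" for z
        unfolding app using f[of z] by (metis add.right_neutral scaleR_zero_right)
      show "blinfun_apply 0 z = - blinfun_apply (Blinfun f) (0 * z)" for z
        by (simp add: blinfun.zero_left blinfun.zero_right)
      show "blinfun_apply (Blinfun f) (a *\<^sub>R 1) = a" for a
        unfolding app by (rule fe)
    qed simp_all
  next
    case c
    then obtain f g where fg: "\<And>z::'k. z = f z *\<^sub>R 1 + g z *\<^sub>R j" by metis
    have uniq: "a = a' \<and> b = b'" if "a *\<^sub>R 1 + b *\<^sub>R j = a' *\<^sub>R 1 + b' *\<^sub>R j" for a b a' b'
    proof -
      have "sqrt ((a - a') * (a - a') + (b - b') * (b - b')) = 0"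
        using c(3)[rule_format, of "a - a'" "b - b'"] that by (simp add: algebra_simps)
      then show ?thesis
        by (simp add: sum_squares_eq_zero_iff)
    qed
    have fe: "f (a *\<^sub>R 1 + b *\<^sub>R j) = a" and ge: "g (a *\<^sub>R 1 + b *\<^sub>R j) = b" for a b
      using uniq fg by metis+
    have nz: "norm z = sqrt (f z * f z + g z * g z)" for z
      using fg c(3) by metis
    have fn: "\<bar>f z\<bar> \<le> norm z" and gn: "\<bar>g z\<bar> \<le> norm z" for z
      unfolding nz by (auto intro!: real_le_rsqrt simp: power2_eq_square)
    have add: "f (x + y) = f x + f y" "g (x + y) = g x + g y" for x y
    proof -
      have "x + y = (f x + f y) *\<^sub>R 1 + (g x + g y) *\<^sub>R j"
        using fg[of x] fg[of y] by (smt (verit) add.assoc add.commute scaleR_left_distrib)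
      then show "f (x + y) = f x + f y" "g (x + y) = g x + g y"
        by (simp_all only: fe ge)
    qed
    have scl: "f (a *\<^sub>R x) = a * f x" "g (a *\<^sub>R x) = a * g x" for a x
    proof -
      have "a *\<^sub>R x = (a * f x) *\<^sub>R 1 + (a * g x) *\<^sub>R j"
        using fg[of x] by (metis scaleR_right_distrib scaleR_scaleR)
      then show "f (a *\<^sub>R x) = a * f x" "g (a *\<^sub>R x) = a * g x"
        by (simp_all only: fe ge)
    qed
    have bl: "bounded_linear f" "bounded_linear g"
      by (rule bounded_linear_intro[where K=1]; use add scl fn gn in simp)+
    then have app: "blinfun_apply (Blinfun f) = f" "blinfun_apply (Blinfun g) = g"
      by (auto simp: bounded_linear_Blinfun_apply)
    show thesis
    proof (rule that[of "Blinfun f" "Blinfun g" j])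
      show "norm (Blinfun f) \<le> 1"
        by (rule norm_blinfun_bound) (use fn in \<open>auto simp: app\<close>)
      show "blinfun_apply (Blinfun g) z = - blinfun_apply (Blinfun f) (j * z)" for z
      proof -
        have "j * z = (- g z) *\<^sub>R 1 + f z *\<^sub>R j"
          by (subst fg[of z]) (simp add: c(1) distrib_left)
        then show ?thesis by (simp only: fe app)
      qed
      show "blinfun_apply (Blinfun f) (a *\<^sub>R 1) = a" for a
        using fe[of a 0] by (simp add: app)
      show "Blinfun g = 0" if "j = 0" using c(1) that by simp
    qed (use fg c(1) in \<open>auto simp: app\<close>)
  qed
qed

lemma linops_apply:
  assumes "T \<in> linops sA sB"
  shows "T (sA c x) = sB c (T x)"
proof -
  interpret Vector_Spaces.linear sA sB "blinfun_apply T"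
    using assms by (simp add: linops_def)
  show ?thesis by (rule scale)
qed

lemma linopsI:
  fixes T :: "'a::real_normed_vector \<Rightarrow>\<^sub>L 'b::real_normed_vector"
  assumes "normed_over sA" "normed_over sB" "\<And>c x. T (sA c x) = sB c (T x)"
  shows "T \<in> linops sA sB"
proof -
  interpret A: normed_over sA by fact
  interpret B: normed_over sB by fact
  have "Vector_Spaces.linear sA sB (blinfun_apply T)"
    by unfold_locales (auto simp: blinfun.add_right assms(3))
  then show ?thesis by (simp add: linops_def)
qed

lemma bounded_linear_scale:
  assumes "normed_over s"
  shows "bounded_linear (s c)"
proof -
  interpret normed_over s by fact
  show ?thesis
  proof (rule bounded_linear_intro)
    show "s c (x + y) = s c x + s c y" for x y by (rule scale_right_distrib)
    show "s c (r *\<^sub>R x) = r *\<^sub>R s c x" for r x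
      by (metis scale_of_real scale_left_commute)
    show "norm (s c x) \<le> norm x * norm c" for x by (simp add: norm_scale)
  qed
qed

lemma normed_over_scalar: "normed_over ((*) :: 'k::real_or_complex \<Rightarrow> 'k \<Rightarrow> 'k)"
  by unfold_locales (auto simp: algebra_simps norm_mult scaleR_conv_of_real)

text \<open>A scalar functional is determined by its real part:
  \<open>\<psi> x = Re \<psi> x - i Re \<psi> (i x)\<close>.\<close>

lemma real_part_dual:
  fixes s :: "'k::real_or_complex \<Rightarrow> 'a::real_normed_vector \<Rightarrow> 'a"
  assumes "normed_over s"
  obtains re :: "'k \<Rightarrow>\<^sub>L real"
  where "bij_betw (\<lambda>\<psi>. re o\<^sub>L \<psi>) (dual s) UNIV" "\<And>\<psi>. \<psi> \<in> dual s \<Longrightarrow> norm (re o\<^sub>L \<psi>) = norm \<psi>"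
proof -
  interpret normed_over s by fact
  obtain re im :: "'k \<Rightarrow>\<^sub>L real" and j :: 'k
  where z: "\<And>z. z = re z *\<^sub>R 1 + im z *\<^sub>R j" and im: "\<And>z. im z = - re (j * z)"
    and re1: "\<And>a. re (a *\<^sub>R 1) = a" and nre: "norm re \<le> 1" and j: "j * j = - 1 \<or> j = 0"
    and im0: "j = 0 \<Longrightarrow> im = 0"
    using real_or_complex_coordinates by metis
  have psi: "\<psi> x = re (\<psi> x) *\<^sub>R 1 - re (\<psi> (s j x)) *\<^sub>R j" if "\<psi> \<in> dual s" for \<psi> :: "'a \<Rightarrow>\<^sub>L 'k" and x
    using z[of "\<psi> x"] im[of "\<psi> x"] linops_apply[of \<psi> s "(*)" j x] that by (simp add: dual_def)
  have inj: "inj_on (\<lambda>\<psi>. re o\<^sub>L \<psi>) (dual s)"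
  proof (rule inj_onI)
    fix \<psi> \<psi>' assume "\<psi> \<in> dual s" "\<psi>' \<in> dual s" "re o\<^sub>L \<psi> = re o\<^sub>L \<psi>'"
    then have "re (\<psi> x) = re (\<psi>' x)" for x
      by (metis blinfun_apply_blinfun_compose)
    then show "\<psi> = \<psi>'"
      using psi[OF \<open>\<psi> \<in> dual s\<close>] psi[OF \<open>\<psi>' \<in> dual s\<close>] by (metis blinfun_eqI)
  qed
  have nrm: "norm (re o\<^sub>L \<psi>) = norm \<psi>" if psi: "\<psi> \<in> dual s" for \<psi>
  proof (rule antisym)
    show "norm (re o\<^sub>L \<psi>) \<le> norm \<psi>"
      using norm_blinfun_compose[of re \<psi>] nre mult_right_mono[OF nre norm_ge_zero[of \<psi>]] by simp
    show "norm \<psi> \<le> norm (re o\<^sub>L \<psi>)"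
    proof (rule norm_blinfun_bound)
      fix x
      define w where "w = \<psi> x"
      show "norm (\<psi> x) \<le> norm (re o\<^sub>L \<psi>) * norm x"
      proof (cases "w = 0")
        case False
        \<comment> \<open>Multiplying by the unimodular \<open>c\<close> rotates \<open>w\<close>
          onto the nonnegative reals, where \<open>re\<close> loses nothing of the norm.\<close>
        define c where "c = of_real (norm w) / w"
        have nc: "norm c = 1" using False by (simp add: c_def norm_divide)
        have "\<psi> (s c x) = c * w"
          using psi linops_apply unfolding dual_def w_def by blast
        also have "\<dots> = norm w *\<^sub>R 1" using False by (simp add: c_def scaleR_conv_of_real)
        finally have "(re o\<^sub>L \<psi>) (s c x) = norm w" using re1 by simp
        then have "norm w \<le> norm (re o\<^sub>L \<psi>) * norm (s c x)"
          using norm_blinfun[of "re o\<^sub>L \<psi>" "s c x"] by simp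
        then show ?thesis by (simp add: norm_scale nc w_def)
      qed (simp add: w_def[symmetric])
    qed simp
  qed
  have surj: "\<exists>\<psi>\<in>dual s. \<phi> = re o\<^sub>L \<psi>" for \<phi> :: "'a \<Rightarrow>\<^sub>L real"
  proof -
    \<comment> \<open>The formula for \<open>\<psi>\<close> read backwards; for \<open>j = 0\<close>
      it is \<open>\<phi>\<close> itself with values moved into \<open>'k\<close>.\<close>
    define f where "f x = \<phi> x *\<^sub>R (1::'k) - \<phi> (s j x) *\<^sub>R j" for x
    have sjR: "s j (a *\<^sub>R x) = a *\<^sub>R s j x" for a x
      by (metis scale_of_real scale_left_commute)
    have f_add: "f (x + y) = f x + f y" for x y
      by (simp add: f_def blinfun.add_right scale_right_distrib scaleR_left_distrib)
    have f_R: "f (a *\<^sub>R x) = a *\<^sub>R f x" for a x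
      by (simp add: f_def blinfun.scaleR_right sjR scaleR_right_diff_distrib)
    have f_j: "f (s j x) = j * f x" for x
      using j
    proof
      assume "j = 0"
      then show ?thesis by (simp add: f_def)
    next
      assume jj: "j * j = - 1"
      have "s j (s j x) = - x" by (simp add: jj)
      then show ?thesis by (simp add: f_def jj blinfun.minus_right right_diff_distrib)
    qed
    have f_s: "f (s c x) = c * f x" for c x
    proof -
      have "s c x = s (re c *\<^sub>R 1 + im c *\<^sub>R j) x" using z by metis
      also have "\<dots> = re c *\<^sub>R x + im c *\<^sub>R s j x"
        by (metis scale_left_distrib scaleR_conv_of_real scale_scale scale_of_real mult.right_neutral)
      finally have "f (s c x) = re c *\<^sub>R f x + im c *\<^sub>R (j * f x)"
        by (simp add: f_add f_R f_j)
      also have "\<dots> = (re c *\<^sub>R 1 + im c *\<^sub>R j) * f x" by (simp add: algebra_simps)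
      finally show ?thesis using z by metis
    qed
    have bl: "bounded_linear f"
    proof (rule bounded_linear_intro[OF f_add f_R])
      fix x
      have "norm (f x) \<le> \<bar>\<phi> x\<bar> + \<bar>\<phi> (s j x)\<bar> * norm j"
        unfolding f_def using norm_triangle_ineq4[of "\<phi> x *\<^sub>R (1::'k)" "\<phi> (s j x) *\<^sub>R j"] by simp
      also have "\<dots> \<le> norm \<phi> * norm x + norm \<phi> * (norm j * norm x) * norm j"
        using norm_blinfun[of \<phi> x] norm_blinfun[of \<phi> "s j x"]
        by (intro add_mono mult_right_mono) (auto simp: norm_scale)
      finally show "norm (f x) \<le> norm x * (norm \<phi> + norm \<phi> * norm j * norm j)"
        by (simp add: algebra_simps)
    qed
    then have app: "blinfun_apply (Blinfun f) = f" by (rule bounded_linear_Blinfun_apply)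
    have "Blinfun f \<in> dual s"
      unfolding dual_def by (rule linopsI[OF assms normed_over_scalar]) (simp add: app f_s)
    moreover have "re (f x) = \<phi> x" for x
    proof -
      have "re (f x) = \<phi> x - \<phi> (s j x) * re j"
        using re1[of "\<phi> x"] by (simp add: f_def blinfun.diff_right blinfun.scaleR_right)
      \<comment> \<open>For \<open>j \<noteq> 0\<close>, the coordinate formula at \<open>1\<close>
        gives \<open>im 1 = 0\<close>, and \<open>im 1 = - re j\<close>.\<close>
      moreover have "re j = 0"
      proof (cases "j = 0")
        case False
        have "im 1 *\<^sub>R j = 0"
          using z[of 1] re1[of 1] by (metis add_cancel_right_right scaleR_one)
        with False have "im 1 = 0" by simp
        then show ?thesis using im[of 1] by simp
      qed simp
      ultimately show ?thesis by simp
    qed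
    then have "\<phi> = re o\<^sub>L Blinfun f" by (intro blinfun_eqI) (simp add: app)
    ultimately show ?thesis by blast
  qed
  show thesis
  proof (rule that[of re])
    show "bij_betw (\<lambda>\<psi>. re o\<^sub>L \<psi>) (dual s) UNIV"
      unfolding bij_betw_def using inj surj by blast
  qed (use nrm in auto)
qed

section \<open>Bounded finite sums\<close>

text \<open>Induction on the number \<open>n\<close> of portions of size \<open>\<epsilon>\<close>
  that bound the row sums. Split \<open>N\<close> into infinitely many infinite pieces. If no piece
  serves as \<open>J\<close>, each piece \<open>Np p\<close> has a row \<open>k p\<close> with more
  than \<open>\<epsilon>\<close> of its mass in \<open>Np p\<close> off the diagonal; on the set of
  these rows every row sum has lost one portion.\<close>

lemma Rosenthal_infinite:
  fixes a :: "nat \<Rightarrow> nat \<Rightarrow> real"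
  assumes nonneg: "\<And>i j. 0 \<le> a i j" and eps: "0 < \<epsilon>"
    and "infinite N" and "\<And>i F. i \<in> N \<Longrightarrow> finite F \<Longrightarrow> F \<subseteq> N \<Longrightarrow> sum (a i) F \<le> of_nat n * \<epsilon>"
  shows "\<exists>J\<subseteq>N. infinite J \<and> (\<forall>i\<in>J. \<forall>F. finite F \<longrightarrow> F \<subseteq> J - {i} \<longrightarrow> sum (a i) F \<le> \<epsilon>)"
  using assms(3,4)
proof (induction n arbitrary: N)
  case 0
  have "sum (a i) F \<le> \<epsilon>" if "i \<in> N" "finite F" "F \<subseteq> N - {i}" for i F
    using 0(2)[OF that(1,2)] that(3) eps by fastforce
  then show ?case using 0 by blast
next
  case (Suc n)
  define e where "e = enumerate N"
  have e_inj: "inj e" and e_in: "e k \<in> N" for k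
    using inj_enumerate[of N] enumerate_in_set[OF Suc(2)] Suc(2) by (auto simp: e_def)
  define Np where "Np p = (\<lambda>q. e (prod_encode (p, q))) ` UNIV" for p
  have Np_disj: "p = p'" if "x \<in> Np p" "x \<in> Np p'" for x p p'
    using that e_inj inj_prod_encode[of UNIV] by (fastforce simp: Np_def dest: injD)
  have Np_inf: "infinite (Np p)" for p
  proof -
    have "inj (\<lambda>q. e (prod_encode (p, q)))"
      by (rule injI) (simp add: inj_eq[OF e_inj] prod_encode_eq)
    then show ?thesis
      unfolding Np_def using range_inj_infinite by blast
  qed
  have Np_sub: "Np p \<subseteq> N" for p
    using e_in by (auto simp: Np_def)
  show ?case
  proof (cases "\<exists>p. \<forall>i\<in>Np p. \<forall>F. finite F \<longrightarrow> F \<subseteq> Np p - {i} \<longrightarrow> sum (a i) F \<le> \<epsilon>")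
    case True
    then obtain p where
      "\<forall>i\<in>Np p. \<forall>F. finite F \<longrightarrow> F \<subseteq> Np p - {i} \<longrightarrow> sum (a i) F \<le> \<epsilon>" ..
    then show ?thesis using Np_inf[of p] Np_sub[of p] by (intro exI[of _ "Np p"]) simp
  next
    case False
    then have "\<forall>p. \<exists>i F. i \<in> Np p \<and> finite F \<and> F \<subseteq> Np p - {i} \<and> \<epsilon> < sum (a i) F"
      by (metis not_le)
    then obtain k F where k: "\<And>p. k p \<in> Np p" and F: "\<And>p. finite (F p)"
        "\<And>p. F p \<subseteq> Np p - {k p}" "\<And>p. \<epsilon> < sum (a (k p)) (F p)"
      by metis
    define M where "M = range k"
    have "inj k"
      using k Np_disj by (metis injI)
    then have "infinite M"
      unfolding M_def by (rule range_inj_infinite)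
    moreover have MN: "M \<subseteq> N"
      using k Np_sub by (auto simp: M_def)
    moreover have "sum (a i) G \<le> of_nat n * \<epsilon>" if G: "i \<in> M" "finite G" "G \<subseteq> M" for i G
    proof -
      obtain p where p: "i = k p" using G(1) by (auto simp: M_def)
      \<comment> \<open>Distinct pieces are disjoint, so the only element of \<open>M\<close> in
        \<open>Np p\<close> is \<open>k p\<close>, which \<open>F p\<close> omits.\<close>
      have disj: "G \<inter> F p = {}"
      proof (rule equals0I)
        fix x assume x: "x \<in> G \<inter> F p"
        then obtain q where "x = k q" using G(3) by (auto simp: M_def)
        moreover have "x \<in> Np p - {k p}" using x F(2) by blast
        ultimately show False using k Np_disj by (metis DiffE singletonI)
      qed
      have "sum (a i) (G \<union> F p) \<le> of_nat (Suc n) * \<epsilon>"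
      proof (rule Suc.prems(2))
        show "G \<union> F p \<subseteq> N" using G(3) MN F(2)[of p] Np_sub[of p] by blast
      qed (use G MN F(1) in auto)
      then show ?thesis
        using F(3)[of p] sum.union_disjoint[OF G(2) F(1) disj, of "a i"] p
        by (simp add: algebra_simps)
    qed
    ultimately have "\<exists>J\<subseteq>M. infinite J \<and>
        (\<forall>i\<in>J. \<forall>F. finite F \<longrightarrow> F \<subseteq> J - {i} \<longrightarrow> sum (a i) F \<le> \<epsilon>)"
      by (intro Suc.IH)
    then show ?thesis using MN by (meson order_trans)
  qed
qed

lemma Rosenthal:
  fixes a :: "nat \<Rightarrow> nat \<Rightarrow> real"
  assumes nonneg: "\<And>i j. 0 \<le> a i j" and eps: "0 < \<epsilon>"
    and bound: "\<And>i F. finite F \<Longrightarrow> sum (a i) F \<le> C"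
  obtains r :: "nat \<Rightarrow> nat" where "strict_mono r"
    "\<And>i F. finite F \<Longrightarrow> i \<notin> F \<Longrightarrow> (\<Sum>j\<in>F. a (r i) (r j)) \<le> \<epsilon>"
proof -
  obtain n :: nat where n: "C \<le> of_nat n * \<epsilon>"
    using reals_Archimedean3[OF eps] less_imp_le by blast
  have "sum (a i) F \<le> of_nat n * \<epsilon>" if "finite F" for i :: nat and F :: "nat set"
    using bound[OF that] n by (rule order_trans)
  then have "\<exists>J\<subseteq>UNIV. infinite J \<and>
      (\<forall>i\<in>J. \<forall>F. finite F \<longrightarrow> F \<subseteq> J - {i} \<longrightarrow> sum (a i) F \<le> \<epsilon>)"
    by (intro Rosenthal_infinite[OF nonneg eps infinite_UNIV_nat])
  then obtain J where J: "infinite J"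
      "\<And>i F. i \<in> J \<Longrightarrow> finite F \<Longrightarrow> F \<subseteq> J - {i} \<Longrightarrow> sum (a i) F \<le> \<epsilon>"
    by auto
  define r where "r = enumerate J"
  have r: "strict_mono r" "\<And>i. r i \<in> J"
    using J(1) enumerate_in_set by (auto simp: r_def strict_mono_def enumerate_mono)
  have inj: "inj r" using r(1) by (rule strict_mono_imp_inj_on)
  show thesis
  proof (rule that[OF r(1)])
    fix i and F :: "nat set" assume F: "finite F" "i \<notin> F"
    have "(\<Sum>j\<in>F. a (r i) (r j)) = sum (a (r i)) (r ` F)"
      using inj by (simp add: sum.reindex inj_on_def)
    also have "\<dots> \<le> \<epsilon>"
      using F r(2) inj by (intro J(2)) (auto simp: inj_def)
    finally show "(\<Sum>j\<in>F. a (r i) (r j)) \<le> \<epsilon>" .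
  qed
qed

text \<open>Split \<open>F\<close> by the sign of \<open>f\<close>; each half contributes at most
  \<open>C\<close>, hence the factor two.\<close>

lemma sum_abs_le_subset_sums:
  fixes f :: "'a \<Rightarrow> real"
  assumes "finite F" "\<And>G. G \<subseteq> F \<Longrightarrow> \<bar>sum f G\<bar> \<le> C"
  shows "(\<Sum>j\<in>F. \<bar>f j\<bar>) \<le> 2 * C"
proof -
  let ?P = "{j\<in>F. 0 \<le> f j}" and ?N = "{j\<in>F. f j < 0}"
  have F: "F = ?P \<union> ?N" by auto
  have "(\<Sum>j\<in>F. \<bar>f j\<bar>) = (\<Sum>j\<in>?P. \<bar>f j\<bar>) + (\<Sum>j\<in>?N. \<bar>f j\<bar>)"
    by (subst F, rule sum.union_disjoint) (use assms(1) in auto)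
  also have "\<dots> = sum f ?P - sum f ?N"
    by (simp add: sum_negf[symmetric])
  also have "\<dots> \<le> C + C"
    using assms(2)[of ?P] assms(2)[of ?N] by auto
  finally show ?thesis by simp
qed

text \<open>The use of bounded finite sums: under every functional the series becomes absolutely
  summable, with a bound proportional to that on the norm of the functional.\<close>

lemma blinfun_sum_abs_bounded:
  fixes z :: "nat \<Rightarrow> 'f::real_normed_vector" and \<phi> :: "'f \<Rightarrow>\<^sub>L real"
  assumes "\<And>F. finite F \<Longrightarrow> norm (sum z F) \<le> C" "norm \<phi> \<le> B" "finite F"
  shows "(\<Sum>j\<in>F. \<bar>\<phi> (z j)\<bar>) \<le> 2 * (B * C)"
proof (rule sum_abs_le_subset_sums[OF assms(3)])
  fix G assume "G \<subseteq> F"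
  then have "finite G" using assms(3) finite_subset by blast
  have "\<bar>\<Sum>j\<in>G. \<phi> (z j)\<bar> = norm (\<phi> (sum z G))"
    by (simp add: blinfun.sum_right)
  also have "\<dots> \<le> norm \<phi> * norm (sum z G)" by (rule norm_blinfun)
  also have "\<dots> \<le> B * C"
    using assms(1)[OF \<open>finite G\<close>] assms(2) order_trans[OF norm_ge_zero assms(2)]
    by (intro mult_mono) auto
  finally show "\<bar>\<Sum>j\<in>G. \<phi> (z j)\<bar> \<le> B * C" .
qed

text \<open>Rosenthal's lemma for the matrix of the values
  \<open>\<bar>\<phi> i (z j)\<bar>\<close>, whose row sums are at most \<open>2 * C\<close>. The
  bound on finite sums is restated along \<open>r\<close> because the thinned sequence replaces
  \<open>z\<close> from then on.\<close>

lemma almost_biorthogonal_subsequence: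
  fixes z :: "nat \<Rightarrow> 'f::real_normed_vector" and \<phi> :: "nat \<Rightarrow> 'f \<Rightarrow>\<^sub>L real"
  assumes "\<And>F. finite F \<Longrightarrow> norm (sum z F) \<le> C" "\<And>i. norm (\<phi> i) \<le> 1" "0 < \<epsilon>"
  shows "\<exists>r :: nat \<Rightarrow> nat. (\<forall>i F. finite F \<longrightarrow> i \<notin> F \<longrightarrow> (\<Sum>j\<in>F. \<bar>\<phi> (r i) (z (r j))\<bar>) \<le> \<epsilon>) \<and>
    (\<forall>F. finite F \<longrightarrow> norm (\<Sum>j\<in>F. z (r j)) \<le> C)"
proof -
  have "(\<Sum>j\<in>F. \<bar>\<phi> i (z j)\<bar>) \<le> 2 * (1 * C)" if "finite F" for i F
    using assms(1,2) that by (rule blinfun_sum_abs_bounded)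
  then show ?thesis
  proof (rule Rosenthal[where a = "\<lambda>i j. \<bar>\<phi> i (z j)\<bar>", OF abs_ge_zero assms(3)])
    fix r :: "nat \<Rightarrow> nat"
    assume r: "strict_mono r"
      "\<And>i F. finite F \<Longrightarrow> i \<notin> F \<Longrightarrow> (\<Sum>j\<in>F. \<bar>\<phi> (r i) (z (r j))\<bar>) \<le> \<epsilon>"
    have "norm (\<Sum>j\<in>F. z (r j)) \<le> C" if "finite F" for F
    proof -
      have "inj_on r F" using strict_mono_imp_inj_on[OF r(1)] inj_on_subset by blast
      then have "(\<Sum>j\<in>F. z (r j)) = sum z (r ` F)" by (simp add: sum.reindex)
      then show ?thesis using assms(1) that by simp
    qed
    with r show ?thesis by (intro exI[of _ r]) auto
  qed
qed

text \<open>How one coefficient is read off an infinite sum: \<open>m\<close> is a row of an almost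
  biorthogonal system, small off the diagonal, so everything but the \<open>i\<close>-th term costs
  at most \<open>B * \<epsilon>\<close>.\<close>

lemma diagonal_dominates:
  fixes m c :: "nat \<Rightarrow> real"
  assumes off: "\<And>F. finite F \<Longrightarrow> i \<notin> F \<Longrightarrow> (\<Sum>j\<in>F. \<bar>m j\<bar>) \<le> \<epsilon>"
    and c: "\<And>j. \<bar>c j\<bar> \<le> B" and lim: "(\<lambda>n. \<Sum>j<n. c j * m j) \<longlonglongrightarrow> l"
  shows "\<bar>c i\<bar> * \<bar>m i\<bar> \<le> \<bar>l\<bar> + B * \<epsilon>"
proof (rule tendsto_lowerbound)
  show "(\<lambda>n. \<bar>\<Sum>j<n. c j * m j\<bar> + B * \<epsilon>) \<longlonglongrightarrow> \<bar>l\<bar> + B * \<epsilon>"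
    using lim by (intro tendsto_intros)
  have "\<bar>c i\<bar> * \<bar>m i\<bar> \<le> \<bar>\<Sum>j<n. c j * m j\<bar> + B * \<epsilon>" if "n \<ge> Suc i" for n
  proof -
    have B: "0 \<le> B" using c[of 0] by linarith
    have "(\<Sum>j<n. c j * m j) = c i * m i + (\<Sum>j\<in>{..<n} - {i}. c j * m j)"
      using that by (subst sum.remove[of _ i]) auto
    moreover have "\<bar>\<Sum>j\<in>{..<n} - {i}. c j * m j\<bar> \<le> B * \<epsilon>"
    proof -
      have "\<bar>\<Sum>j\<in>{..<n} - {i}. c j * m j\<bar> \<le> (\<Sum>j\<in>{..<n} - {i}. \<bar>c j * m j\<bar>)"
        by (rule sum_abs)
      also have "\<dots> \<le> (\<Sum>j\<in>{..<n} - {i}. B * \<bar>m j\<bar>)"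
        using c by (intro sum_mono) (auto simp: abs_mult intro!: mult_right_mono)
      also have "\<dots> = B * (\<Sum>j\<in>{..<n} - {i}. \<bar>m j\<bar>)" by (simp add: sum_distrib_left)
      also have "\<dots> \<le> B * \<epsilon>" using B off by (intro mult_left_mono) auto
      finally show ?thesis .
    qed
    ultimately show ?thesis by (simp add: abs_mult[symmetric])
  qed
  then show "\<forall>\<^sub>F n in sequentially. \<bar>c i\<bar> * \<bar>m i\<bar> \<le> \<bar>\<Sum>j<n. c j * m j\<bar> + B * \<epsilon>"
    by (auto simp: eventually_sequentially)
qed simp

section \<open>The two alternatives for the range space\<close>

lemma weakly_Cauchy_if_real:
  fixes s :: "'k::real_or_complex \<Rightarrow> 'a::real_normed_vector \<Rightarrow> 'a"
  assumes "\<And>\<phi> :: 'a \<Rightarrow>\<^sub>L real. Cauchy (\<lambda>n. \<phi> (x n))"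
  shows "weakly_Cauchy s x"
proof -
  obtain re im :: "'k \<Rightarrow>\<^sub>L real" and j :: 'k where z: "\<And>z. z = re z *\<^sub>R 1 + im z *\<^sub>R j"
    using real_or_complex_coordinates by metis
  have "Cauchy (\<lambda>n. \<psi> (x n))" for \<psi> :: "'a \<Rightarrow>\<^sub>L 'k"
  proof -
    have "Cauchy (\<lambda>n. (re o\<^sub>L \<psi>) (x n))" "Cauchy (\<lambda>n. (im o\<^sub>L \<psi>) (x n))"
      by (rule assms)+
    then obtain L L' where "(\<lambda>n. re (\<psi> (x n))) \<longlonglongrightarrow> L" "(\<lambda>n. im (\<psi> (x n))) \<longlonglongrightarrow> L'"
      by (auto simp: Cauchy_convergent_iff convergent_def)
    then have "(\<lambda>n. re (\<psi> (x n)) *\<^sub>R 1 + im (\<psi> (x n)) *\<^sub>R j) \<longlonglongrightarrow> L *\<^sub>R 1 + L' *\<^sub>R j"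
      by (intro tendsto_add tendsto_scaleR tendsto_const)
    then have "convergent (\<lambda>n. re (\<psi> (x n)) *\<^sub>R 1 + im (\<psi> (x n)) *\<^sub>R j)"
      by (auto simp: convergent_def)
    then show ?thesis
      using z convergent_Cauchy by (metis (no_types, lifting) ext)
  qed
  then show ?thesis by (simp add: weakly_Cauchy_def)
qed

lemma weakly_converges_real:
  fixes s :: "'k::real_or_complex \<Rightarrow> 'a::real_normed_vector \<Rightarrow> 'a" and \<phi> :: "'a \<Rightarrow>\<^sub>L real"
  assumes "normed_over s" "weakly_converges s x l"
  shows "(\<lambda>n. \<phi> (x n)) \<longlonglongrightarrow> \<phi> l"
proof -
  obtain re :: "'k \<Rightarrow>\<^sub>L real" where "bij_betw (\<lambda>\<psi>. re o\<^sub>L \<psi>) (dual s) UNIV"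
    using real_part_dual[OF assms(1)] by metis
  then obtain \<psi> where \<psi>: "\<psi> \<in> dual s" "\<phi> = re o\<^sub>L \<psi>"
    by (metis UNIV_I bij_betw_imp_surj_on imageE)
  then have "(\<lambda>n. \<psi> (x n)) \<longlonglongrightarrow> \<psi> l"
    using assms(2) by (simp add: weakly_converges_def)
  then show ?thesis
    unfolding \<psi>(2) blinfun_apply_blinfun_compose by (rule blinfun.tendsto[OF tendsto_const])
qed

text \<open>Suppose all terms have norm at least \<open>\<delta>\<close>. The thinned series has a
  weak sum \<open>l\<close>, and by Hahn--Banach \<open>l\<close> lies in the norm closure of the
  span \<open>S\<close> of its terms. But subtracting an element of \<open>S\<close> leaves
  coefficients that are eventually one, and almost biorthogonality keeps such a formal series away
  from zero.\<close>

lemma weakly_sequentially_complete_bounded_sums: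
  fixes s :: "'k::real_or_complex \<Rightarrow> 'f::banach \<Rightarrow> 'f" and z :: "nat \<Rightarrow> 'f"
  assumes s: "normed_over s" and wsc: "weakly_sequentially_complete s"
    and sums: "\<And>F. finite F \<Longrightarrow> norm (sum z F) \<le> C" and \<delta>: "0 < \<delta>"
  shows "\<exists>i. norm (z i) < \<delta>"
proof (rule ccontr)
  assume "\<not> ?thesis"
  then have z: "\<delta> \<le> norm (z i)" for i by (auto simp: not_less)
  have "\<exists>\<phi> :: 'f \<Rightarrow>\<^sub>L real. norm \<phi> \<le> 1 \<and> blinfun_apply \<phi> (z i) = norm (z i)" for i
    by (metis norming_functional)
  then obtain \<phi> :: "nat \<Rightarrow> 'f \<Rightarrow>\<^sub>L real"
    where \<phi>: "\<And>i. norm (\<phi> i) \<le> 1" "\<And>i. \<phi> i (z i) = norm (z i)" by metis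
  have "\<exists>r :: nat \<Rightarrow> nat.
      (\<forall>i F. finite F \<longrightarrow> i \<notin> F \<longrightarrow> (\<Sum>j\<in>F. \<bar>\<phi> (r i) (z (r j))\<bar>) \<le> \<delta> / 4) \<and>
      (\<forall>F. finite F \<longrightarrow> norm (\<Sum>j\<in>F. z (r j)) \<le> C)"
    by (rule almost_biorthogonal_subsequence) (use sums \<phi>(1) \<delta> in auto)
  then obtain r :: "nat \<Rightarrow> nat"
    where off': "\<forall>i F. finite F \<longrightarrow> i \<notin> F \<longrightarrow> (\<Sum>j\<in>F. \<bar>\<phi> (r i) (z (r j))\<bar>) \<le> \<delta> / 4"
      and rsums: "\<forall>F. finite F \<longrightarrow> norm (\<Sum>j\<in>F. z (r j)) \<le> C"
    by (elim exE conjE)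
  have off: "(\<Sum>j\<in>F. \<bar>\<phi> (r i) (z (r j))\<bar>) \<le> \<delta> / 4" if "finite F" "i \<notin> F" for i F
    using off' that by blast
  define w where "w j = z (r j)" for j
  have "Cauchy (\<lambda>n. \<psi> (\<Sum>j<n. w j))" for \<psi> :: "'f \<Rightarrow>\<^sub>L real"
  proof -
    have "(\<Sum>j\<in>F. \<bar>\<psi> (w j)\<bar>) \<le> 2 * (norm \<psi> * C)" if "finite F" for F
      using rsums that by (intro blinfun_sum_abs_bounded) (auto simp: w_def)
    then have "summable (\<lambda>j. \<bar>\<psi> (w j)\<bar>)"
      by (intro bounded_imp_summable) auto
    then have "summable (\<lambda>j. \<psi> (w j))"
      by (rule summable_rabs_cancel)
    then show ?thesis
      by (simp add: blinfun.sum_right summable_iff_convergent Cauchy_convergent_iff)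
  qed
  then have "weakly_Cauchy s (\<lambda>n. \<Sum>j<n. w j)"
    by (rule weakly_Cauchy_if_real)
  then obtain l where "weakly_converges s (\<lambda>n. \<Sum>j<n. w j) l"
    using wsc unfolding weakly_sequentially_complete_def by blast
  then have l: "(\<lambda>n. \<psi> (\<Sum>j<n. w j)) \<longlonglongrightarrow> \<psi> l" for \<psi> :: "'f \<Rightarrow>\<^sub>L real"
    by (rule weakly_converges_real[OF s])
  \<comment> \<open>Coefficients are functions vanishing from \<open>n\<close> on, so two
    combinations can be brought to a common length.\<close>
  define S where "S = {\<Sum>j<n. b j *\<^sub>R w j | n b. \<forall>j\<ge>n. b j = (0::real)}"
  have S_ge: "\<exists>b. x = (\<Sum>j<n'. b j *\<^sub>R w j) \<and> (\<forall>j\<ge>n'. b j = 0)"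
    if "x = (\<Sum>j<n. b j *\<^sub>R w j)" "\<forall>j\<ge>n. b j = 0" "n \<le> n'" for x n b n'
  proof -
    have "(\<Sum>j<n'. b j *\<^sub>R w j) = (\<Sum>j<n. b j *\<^sub>R w j)"
      using that by (intro sum.mono_neutral_right) auto
    then show ?thesis using that by (intro exI[of _ b]) auto
  qed
  have sub: "subspace S"
  proof (rule subspaceI)
    show "0 \<in> S" by (auto simp: S_def intro!: exI[of _ 0] exI[of _ "\<lambda>_. 0"])
    fix x y assume "x \<in> S" "y \<in> S"
    then obtain n b n' b' where
      "x = (\<Sum>j<n. b j *\<^sub>R w j)" "\<forall>j\<ge>n. b j = 0" "y = (\<Sum>j<n'. b' j *\<^sub>R w j)" "\<forall>j\<ge>n'. b' j = 0"
      by (auto simp: S_def)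
    then obtain b b' where
      "x = (\<Sum>j<max n n'. b j *\<^sub>R w j)" "\<forall>j\<ge>max n n'. b j = 0"
      "y = (\<Sum>j<max n n'. b' j *\<^sub>R w j)" "\<forall>j\<ge>max n n'. b' j = 0"
      using S_ge[of x b n "max n n'"] S_ge[of y b' n' "max n n'"] by auto
    then have "x + y = (\<Sum>j<max n n'. (b j + b' j) *\<^sub>R w j)" "\<forall>j\<ge>max n n'. b j + b' j = 0"
      by (auto simp: scaleR_left_distrib sum.distrib)
    then show "x + y \<in> S"
      unfolding S_def by (intro CollectI exI[of _ "max n n'"] exI[of _ "\<lambda>j. b j + b' j"] conjI)
  next
    fix c x assume "x \<in> S"
    then obtain n b where "x = (\<Sum>j<n. b j *\<^sub>R w j)" "\<forall>j\<ge>n. b j = 0" by (auto simp: S_def)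
    then have "c *\<^sub>R x = (\<Sum>j<n. (c * b j) *\<^sub>R w j)" "\<forall>j\<ge>n. c * b j = 0"
      by (auto simp: scaleR_sum_right)
    then show "c *\<^sub>R x \<in> S"
      unfolding S_def by (intro CollectI exI[of _ n] exI[of _ "\<lambda>j. c * b j"] conjI)
  qed
  have wS: "w j \<in> S" for j
  proof -
    have "(\<Sum>i<Suc j. (if i = j then 1 else 0) *\<^sub>R w i) = (\<Sum>i<Suc j. if i = j then w i else 0)"
      by (intro sum.cong) auto
    also have "\<dots> = w j" by simp
    finally have "w j = (\<Sum>i<Suc j. (if i = j then 1 else 0) *\<^sub>R w i)" by (rule sym)
    then show ?thesis
      unfolding S_def by (intro CollectI exI[of _ "Suc j"] exI[of _ "\<lambda>i. if i = j then 1 else 0"]) auto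
  qed
  \<comment> \<open>Mazur's argument: a functional that vanishes on \<open>S\<close> vanishes on the
    partial sums, hence at their weak limit \<open>l\<close>.\<close>
  have "infdist l S = 0"
  proof -
    obtain \<psi> :: "'f \<Rightarrow>\<^sub>L real" where \<psi>: "\<And>x. x \<in> S \<Longrightarrow> \<psi> x = 0" "\<psi> l = infdist l S"
      using Hahn_Banach_infdist[OF sub, of l] by metis
    have "\<psi> (\<Sum>j<n. w j) = 0" for n
      using \<psi>(1)[OF wS] by (simp add: blinfun.sum_right)
    then have "\<psi> l = 0"
      using l[of \<psi>] by (simp add: LIMSEQ_const_iff)
    then show ?thesis using \<psi>(2) by simp
  qed
  moreover have "S \<noteq> {}" using wS by auto
  ultimately have "(INF a\<in>S. dist l a) < \<delta> / 4"
    using \<delta> by (simp add: infdist_notempty)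
  then obtain v where v: "v \<in> S" "dist l v < \<delta> / 4"
    using \<open>S \<noteq> {}\<close> by (subst (asm) cINF_less_iff) (auto intro: bdd_belowI2[where m=0])
  then obtain n b where v_eq: "v = (\<Sum>j<n. b j *\<^sub>R w j)" and b0: "\<And>j. j \<ge> n \<Longrightarrow> b j = 0"
    by (auto simp: S_def)
  define c where "c j = 1 - b j" for j
  have cn: "c j = 1" if "j \<ge> n" for j using b0[OF that] by (simp add: c_def)
  \<comment> \<open>A largest coefficient exists since \<open>c\<close> is constant from
    \<open>n\<close> on. Choosing \<open>i\<close> there makes the off-diagonal error
    \<open>\<bar>c i\<bar> * (\<delta> / 4)\<close> comparable with the diagonal term, which is at
    least \<open>\<bar>c i\<bar> * \<delta>\<close>.\<close>
  obtain i where i: "\<And>j. \<bar>c j\<bar> \<le> \<bar>c i\<bar>"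
  proof -
    define M where "M = (\<lambda>j. \<bar>c j\<bar>) ` {..n}"
    have M: "finite M" "M \<noteq> {}" by (auto simp: M_def)
    then obtain i where i: "Max M = \<bar>c i\<bar>"
      using Max_in[OF M] by (metis M_def imageE)
    have le: "\<bar>c j\<bar> \<le> \<bar>c i\<bar>" if "j \<le> n" for j
    proof -
      have "\<bar>c j\<bar> \<in> M" using that by (auto simp: M_def)
      then show ?thesis using Max_ge[OF M(1)] i by auto
    qed
    have "\<bar>c j\<bar> \<le> \<bar>c i\<bar>" for j
      using le[of j] le[of n] cn[of j] cn[of n] by (cases "j \<le> n") auto
    then show thesis by (rule that)
  qed
  have c1: "1 \<le> \<bar>c i\<bar>" using i[of n] cn[of n] by simp
  define m where "m j = \<phi> (r i) (w j)" for j
  have lim: "(\<lambda>k. \<Sum>j<k. c j * m j) \<longlonglongrightarrow> \<phi> (r i) (l - v)"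
  proof -
    have "(\<lambda>k. \<phi> (r i) (\<Sum>j<k. w j) - \<phi> (r i) v) \<longlonglongrightarrow> \<phi> (r i) l - \<phi> (r i) v"
      by (intro tendsto_intros l)
    moreover have "\<phi> (r i) (\<Sum>j<k. w j) - \<phi> (r i) v = (\<Sum>j<k. c j * m j)" if "k \<ge> n" for k
    proof -
      have "(\<Sum>j<n. b j *\<^sub>R w j) = (\<Sum>j<k. b j *\<^sub>R w j)"
        using that b0 by (intro sum.mono_neutral_left) auto
      then show ?thesis
        by (simp add: v_eq c_def m_def blinfun.sum_right blinfun.scaleR_right left_diff_distrib
            sum_subtractf)
    qed
    then have "\<forall>\<^sub>F k in sequentially. \<phi> (r i) (\<Sum>j<k. w j) - \<phi> (r i) v = (\<Sum>j<k. c j * m j)"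
      by (auto simp: eventually_sequentially)
    ultimately show ?thesis
      unfolding blinfun.diff_right by (rule Lim_transform_eventually)
  qed
  have "\<bar>c i\<bar> * \<bar>m i\<bar> \<le> \<bar>\<phi> (r i) (l - v)\<bar> + \<bar>c i\<bar> * (\<delta> / 4)"
    using off i lim by (intro diagonal_dominates) (auto simp: m_def w_def)
  moreover have "\<bar>m i\<bar> \<ge> \<delta>"
    using z[of "r i"] by (simp add: m_def w_def \<phi>(2))
  moreover have "\<bar>\<phi> (r i) (l - v)\<bar> \<le> \<delta> / 4"
    using norm_blinfun[of "\<phi> (r i)" "l - v"] \<phi>(1)[of "r i"] v(2)
      mult_right_mono[OF \<phi>(1)[of "r i"] norm_ge_zero[of "l - v"]] by (simp add: dist_norm)
  \<comment> \<open>As \<open>1 \<le> \<bar>c i\<bar>\<close>, the two quarters on the right add up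
    to at most half of the left side.\<close>
  ultimately have "\<bar>c i\<bar> * \<delta> \<le> \<delta> / 4 + \<bar>c i\<bar> * (\<delta> / 4)"
    using mult_left_mono[of \<delta> "\<bar>m i\<bar>" "\<bar>c i\<bar>"] by linarith
  moreover have "\<delta> \<le> \<bar>c i\<bar> * \<delta>" using c1 \<delta> by simp
  ultimately show False using \<delta> by simp
qed

text \<open>The copy of the bounded sequences in \<open>contains_real_linfty\<close> is real-linear,
  so the duality over \<open>'k\<close> is first turned into one over the reals; real parts keep
  norms and exhaust the real dual.\<close>

lemma is_dual_of_real:
  fixes sF :: "'k::real_or_complex \<Rightarrow> 'f::real_normed_vector \<Rightarrow> 'f"
    and sG :: "'k \<Rightarrow> 'g::real_normed_vector \<Rightarrow> 'g"
  assumes sF: "normed_over sF" and sG: "normed_over sG" and dual: "is_dual_of sF sG"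
  obtains J :: "'f \<Rightarrow> 'g \<Rightarrow>\<^sub>L real"
  where "linear J" "bij J" "\<And>y. norm (J y) = norm y"
proof -
  interpret F: normed_over sF by fact
  obtain J0 :: "'f \<Rightarrow> 'g \<Rightarrow>\<^sub>L 'k" where bij: "bij_betw J0 UNIV (dual sG)"
    and add: "\<And>y z. J0 (y + z) = J0 y + J0 z"
    and scl: "\<And>c y x. blinfun_apply (J0 (sF c y)) x = c * blinfun_apply (J0 y) x"
    and nrm: "\<And>y. norm (J0 y) = norm y"
    using dual unfolding is_dual_of_def by blast
  obtain re :: "'k \<Rightarrow>\<^sub>L real" where re: "bij_betw (\<lambda>\<psi>. re o\<^sub>L \<psi>) (dual sG) UNIV"
    "\<And>\<psi>. \<psi> \<in> dual sG \<Longrightarrow> norm (re o\<^sub>L \<psi>) = norm \<psi>"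
    using real_part_dual[OF sG] by metis
  define J where "J y = re o\<^sub>L J0 y" for y
  show thesis
  proof
    show "linear J"
    proof (rule linearI)
      show "J (y + z) = J y + J z" for y z
        by (rule blinfun_eqI) (simp add: J_def add blinfun.add_left blinfun.add_right)
      show "J (r *\<^sub>R y) = r *\<^sub>R J y" for r y
      proof (rule blinfun_eqI)
        fix x
        have "J0 (r *\<^sub>R y) x = r *\<^sub>R J0 y x"
          using scl[of "of_real r" y x] by (simp add: F.scale_of_real scaleR_conv_of_real)
        then show "J (r *\<^sub>R y) x = (r *\<^sub>R J y) x"
          by (simp add: J_def blinfun.scaleR_left blinfun.scaleR_right)
      qed
    qed
    show "bij J"
      using bij_betw_trans[OF bij re(1)] by (simp add: J_def[abs_def] o_def)
    show "norm (J y) = norm y" for y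
      using re(2)[of "J0 y"] bij nrm by (auto simp: J_def bij_betw_def)
  qed
qed

text \<open>The embedding sends \<open>a\<close> to the weak* sum of the vectors
  \<open>apply_bcontfun a j *\<^sub>R w j\<close> for a thinned sequence \<open>w\<close>. The
  functionals are evaluations at points of the predual, because these commute with weak* sums;
  norming functionals from Hahn--Banach need not.\<close>

lemma dual_space_bounded_sums:
  fixes sF :: "'k::real_or_complex \<Rightarrow> 'f::banach \<Rightarrow> 'f" and sG :: "'k \<Rightarrow> 'g::banach \<Rightarrow> 'g"
    and z :: "nat \<Rightarrow> 'f"
  assumes "normed_over sF" "normed_over sG" "is_dual_of sF sG" "\<not> contains_real_linfty TYPE('f)"
    and sums: "\<And>F. finite F \<Longrightarrow> norm (sum z F) \<le> C" and \<delta>: "0 < \<delta>"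
  shows "\<exists>i. norm (z i) < \<delta>"
proof (rule ccontr)
  assume "\<not> ?thesis"
  then have z: "\<delta> \<le> norm (z i)" for i by (auto simp: not_less)
  obtain J :: "'f \<Rightarrow> 'g \<Rightarrow>\<^sub>L real" where J: "linear J" "bij J" "\<And>y. norm (J y) = norm y"
    using is_dual_of_real assms(1-3) by metis
  have bl: "bounded_linear (\<lambda>y. blinfun_apply (J y) g)" for g
  proof (rule bounded_linear_intro)
    show "norm (blinfun_apply (J y) g) \<le> norm y * norm g" for y
      using norm_blinfun[of "J y" g] J(3) by simp
  qed (auto simp: linear_add[OF J(1)] linear_scale[OF J(1)] blinfun.add_left blinfun.scaleR_left)
  define ev where "ev g = Blinfun (\<lambda>y. blinfun_apply (J y) g)" for g
  have ev: "blinfun_apply (ev g) y = J y g" for g y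
    by (simp add: ev_def bounded_linear_Blinfun_apply[OF bl])
  have ev_norm: "norm (ev g) \<le> norm g" for g
  proof (rule norm_blinfun_bound)
    show "norm (ev g y) \<le> norm g * norm y" for y
      using norm_blinfun[of "J y" g] J(3)[of y] by (simp add: ev mult.commute)
  qed simp
  \<comment> \<open>An evaluation at a point of the unit ball need not attain the norm of
    \<open>J (z i)\<close>; the factor one half leaves room for that.\<close>
  have "\<exists>g. norm g \<le> 1 \<and> \<delta> / 2 \<le> J (z i) g" for i
  proof (rule ccontr)
    assume "\<not> ?thesis"
    then have lt: "J (z i) g < \<delta> / 2" if "norm g \<le> 1" for g using that by (meson not_le)
    have "norm (J (z i)) \<le> \<delta> / 2"
    proof (rule norm_blinfun_bound)
      fix g :: 'g
      show "norm (J (z i) g) \<le> \<delta> / 2 * norm g"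
      proof (cases "g = 0")
        case False
        have "J (z i) (g /\<^sub>R norm g) < \<delta> / 2" "J (z i) ((- g) /\<^sub>R norm g) < \<delta> / 2"
          using False by (intro lt; simp)+
        then show ?thesis
          using False by (simp add: blinfun.scaleR_right blinfun.minus_right field_simps abs_if)
      qed (simp add: blinfun.zero_right)
    qed (use \<delta> in simp)
    then show False using J(3) z[of i] \<delta> by simp
  qed
  then obtain g where g: "\<And>i. norm (g i) \<le> 1" "\<And>i. \<delta> / 2 \<le> J (z i) (g i)" by metis
  define \<phi> where "\<phi> i = ev (g i)" for i
  have \<phi>: "norm (\<phi> i) \<le> 1" for i
    using ev_norm[of "g i"] g(1)[of i] by (simp add: \<phi>_def)
  have "\<exists>r :: nat \<Rightarrow> nat.
      (\<forall>i F. finite F \<longrightarrow> i \<notin> F \<longrightarrow> (\<Sum>j\<in>F. \<bar>\<phi> (r i) (z (r j))\<bar>) \<le> \<delta> / 4) \<and>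
      (\<forall>F. finite F \<longrightarrow> norm (\<Sum>j\<in>F. z (r j)) \<le> C)"
    by (rule almost_biorthogonal_subsequence) (use sums \<phi> \<delta> in auto)
  then obtain r :: "nat \<Rightarrow> nat"
    where off': "\<forall>i F. finite F \<longrightarrow> i \<notin> F \<longrightarrow> (\<Sum>j\<in>F. \<bar>\<phi> (r i) (z (r j))\<bar>) \<le> \<delta> / 4"
      and rsums: "\<forall>F. finite F \<longrightarrow> norm (\<Sum>j\<in>F. z (r j)) \<le> C"
    by (elim exE conjE)
  have off: "(\<Sum>j\<in>F. \<bar>\<phi> (r i) (z (r j))\<bar>) \<le> \<delta> / 4" if "finite F" "i \<notin> F" for i F
    using off' that by blast
  define w where "w j = z (r j)" for j
  have wsum: "(\<Sum>j\<in>F. \<bar>J (w j) x\<bar>) \<le> 2 * (norm x * C)" if "finite F" for F x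
    using blinfun_sum_abs_bounded[of w C "ev x" "norm x" F] rsums ev_norm that
    by (simp add: w_def ev)
  then have abs_sum: "summable (\<lambda>j. \<bar>J (w j) x\<bar>)" for x
    by (intro bounded_imp_summable) auto
  have C: "0 \<le> C" using sums[of "{}"] by simp
  have asum_b: "summable (\<lambda>j. apply_bcontfun a j * J (w j) x)"
    "\<bar>\<Sum>j. apply_bcontfun a j * J (w j) x\<bar> \<le> 2 * C * norm a * norm x" for a :: "nat \<Rightarrow>\<^sub>C real" and x
  proof -
    have le: "\<bar>apply_bcontfun a j * J (w j) x\<bar> \<le> norm a * \<bar>J (w j) x\<bar>" for j
      using norm_bounded[of a j] by (auto simp: abs_mult intro!: mult_right_mono)
    have s1: "summable (\<lambda>j. norm a * \<bar>J (w j) x\<bar>)"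
      by (intro summable_mult abs_sum)
    have s2: "summable (\<lambda>j. \<bar>apply_bcontfun a j * J (w j) x\<bar>)"
      by (rule summable_comparison_test[OF _ s1]) (use le in auto)
    show "summable (\<lambda>j. apply_bcontfun a j * J (w j) x)"
      using s2 by (rule summable_rabs_cancel)
    have "\<bar>\<Sum>j. apply_bcontfun a j * J (w j) x\<bar> \<le> (\<Sum>j. \<bar>apply_bcontfun a j * J (w j) x\<bar>)"
      using s2 by (rule summable_rabs)
    also have "\<dots> \<le> (\<Sum>j. norm a * \<bar>J (w j) x\<bar>)"
      using le s2 s1 by (rule suminf_le)
    also have "\<dots> = norm a * (\<Sum>j. \<bar>J (w j) x\<bar>)"
      using abs_sum by (rule suminf_mult)
    also have "\<dots> \<le> norm a * (2 * (norm x * C))"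
      using wsum by (intro mult_left_mono suminf_le_const abs_sum) auto
    finally show "\<bar>\<Sum>j. apply_bcontfun a j * J (w j) x\<bar> \<le> 2 * C * norm a * norm x"
      by (simp add: mult_ac)
  qed
  \<comment> \<open>The weak* sum, computed pointwise on the predual; \<open>U\<close> below pulls
    it back to \<open>'f\<close>.\<close>
  define V where "V a = Blinfun (\<lambda>x. \<Sum>j. apply_bcontfun a j * J (w j) x)" for a :: "nat \<Rightarrow>\<^sub>C real"
  have "bounded_linear (\<lambda>x. \<Sum>j. apply_bcontfun a j * J (w j) x)" for a :: "nat \<Rightarrow>\<^sub>C real"
  proof (rule bounded_linear_intro)
    show "norm (\<Sum>j. apply_bcontfun a j * J (w j) x) \<le> norm x * (2 * C * norm a)" for x
      using asum_b(2)[of a x] by (simp add: mult_ac)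
    show "(\<Sum>j. apply_bcontfun a j * J (w j) (x + y)) =
      (\<Sum>j. apply_bcontfun a j * J (w j) x) + (\<Sum>j. apply_bcontfun a j * J (w j) y)" for x y
      by (simp add: suminf_add[OF asum_b(1) asum_b(1)] blinfun.add_right distrib_left)
    show "(\<Sum>j. apply_bcontfun a j * J (w j) (c *\<^sub>R x)) = c *\<^sub>R (\<Sum>j. apply_bcontfun a j * J (w j) x)" for c x
      using suminf_mult[OF asum_b(1)[of a x], of c] by (simp add: blinfun.scaleR_right mult_ac)
  qed
  then have V: "blinfun_apply (V a) x = (\<Sum>j. apply_bcontfun a j * J (w j) x)" for a x
    by (simp add: V_def bounded_linear_Blinfun_apply)
  define U where "U a = inv J (V a)" for a
  have JU: "J (U a) = V a" for a
    using J(2) by (simp add: U_def bij_is_surj surj_f_inv_f)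
  have injJ: "J x = J y \<Longrightarrow> x = y" for x y
    using J(2) by (auto simp: bij_def inj_def)
  have blU: "bounded_linear U"
  proof (rule bounded_linear_intro)
    show "norm (U a) \<le> norm a * (2 * C)" for a
    proof -
      have "norm (V a) \<le> 2 * C * norm a"
        by (rule norm_blinfun_bound) (use asum_b(2)[of a] C in \<open>auto simp: V\<close>)
      then show ?thesis using J(3)[of "U a"] JU by (simp add: mult_ac)
    qed
    show "U (a + b) = U a + U b" for a b
    proof (rule injJ, rule blinfun_eqI)
      show "J (U (a + b)) x = J (U a + U b) x" for x
        by (simp add: linear_add[OF J(1)] JU V blinfun.add_left
            suminf_add[OF asum_b(1) asum_b(1)] plus_bcontfun.rep_eq distrib_right)
    qed
    show "U (c *\<^sub>R a) = c *\<^sub>R U a" for c a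
    proof (rule injJ, rule blinfun_eqI)
      show "J (U (c *\<^sub>R a)) x = J (c *\<^sub>R U a) x" for x
        using suminf_mult[OF asum_b(1)[of a x], of c]
        by (simp add: linear_scale[OF J(1)] JU V blinfun.scaleR_left scaleR_bcontfun.rep_eq mult_ac)
    qed
  qed
  \<comment> \<open>The constant is the diagonal bound \<open>\<delta> / 2\<close> less the
    off-diagonal error \<open>\<delta> / 4\<close>. The supremum of \<open>a\<close> need not be
    attained, so \<open>diagonal_dominates\<close> is applied at every \<open>i\<close>.\<close>
  have low: "\<delta> / 4 * norm a \<le> norm (U a)" for a
  proof -
    have "norm a * (\<delta> / 2) \<le> norm (U a) + norm a * (\<delta> / 4)"
    proof -
      have "\<bar>apply_bcontfun a i\<bar> \<le> (norm (U a) + norm a * (\<delta> / 4)) / (\<delta> / 2)" for i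
      proof -
        define m where "m j = \<phi> (r i) (w j)" for j
        have "\<bar>apply_bcontfun a i\<bar> * \<bar>m i\<bar> \<le> \<bar>\<phi> (r i) (U a)\<bar> + norm a * (\<delta> / 4)"
        proof (rule diagonal_dominates)
          show "(\<lambda>n. \<Sum>j<n. apply_bcontfun a j * m j) \<longlonglongrightarrow> \<phi> (r i) (U a)"
            using summable_LIMSEQ[OF asum_b(1)[of a "g (r i)"]] by (simp add: m_def \<phi>_def ev JU V)
        qed (use off norm_bounded[of a] in \<open>auto simp: m_def w_def\<close>)
        moreover have "\<delta> / 2 \<le> \<bar>m i\<bar>"
          using g(2)[of "r i"] by (simp add: m_def \<phi>_def ev w_def)
        then have "\<bar>apply_bcontfun a i\<bar> * (\<delta> / 2) \<le> \<bar>apply_bcontfun a i\<bar> * \<bar>m i\<bar>"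
          by (intro mult_left_mono) auto
        moreover have "\<bar>\<phi> (r i) (U a)\<bar> \<le> norm (U a)"
          using norm_blinfun[of "\<phi> (r i)" "U a"] mult_right_mono[OF \<phi>[of "r i"] norm_ge_zero[of "U a"]]
          by simp
        ultimately show ?thesis using \<delta> by (simp add: field_simps)
      qed
      then have "norm a \<le> (norm (U a) + norm a * (\<delta> / 4)) / (\<delta> / 2)"
        by (intro norm_bound) simp
      then show ?thesis using \<delta> by (simp add: field_simps)
    qed
    then show ?thesis by (simp add: field_simps)
  qed
  have "contains_real_linfty TYPE('f)"
    unfolding contains_real_linfty_def
    by (rule exI[of _ "Blinfun U"], rule exI[of _ "\<delta> / 4"])
      (use low \<delta> in \<open>simp add: bounded_linear_Blinfun_apply[OF blU]\<close>)
  then show False using assms(4) by simp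
qed

section \<open>Functions vanishing at infinity on a locally compact space\<close>

text \<open>Urysohn's function vanishes off \<open>W \<inter> U\<close>, but the closure of the set
  where it is nonzero may leave \<open>U\<close>. Cutting it at level one half moves the support
  into the closed set \<open>M\<close>, which lies in \<open>U\<close> and in the compact
  \<open>L\<close>.\<close>

lemma Urysohn_compact_support:
  fixes K U :: "'z::t2_space set"
  assumes lc: "locally_compact_space (euclidean :: 'z topology)"
    and "compact K" "open U" "K \<subseteq> U"
  obtains \<phi> :: "'z \<Rightarrow> real" and L where "continuous_on UNIV \<phi>" "\<And>z. 0 \<le> \<phi> z" "\<And>z. \<phi> z \<le> 1"
    "\<And>z. z \<in> K \<Longrightarrow> \<phi> z = 1" "compact L" "L \<subseteq> U" "\<And>z. z \<notin> L \<Longrightarrow> \<phi> z = 0"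
proof -
  have haus: "Hausdorff_space (euclidean :: 'z topology)"
    using separation_t2 by (auto simp: Hausdorff_space_def disjnt_def)
  obtain W L where W: "open W" "compact L" "K \<subseteq> W" "W \<subseteq> L"
  proof -
    have "\<exists>W L. open W \<and> compact L \<and> closed L \<and> K \<subseteq> W \<and> W \<subseteq> L"
      using lc \<open>compact K\<close> locally_compact_space_compact_closed_compact[of "euclidean :: 'z topology"]
        haus by simp
    then show thesis using that by blast
  qed
  have cr: "completely_regular_space (euclidean :: 'z topology)"
    using locally_compact_regular_imp_completely_regular_space[OF lc] haus by blast
  obtain f :: "'z \<Rightarrow> real" where f: "continuous_map euclidean (top_of_set {0..1}) f"
      "f ` K \<subseteq> {1}" "f ` (- (W \<inter> U)) \<subseteq> {0}"
  proof (rule Urysohn_completely_regular_compact_closed[of 0 1])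
    show "compactin euclidean K" "closedin euclidean (- (W \<inter> U))" "disjnt K (- (W \<inter> U))"
      using W assms by (auto simp: disjnt_iff closed_Compl)
  qed (simp_all add: cr)
  have cont: "continuous_on UNIV f" and f1: "f z \<le> 1" for z
    using f(1) by (auto simp: continuous_map_in_subtopology)
  define M where "M = {z. 1 / 2 \<le> f z}"
  have "closed M"
    unfolding M_def using cont by (intro closed_Collect_le continuous_intros)
  have M: "M \<subseteq> W \<inter> U"
  proof
    fix z assume "z \<in> M"
    then show "z \<in> W \<inter> U"
      using f(3) by (cases "z \<in> W \<inter> U") (auto simp: M_def image_subset_iff)
  qed
  have "L \<inter> M = M" using M W(4) by blast
  then have "compact M"
    using compact_Int_closed[OF W(2) \<open>closed M\<close>] by simp
  show thesis
  proof (rule that[of "\<lambda>z. max 0 (2 * f z - 1)" M])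
    show "continuous_on UNIV (\<lambda>z. max 0 (2 * f z - 1))"
      using cont by (intro continuous_intros)
    show "max 0 (2 * f z - 1) = 1" if "z \<in> K" for z
      using f(2) that by (auto simp: image_subset_iff)
  qed (use f1 M \<open>compact M\<close> in \<open>auto simp: M_def\<close>)
qed

lemma apply_c0_Abs:
  assumes "continuous_on UNIV F" "vanishes_at_infinity F"
  shows "apply_c0 (Abs_c0 F) = F"
  using assms by (simp add: Abs_c0_inverse)

lemma continuous_apply_c0: "continuous_on UNIV (apply_c0 f)"
  and vanishes_apply_c0: "vanishes_at_infinity (apply_c0 f)"
  using apply_c0[of f] by auto

lemma vanishes_at_infinity_compact_support:
  assumes "compact L" "\<And>z. z \<notin> L \<Longrightarrow> F z = 0"
  shows "vanishes_at_infinity F"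
  using assms unfolding vanishes_at_infinity_def by fastforce

lemma compact_superlevel_c0:
  fixes f :: "('z::t2_space, 'e::real_normed_vector) c0fun"
  assumes "0 < \<eta>"
  shows "compact {z. \<eta> \<le> norm (apply_c0 f z)}" (is "compact ?S")
proof -
  obtain K where K: "compact K" "\<And>z. z \<notin> K \<Longrightarrow> norm (apply_c0 f z) < \<eta>"
    using vanishes_apply_c0[of f] assms unfolding vanishes_at_infinity_def by meson
  have "closed ?S"
    by (intro closed_Collect_le continuous_intros continuous_apply_c0)
  then have "compact (K \<inter> ?S)"
    using K(1) by (simp add: compact_Int_closed)
  moreover have "K \<inter> ?S = ?S" using K(2) by fastforce
  ultimately show ?thesis by simp
qed

lemma c0_compose:
  assumes "continuous_on UNIV h" "\<And>x. norm (h x) \<le> norm x"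
  obtains g :: "('z::topological_space, 'e::real_normed_vector) c0fun"
  where "\<And>z. apply_c0 g z = h (apply_c0 f z)"
proof (rule that[of "Abs_c0 (\<lambda>z. h (apply_c0 f z))"])
  have "continuous_on UNIV (\<lambda>z. h (apply_c0 f z))"
    using continuous_on_compose2[OF assms(1) continuous_apply_c0] by simp
  moreover have "vanishes_at_infinity (\<lambda>z. h (apply_c0 f z))"
    using vanishes_apply_c0[of f] by (rule vanishes_at_infinity_dominated[where B=1]) (use assms(2) in auto)
  ultimately show "apply_c0 (Abs_c0 (\<lambda>z. h (apply_c0 f z))) z = h (apply_c0 f z)" for z
    by (simp add: apply_c0_Abs)
qed

lemma c0_times:
  fixes \<phi> :: "'z::topological_space \<Rightarrow> real"
  assumes "continuous_on UNIV \<phi>" "\<And>z. \<bar>\<phi> z\<bar> \<le> 1"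
  obtains g :: "('z, 'e::real_normed_vector) c0fun" where "\<And>z. apply_c0 g z = \<phi> z *\<^sub>R apply_c0 f z"
proof (rule that[of "Abs_c0 (\<lambda>z. \<phi> z *\<^sub>R apply_c0 f z)"])
  have "continuous_on UNIV (\<lambda>z. \<phi> z *\<^sub>R apply_c0 f z)"
    by (intro continuous_intros assms continuous_apply_c0)
  moreover have "vanishes_at_infinity (\<lambda>z. \<phi> z *\<^sub>R apply_c0 f z)"
    using vanishes_apply_c0[of f]
    by (rule vanishes_at_infinity_dominated[where B=1]) (use assms(2) in \<open>auto intro: mult_left_le_one_le\<close>)
  ultimately show "apply_c0 (Abs_c0 (\<lambda>z. \<phi> z *\<^sub>R apply_c0 f z)) z = \<phi> z *\<^sub>R apply_c0 f z" for z
    by (simp add: apply_c0_Abs)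
qed

lemma c0_bump:
  fixes K U :: "'z::t2_space set" and x :: "'e::real_normed_vector"
  assumes "locally_compact_space (euclidean :: 'z topology)" "compact K" "open U" "K \<subseteq> U"
  obtains g :: "('z, 'e) c0fun" where "\<And>z. norm (apply_c0 g z) \<le> norm x"
    "\<And>z. z \<in> K \<Longrightarrow> apply_c0 g z = x" "\<And>z. z \<notin> U \<Longrightarrow> apply_c0 g z = 0" "norm g \<le> norm x"
proof -
  obtain \<phi> :: "'z \<Rightarrow> real" and L where \<phi>: "continuous_on UNIV \<phi>" "\<And>z. 0 \<le> \<phi> z" "\<And>z. \<phi> z \<le> 1"
    "\<And>z. z \<in> K \<Longrightarrow> \<phi> z = 1" "compact L" "L \<subseteq> U" "\<And>z. z \<notin> L \<Longrightarrow> \<phi> z = 0"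
    using Urysohn_compact_support[OF assms] by blast
  define g where "g = Abs_c0 (\<lambda>z. \<phi> z *\<^sub>R x)"
  have g: "apply_c0 g z = \<phi> z *\<^sub>R x" for z
    unfolding g_def using \<phi>
    by (subst apply_c0_Abs) (auto intro!: continuous_intros vanishes_at_infinity_compact_support)
  have le: "norm (apply_c0 g z) \<le> norm x" for z
    using \<phi>(2,3)[of z] by (simp add: g mult_left_le_one_le)
  show thesis
  proof (rule that[OF le _ _ norm_c0_least[OF le]])
    show "apply_c0 g z = 0" if "z \<notin> U" for z
      using \<phi>(6,7) that by (auto simp: g)
  qed (use \<phi>(4) in \<open>auto simp: g\<close>)
qed

text \<open>For \<open>0 < C\<close> this is the radial retraction onto the closed ball of radius
  \<open>C\<close>. Truncation by it stays within the functions vanishing at infinity, and the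
  remainder \<open>x - radial C x\<close> is zero on that ball; subtracting a truncation is how
  compact supports are produced.\<close>

definition radial :: "real \<Rightarrow> 'e::real_normed_vector \<Rightarrow> 'e"
  where "radial C x = (C / max C (norm x)) *\<^sub>R x"

lemma radial_id: "0 < C \<Longrightarrow> norm x \<le> C \<Longrightarrow> radial C x = x"
  by (simp add: radial_def max_absorb1)

lemma radial_zero [simp]: "radial C 0 = 0"
  by (simp add: radial_def)

lemma norm_radial_le: "0 < C \<Longrightarrow> norm (radial C x) \<le> C"
  by (cases "norm x \<le> C") (auto simp: radial_id, simp add: radial_def max_absorb2)

lemma norm_radial_le_norm: "0 < C \<Longrightarrow> norm (radial C x) \<le> norm x"
proof -
  assume "0 < C"
  then have "norm (radial C x) = C / max C (norm x) * norm x" "C / max C (norm x) \<le> 1"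
    by (simp_all add: radial_def divide_le_eq)
  then show ?thesis
    using \<open>0 < C\<close> by (metis divide_nonneg_pos less_imp_le max_less_iff_conj max.strict_coboundedI1 mult_left_le_one_le norm_ge_zero)
qed

lemma norm_minus_radial:
  assumes "0 < C"
  shows "norm (x - radial C x) = max 0 (norm x - C)"
proof (cases "norm x \<le> C")
  case True
  then show ?thesis using assms by (simp add: radial_id)
next
  case False
  then have "x \<noteq> 0" using assms by auto
  have "x - radial C x = (1 - C / norm x) *\<^sub>R x"
    using False by (simp add: radial_def max_absorb2 scaleR_left_diff_distrib)
  then have "norm (x - radial C x) = (1 - C / norm x) * norm x"
    using False assms by (simp add: abs_of_nonneg divide_le_eq del: mult_eq_0_iff)
  also have "\<dots> = norm x - C"
    using \<open>x \<noteq> 0\<close> by (simp add: field_simps)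
  finally show ?thesis using False by simp
qed

lemma continuous_radial: "0 < C \<Longrightarrow> continuous_on UNIV (radial C)"
  unfolding radial_def[abs_def] by (intro continuous_intros) (auto simp: max_def)

lemma c0_radial:
  assumes "0 < C"
  obtains g :: "('z::topological_space, 'e::real_normed_vector) c0fun"
  where "\<And>z. apply_c0 g z = radial C (apply_c0 f z)"
  using c0_compose[OF continuous_radial[OF assms] norm_radial_le_norm[OF assms]] by metis

section \<open>The semivariation of an operator\<close>

locale c0_operator =
  fixes T :: "('z::t2_space, 'e::banach) c0fun \<Rightarrow>\<^sub>L 'f::banach"
  assumes lc: "locally_compact_space (euclidean :: 'z topology)"
begin

definition ov :: "'z set \<Rightarrow> real"
  where "ov U = (SUP f\<in>{f. norm f \<le> 1 \<and> (\<forall>z. z \<notin> U \<longrightarrow> apply_c0 f z = 0)}. norm (T f))"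

lemma ov_upper1:
  assumes "norm f \<le> 1" "\<And>z. z \<notin> U \<Longrightarrow> apply_c0 f z = 0"
  shows "norm (T f) \<le> ov U"
  unfolding ov_def
proof (rule cSUP_upper)
  show "bdd_above ((\<lambda>f. norm (T f)) ` {f :: ('z, 'e) c0fun. norm f \<le> 1 \<and> (\<forall>z. z \<notin> U \<longrightarrow> apply_c0 f z = 0)})"
  proof (rule bdd_aboveI2)
    fix f :: "('z, 'e) c0fun"
    assume "f \<in> {f. norm f \<le> 1 \<and> (\<forall>z. z \<notin> U \<longrightarrow> apply_c0 f z = 0)}"
    then show "norm (T f) \<le> norm T"
      using norm_blinfun[of T f] mult_left_mono[of "norm f" 1 "norm T"] by simp
  qed
qed (use assms in auto)

lemma ov_least:
  assumes "\<And>f. norm f \<le> 1 \<Longrightarrow> (\<And>z. z \<notin> U \<Longrightarrow> apply_c0 f z = 0) \<Longrightarrow> norm (T f) \<le> c"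
  shows "ov U \<le> c"
  unfolding ov_def
proof (rule cSUP_least)
  have "0 \<in> {f. norm f \<le> 1 \<and> (\<forall>z. z \<notin> U \<longrightarrow> apply_c0 f z = 0)}"
    by (simp add: zero_c0fun.rep_eq)
  then show "{f. norm f \<le> 1 \<and> (\<forall>z. z \<notin> U \<longrightarrow> apply_c0 f z = 0)} \<noteq> {}" by blast
qed (use assms in auto)

lemma ov_nonneg: "0 \<le> ov U"
  using ov_upper1[of 0 U] by (simp add: zero_c0fun.rep_eq blinfun.zero_right)

lemma ov_upper:
  assumes "norm f \<le> C" "\<And>z. z \<notin> U \<Longrightarrow> apply_c0 f z = 0"
  shows "norm (T f) \<le> C * ov U"
proof (cases "C = 0")
  case True
  then show ?thesis using assms(1) by (simp add: blinfun.zero_right)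
next
  case False
  then have C: "0 < C" using assms(1) norm_ge_zero[of f] by linarith
  have "norm (T (f /\<^sub>R C)) \<le> ov U"
    using assms C by (intro ov_upper1) (auto simp: scaleR_c0fun.rep_eq field_simps)
  then show ?thesis
    using C by (simp add: blinfun.scaleR_right field_simps)
qed

lemma ov_le_norm: "ov U \<le> norm T"
proof (rule ov_least)
  fix f :: "('z, 'e) c0fun" assume "norm f \<le> 1"
  then show "norm (T f) \<le> norm T"
    using norm_blinfun[of T f] mult_left_mono[of "norm f" 1 "norm T"] by simp
qed

lemma ov_mono: "U \<subseteq> V \<Longrightarrow> ov U \<le> ov V"
  by (rule ov_least, rule ov_upper1) auto

lemma ov_empty: "ov {} = 0"
proof -
  have "ov {} \<le> 0"
  proof (rule ov_least)
    fix f :: "('z, 'e) c0fun" assume "\<And>z. z \<notin> {} \<Longrightarrow> apply_c0 f z = 0"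
    then have "norm f \<le> 0" by (intro norm_c0_least) auto
    then show "norm (T f) \<le> 0" by (simp add: blinfun.zero_right)
  qed
  then show ?thesis using ov_nonneg[of "{}"] by simp
qed

text \<open>Split off the truncation \<open>h\<close> at height \<open>\<eta>\<close>: it costs
  \<open>norm T * \<eta>\<close>, and the remainder vanishes off \<open>V\<close>.\<close>

lemma norm_apply_le_ov:
  assumes "norm g \<le> C" "\<And>z. z \<notin> V \<Longrightarrow> norm (apply_c0 g z) \<le> \<eta>" "0 < \<eta>"
  shows "norm (T g) \<le> C * ov V + norm T * \<eta>"
proof -
  obtain h :: "('z, 'e) c0fun" where h: "\<And>z. apply_c0 h z = radial \<eta> (apply_c0 g z)"
    using c0_radial[OF assms(3)] by metis
  have gh: "apply_c0 (g - h) z = apply_c0 g z - radial \<eta> (apply_c0 g z)" for z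
    by (simp add: minus_c0fun.rep_eq h)
  have C: "0 \<le> C" using assms(1) norm_ge_zero[of g] by linarith
  have "norm (T (g - h)) \<le> C * ov V"
  proof (rule ov_upper)
    show "norm (g - h) \<le> C"
    proof (rule norm_c0_least)
      show "norm (apply_c0 (g - h) z) \<le> C" for z
        using norm_c0_le[of g z] assms(1,3) C unfolding gh norm_minus_radial[OF assms(3)] by simp
    qed
    show "apply_c0 (g - h) z = 0" if "z \<notin> V" for z
      using assms(2)[OF that] assms(3) by (simp add: gh radial_id)
  qed
  moreover have "norm (T h) \<le> norm T * \<eta>"
  proof -
    have "norm h \<le> \<eta>"
      by (rule norm_c0_least) (simp add: h norm_radial_le assms(3))
    then show ?thesis
      using norm_blinfun[of T h] mult_left_mono[of "norm h" \<eta> "norm T"] by simp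
  qed
  moreover have "norm (T g) \<le> norm (T (g - h)) + norm (T h)"
    using norm_triangle_ineq[of "T (g - h)" "T h"] by (simp add: blinfun.diff_right)
  ultimately show ?thesis by linarith
qed

text \<open>Subtracting the truncation at a small height \<open>\<eta>\<close> leaves a function
  supported in a superlevel set of \<open>norm (apply_c0 f z)\<close>, which is compact and avoids
  the zeros of \<open>f\<close>.\<close>

lemma approx_compact_support:
  assumes "norm f \<le> 1" "0 < \<epsilon>" "\<And>z. z \<notin> U \<Longrightarrow> apply_c0 f z = 0"
  shows "\<exists>g K. norm g \<le> 1 \<and> norm (T f) \<le> norm (T g) + \<epsilon> \<and> compact K \<and> K \<subseteq> U \<and>
    (\<forall>z. z \<notin> K \<longrightarrow> apply_c0 g z = 0)"
proof -
  define \<eta> where "\<eta> = \<epsilon> / (norm T + 1)"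
  have \<eta>: "0 < \<eta>" "norm T * \<eta> \<le> \<epsilon>"
  proof -
    have pos: "0 < norm T + 1" using norm_ge_zero[of T] by linarith
    show "0 < \<eta>" using pos assms(2) by (simp add: \<eta>_def)
    show "norm T * \<eta> \<le> \<epsilon>"
      using mult_left_mono[of "norm T / (norm T + 1)" 1 \<epsilon>] assms(2) pos
      by (simp add: \<eta>_def mult.commute)
  qed
  obtain h :: "('z, 'e) c0fun" where h: "\<And>z. apply_c0 h z = radial \<eta> (apply_c0 f z)"
    using c0_radial[OF \<eta>(1)] by metis
  define K where "K = {z. \<eta> \<le> norm (apply_c0 f z)}"
  have gh: "apply_c0 (f - h) z = apply_c0 f z - radial \<eta> (apply_c0 f z)" for z
    by (simp add: minus_c0fun.rep_eq h)
  show ?thesis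
  proof (intro exI[of _ "f - h"] exI[of _ K] conjI allI impI)
    show "norm (f - h) \<le> 1"
    proof (rule norm_c0_least)
      show "norm (apply_c0 (f - h) z) \<le> 1" for z
        using norm_c0_le[of f z] assms(1) \<eta>(1) unfolding gh norm_minus_radial[OF \<eta>(1)] by simp
    qed
    have "norm h \<le> \<eta>"
      by (rule norm_c0_least) (simp add: h norm_radial_le \<eta>(1))
    then have "norm (T h) \<le> \<epsilon>"
      using norm_blinfun[of T h] mult_left_mono[of "norm h" \<eta> "norm T"] \<eta>(2) by simp
    then show "norm (T f) \<le> norm (T (f - h)) + \<epsilon>"
      using norm_triangle_ineq[of "T (f - h)" "T h"] by (simp add: blinfun.diff_right)
    show "compact K"
      unfolding K_def by (rule compact_superlevel_c0[OF \<eta>(1)])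
    show "K \<subseteq> U"
      using assms(3) \<eta>(1) by (force simp: K_def)
    show "apply_c0 (f - h) z = 0" if "z \<notin> K" for z
      using that \<eta>(1) by (simp add: gh K_def radial_id)
  qed
qed

text \<open>For a function with compact support \<open>K\<close>, the set \<open>K - V\<close> is
  compact and inside \<open>U\<close>, so a Urysohn function splits it into a part living on
  \<open>U\<close> and a part living on \<open>V\<close>. Openness matters: a continuous function
  vanishing on a dense set is zero, so two complementary dense sets would both have
  \<open>ov\<close> zero.\<close>

lemma ov_Un:
  assumes "open U" "open V"
  shows "ov (U \<union> V) \<le> ov U + ov V"
proof (rule ov_least, rule field_le_epsilon)
  fix f :: "('z, 'e) c0fun" and \<epsilon> :: real
  assume f: "norm f \<le> 1" "\<And>z. z \<notin> U \<union> V \<Longrightarrow> apply_c0 f z = 0" and e: "0 < \<epsilon>"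
  have "\<exists>g K. norm g \<le> 1 \<and> norm (T f) \<le> norm (T g) + \<epsilon> \<and> compact K \<and> K \<subseteq> U \<union> V \<and>
      (\<forall>z. z \<notin> K \<longrightarrow> apply_c0 g z = 0)"
    by (rule approx_compact_support[OF f(1) e]) (rule f(2))
  then obtain g K where g: "norm g \<le> 1" "norm (T f) \<le> norm (T g) + \<epsilon>"
    and K: "compact K" "K \<subseteq> U \<union> V" and K0: "\<forall>z. z \<notin> K \<longrightarrow> apply_c0 g z = 0"
    by (elim exE conjE)
  have "compact (K - V)" "K - V \<subseteq> U"
    using K assms compact_diff by auto
  then obtain \<phi> :: "'z \<Rightarrow> real" and L where \<phi>: "continuous_on UNIV \<phi>" "\<And>z. 0 \<le> \<phi> z" "\<And>z. \<phi> z \<le> 1"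
    "\<And>z. z \<in> K - V \<Longrightarrow> \<phi> z = 1" "L \<subseteq> U" "\<And>z. z \<notin> L \<Longrightarrow> \<phi> z = 0"
    using Urysohn_compact_support[OF lc _ assms(1), of "K - V"] by metis
  obtain h :: "('z, 'e) c0fun" where h: "\<And>z. apply_c0 h z = \<phi> z *\<^sub>R apply_c0 g z"
    using c0_times[OF \<phi>(1), of g] \<phi>(2,3) by (metis abs_of_nonneg)
  have "norm (apply_c0 h z) \<le> 1" for z
    using mult_le_one[OF \<phi>(3)[of z] norm_ge_zero, of "apply_c0 g z"] norm_c0_le[of g z] g(1) \<phi>(2)[of z]
    by (simp add: h)
  then have "norm (T h) \<le> ov U"
    using \<phi>(5,6) by (intro ov_upper1 norm_c0_least) (auto simp: h)
  moreover have "norm (T (g - h)) \<le> ov V"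
  proof (rule ov_upper1)
    have eq: "apply_c0 (g - h) z = (1 - \<phi> z) *\<^sub>R apply_c0 g z" for z
      by (simp add: minus_c0fun.rep_eq h scaleR_left_diff_distrib)
    show "norm (g - h) \<le> 1"
    proof (rule norm_c0_least)
      show "norm (apply_c0 (g - h) z) \<le> 1" for z
        using mult_le_one[of "1 - \<phi> z" "norm (apply_c0 g z)"] norm_c0_le[of g z] g(1) \<phi>(2,3)[of z]
        by (simp add: eq)
    qed
    show "apply_c0 (g - h) z = 0" if "z \<notin> V" for z
      using that \<phi>(4)[of z] K0 by (cases "z \<in> K") (auto simp: eq)
  qed
  moreover have "norm (T g) \<le> norm (T (g - h)) + norm (T h)"
    using norm_triangle_ineq[of "T (g - h)" "T h"] by (simp add: blinfun.diff_right)
  ultimately show "norm (T f) \<le> ov U + ov V + \<epsilon>" using g(2) by linarith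
qed

lemma ov_UN_finite:
  assumes "finite I" "\<And>i. i \<in> I \<Longrightarrow> open (U i)"
  shows "ov (\<Union>i\<in>I. U i) \<le> (\<Sum>i\<in>I. ov (U i))"
  using assms
proof (induction I rule: finite_induct)
  case empty
  then show ?case by (simp add: ov_empty)
next
  case (insert i I)
  have "ov (U i \<union> (\<Union>i\<in>I. U i)) \<le> ov (U i) + ov (\<Union>i\<in>I. U i)"
    using insert by (intro ov_Un open_UN) auto
  then show ?case using insert by simp
qed

text \<open>Compactness of the support reduces the union to finitely many sets; a bound on partial
  sums stands in for the value of the series.\<close>

lemma ov_UN_countable:
  fixes U :: "nat \<Rightarrow> 'z set"
  assumes "\<And>n. open (U n)" "\<And>N. (\<Sum>n<N. ov (U n)) \<le> c"
  shows "ov (\<Union>n. U n) \<le> c"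
proof (rule ov_least, rule field_le_epsilon)
  fix f :: "('z, 'e) c0fun" and \<epsilon> :: real
  assume f: "norm f \<le> 1" "\<And>z. z \<notin> (\<Union>n. U n) \<Longrightarrow> apply_c0 f z = 0" and e: "0 < \<epsilon>"
  have "\<exists>g K. norm g \<le> 1 \<and> norm (T f) \<le> norm (T g) + \<epsilon> \<and> compact K \<and> K \<subseteq> (\<Union>n. U n) \<and>
      (\<forall>z. z \<notin> K \<longrightarrow> apply_c0 g z = 0)"
    by (rule approx_compact_support[OF f(1) e]) (rule f(2))
  then obtain g K where g: "norm g \<le> 1" "norm (T f) \<le> norm (T g) + \<epsilon>"
    and K: "compact K" "K \<subseteq> (\<Union>n. U n)" and K0: "\<forall>z. z \<notin> K \<longrightarrow> apply_c0 g z = 0"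
    by (elim exE conjE)
  from compactE_image[OF K(1) assms(1) K(2)]
  obtain I where I: "I \<subseteq> UNIV" "finite I" "K \<subseteq> (\<Union>n\<in>I. U n)" .
  then obtain N where "I \<subseteq> {..<N}"
    using finite_nat_iff_bounded by blast
  then have "K \<subseteq> (\<Union>n<N. U n)" using I(3) by blast
  then have "norm (T g) \<le> ov (\<Union>n<N. U n)"
    using g(1) K0 by (intro ov_upper1) auto
  also have "\<dots> \<le> (\<Sum>n<N. ov (U n))"
    using assms(1) by (intro ov_UN_finite) auto
  also have "\<dots> \<le> c" by (rule assms(2))
  finally show "norm (T f) \<le> c + \<epsilon>" using g(2) by linarith
qed

section \<open>Strong boundedness and the \<sigma>-algebra of regular sets\<close>

definition reg :: "'z set \<Rightarrow> bool"
  where "reg A \<longleftrightarrow>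
    (\<forall>\<epsilon>>0. \<exists>K U. compact K \<and> open U \<and> K \<subseteq> A \<and> A \<subseteq> U \<and> ov (U - K) \<le> \<epsilon>)"

lemma regE:
  assumes "reg A" "0 < \<epsilon>"
  obtains K U where "compact K" "open U" "K \<subseteq> A" "A \<subseteq> U" "ov (U - K) \<le> \<epsilon>"
  using assms unfolding reg_def by meson

end

text \<open>Applied to subsequences, the assumption says that \<open>T\<close> sends disjointly
  supported sequences of the unit ball to null sequences. It is the only trace that the two
  alternatives for the range space leave in the construction of the measure.\<close>

locale strongly_bounded_operator = c0_operator T
  for T :: "('z::t2_space, 'e::banach) c0fun \<Rightarrow>\<^sub>L 'f::banach" +
  assumes strongly_bounded:
    "\<And>(g :: nat \<Rightarrow> ('z, 'e) c0fun) \<delta>. (\<And>n. norm (g n) \<le> 1) \<Longrightarrow>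
      (\<And>m n z. m < n \<Longrightarrow> apply_c0 (g m) z = 0 \<or> apply_c0 (g n) z = 0) \<Longrightarrow> 0 < \<delta> \<Longrightarrow>
      \<exists>n. norm (T (g n)) < \<delta>"
begin

text \<open>If every compact \<open>K\<close> leaves more than \<open>\<epsilon>\<close>, one finds
  \<open>G K\<close> with compact support in \<open>U - K\<close> and \<open>norm (T (G K))\<close>
  at least \<open>\<epsilon> / 2\<close>; the other half is given up for compactness of the support.
  Adding each support to \<open>K\<close> and repeating produces disjointly supported functions that
  contradict strong boundedness.\<close>

lemma ov_inner:
  assumes "open U" "0 < \<epsilon>"
  shows "\<exists>K. compact K \<and> K \<subseteq> U \<and> ov (U - K) \<le> \<epsilon>"
proof (rule ccontr)
  assume "\<not> ?thesis"
  then have big: "\<epsilon> < ov (U - K)" if "compact K" "K \<subseteq> U" for K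
    using that by (meson not_le)
  have "\<exists>g L. norm g \<le> 1 \<and> \<epsilon> / 2 \<le> norm (T g) \<and> compact L \<and> L \<subseteq> U - K \<and>
      (\<forall>z. z \<notin> L \<longrightarrow> apply_c0 g z = 0)" if K: "compact K" "K \<subseteq> U" for K
  proof -
    obtain f where f: "norm f \<le> 1" "\<And>z. z \<notin> U - K \<Longrightarrow> apply_c0 f z = 0" "\<epsilon> < norm (T f)"
      using big[OF K] ov_least[of "U - K" \<epsilon>] by (meson not_le)
    have "\<exists>g L. norm g \<le> 1 \<and> norm (T f) \<le> norm (T g) + \<epsilon> / 2 \<and> compact L \<and> L \<subseteq> U - K \<and>
        (\<forall>z. z \<notin> L \<longrightarrow> apply_c0 g z = 0)"
      by (rule approx_compact_support[OF f(1) half_gt_zero[OF assms(2)]]) (rule f(2))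
    then obtain g L where "norm g \<le> 1" "norm (T f) \<le> norm (T g) + \<epsilon> / 2" "compact L" "L \<subseteq> U - K"
        "\<forall>z. z \<notin> L \<longrightarrow> apply_c0 g z = 0"
      by (elim exE conjE)
    then show ?thesis
      using f(3) by (intro exI[of _ g] exI[of _ L]) auto
  qed
  then obtain G L where GL: "\<And>K. compact K \<Longrightarrow> K \<subseteq> U \<Longrightarrow> norm (G K) \<le> 1 \<and> \<epsilon> / 2 \<le> norm (T (G K)) \<and>
      compact (L K) \<and> L K \<subseteq> U - K \<and> (\<forall>z. z \<notin> L K \<longrightarrow> apply_c0 (G K) z = 0)"
    by metis
  define Ks where "Ks = rec_nat {} (\<lambda>_ K. K \<union> L K)"
  have Ks0: "Ks 0 = {}" and KsS: "Ks (Suc n) = Ks n \<union> L (Ks n)" for n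
    by (auto simp: Ks_def)
  have Ks: "compact (Ks n) \<and> Ks n \<subseteq> U" for n
  proof (induction n)
    case (Suc n)
    then show ?case using GL[of "Ks n"] by (auto simp: KsS)
  qed (simp add: Ks0)
  have LK: "L (Ks m) \<subseteq> Ks n" if "m < n" for m n
    using that by (induction n) (auto simp: KsS less_Suc_eq)
  have "\<exists>n. norm (T (G (Ks n))) < \<epsilon> / 2"
  proof (rule strongly_bounded)
    show "norm (G (Ks n)) \<le> 1" for n
      using GL Ks by blast
    fix m n :: nat and z assume "m < n"
    show "apply_c0 (G (Ks m)) z = 0 \<or> apply_c0 (G (Ks n)) z = 0"
    proof (cases "z \<in> L (Ks m)")
      case True
      then have "z \<in> Ks n" using LK[OF \<open>m < n\<close>] by auto
      then have "z \<notin> L (Ks n)" using GL[of "Ks n"] Ks[of n] by auto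
      then show ?thesis using GL[of "Ks n"] Ks[of n] by auto
    next
      case False
      then show ?thesis using GL[of "Ks m"] Ks[of m] by auto
    qed
  qed (use assms(2) in simp)
  then obtain n where "norm (T (G (Ks n))) < \<epsilon> / 2" ..
  then show False using GL[of "Ks n"] Ks[of n] by auto
qed

lemma reg_open:
  assumes "open U"
  shows "reg U"
  unfolding reg_def using ov_inner[OF assms] assms by (meson subset_refl)

text \<open>The complement of \<open>U\<close> is closed but perhaps not compact; it is cut with a
  compact \<open>L\<close> outside of which \<open>ov\<close> is small.\<close>

lemma reg_Compl:
  assumes "reg A"
  shows "reg (UNIV - A)"
  unfolding reg_def
proof (intro allI impI)
  fix \<epsilon> :: real assume "0 < \<epsilon>"
  then have e: "0 < \<epsilon> / 2" by simp
  obtain K U where KU: "compact K" "open U" "K \<subseteq> A" "A \<subseteq> U" "ov (U - K) \<le> \<epsilon> / 2"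
    using regE[OF assms e] by metis
  obtain L where L: "compact L" "ov (UNIV - L) \<le> \<epsilon> / 2"
    using ov_inner[OF open_UNIV e] by (elim exE conjE)
  have "ov ((UNIV - K) - (L - U)) \<le> ov ((U - K) \<union> (UNIV - L))"
    by (rule ov_mono) auto
  also have "\<dots> \<le> ov (U - K) + ov (UNIV - L)"
    using KU L by (intro ov_Un open_Diff) (auto intro: compact_imp_closed)
  also have "\<dots> \<le> \<epsilon>" using KU(5) L(2) by simp
  finally have "ov ((UNIV - K) - (L - U)) \<le> \<epsilon>" .
  moreover have "compact (L - U)" "open (UNIV - K)"
    using KU L by (auto intro: compact_imp_closed compact_diff)
  ultimately show "\<exists>K' U'. compact K' \<and> open U' \<and> K' \<subseteq> UNIV - A \<and> UNIV - A \<subseteq> U' \<and> ov (U' - K') \<le> \<epsilon>"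
    using KU(3,4) by (intro exI[of _ "L - U"] exI[of _ "UNIV - K"]) auto
qed

lemma ov_UN_geometric:
  fixes U :: "nat \<Rightarrow> 'z set"
  assumes "\<And>n. open (U n)" "\<And>n. ov (U n) \<le> \<epsilon> * (1 / 2) ^ Suc n" "0 \<le> \<epsilon>"
  shows "ov (\<Union>n. U n) \<le> \<epsilon>"
proof (rule ov_UN_countable[OF assms(1)])
  fix N
  have "(\<Sum>n<N. ov (U n)) \<le> (\<Sum>n<N. \<epsilon> * (1 / 2) ^ Suc n)"
    by (intro sum_mono assms(2))
  also have "\<dots> = \<epsilon> * (1 - (1 / 2) ^ N)"
    by (induction N) (auto simp: algebra_simps)
  also have "\<dots> \<le> \<epsilon> * 1"
    using assms(3) by (intro mult_left_mono) auto
  finally show "(\<Sum>n<N. ov (U n)) \<le> \<epsilon>" by simp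
qed

text \<open>A countable union of compact sets need not be compact. So a compact \<open>L\<close> is
  taken inside the union of the \<open>U n\<close>, and the small open set \<open>V\<close> of all
  gaps \<open>U n - K n\<close> is removed from it; what is left lies in the union of the
  \<open>K n\<close>.\<close>

lemma reg_UN:
  fixes A :: "nat \<Rightarrow> 'z set"
  assumes "\<And>n. reg (A n)"
  shows "reg (\<Union>n. A n)"
  unfolding reg_def
proof (intro allI impI)
  fix \<epsilon> :: real assume e: "0 < \<epsilon>"
  have "\<exists>K U. compact K \<and> open U \<and> K \<subseteq> A n \<and> A n \<subseteq> U \<and> ov (U - K) \<le> \<epsilon> / 2 * (1 / 2) ^ Suc n" for n
  proof -
    have "0 < \<epsilon> / 2 * (1 / 2) ^ Suc n" using e by simp
    then show ?thesis using assms[of n] unfolding reg_def by blast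
  qed
  then obtain K U where KU: "\<And>n. compact (K n)" "\<And>n. open (U n)" "\<And>n. K n \<subseteq> A n" "\<And>n. A n \<subseteq> U n"
      "\<And>n. ov (U n - K n) \<le> \<epsilon> / 2 * (1 / 2) ^ Suc n"
    by metis
  define V where "V = (\<Union>n. U n - K n)"
  have op: "open (U n - K n)" for n
    using KU by (intro open_Diff compact_imp_closed)
  then have "open V" unfolding V_def by (rule open_UN[OF ballI])
  moreover have "ov V \<le> \<epsilon> / 2"
    unfolding V_def by (rule ov_UN_geometric[OF op KU(5)]) (use e in simp)
  ultimately have V: "open V" "ov V \<le> \<epsilon> / 2" by auto
  have opU: "open (\<Union>n. U n)" using KU(2) by blast
  obtain L where L: "compact L" "L \<subseteq> (\<Union>n. U n)" "ov ((\<Union>n. U n) - L) \<le> \<epsilon> / 2"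
    using ov_inner[OF opU half_gt_zero[OF e]] by (elim exE conjE)
  have "ov ((\<Union>n. U n) - (L - V)) \<le> ov (((\<Union>n. U n) - L) \<union> V)"
    by (rule ov_mono) auto
  also have "\<dots> \<le> ov ((\<Union>n. U n) - L) + ov V"
    using opU V(1) L(1) by (intro ov_Un open_Diff compact_imp_closed)
  also have "\<dots> \<le> \<epsilon>" using L(3) V(2) by simp
  finally have "ov ((\<Union>n. U n) - (L - V)) \<le> \<epsilon>" .
  moreover have "compact (L - V)"
    using L(1) V(1) by (rule compact_diff)
  moreover have "L - V \<subseteq> (\<Union>n. A n)"
  proof
    fix z assume z: "z \<in> L - V"
    then obtain n where "z \<in> U n" using L(2) by auto
    moreover have "z \<notin> U n - K n" using z by (auto simp: V_def)
    ultimately show "z \<in> (\<Union>n. A n)" using KU(3)[of n] by auto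
  qed
  moreover have "(\<Union>n. A n) \<subseteq> (\<Union>n. U n)" using KU(4) by blast
  ultimately show "\<exists>K' U'. compact K' \<and> open U' \<and> K' \<subseteq> (\<Union>n. A n) \<and> (\<Union>n. A n) \<subseteq> U' \<and> ov (U' - K') \<le> \<epsilon>"
    using opU by (intro exI[of _ "L - V"] exI[of _ "\<Union>n. U n"] conjI)
qed

lemma reg_borel:
  assumes "A \<in> sets borel"
  shows "reg A"
proof -
  have "A \<in> sigma_sets UNIV {S. open S}"
    using assms by (simp add: borel_def)
  then show ?thesis
    by (induction rule: sigma_sets.induct) (use reg_open reg_open[OF open_empty] reg_Compl reg_UN in auto)
qed

text \<open>Continuity at the empty set. The compact sets \<open>K n\<close> inside
  \<open>B n\<close> have empty intersection, hence finitely many already do; if \<open>N\<close>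
  bounds these indices, each point of \<open>B N\<close> misses one of these \<open>K n\<close> and
  so lies in the gap \<open>U n - K n\<close>, which is part of \<open>V\<close>.\<close>

lemma ov_decreasing_borel:
  fixes B :: "nat \<Rightarrow> 'z set"
  assumes B: "\<And>n. B n \<in> sets borel" "decseq B" "(\<Inter>n. B n) = {}" and e: "0 < \<epsilon>"
  obtains N V where "open V" "B N \<subseteq> V" "ov V \<le> \<epsilon>"
proof -
  have "\<exists>K U. compact K \<and> open U \<and> K \<subseteq> B n \<and> B n \<subseteq> U \<and> ov (U - K) \<le> \<epsilon> * (1 / 2) ^ Suc n" for n
  proof -
    have "0 < \<epsilon> * (1 / 2) ^ Suc n" using e by simp
    then show ?thesis using reg_borel[OF B(1)[of n]] unfolding reg_def by blast
  qed
  then obtain K U where KU: "\<And>n. compact (K n)" "\<And>n. open (U n)" "\<And>n. K n \<subseteq> B n" "\<And>n. B n \<subseteq> U n"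
      "\<And>n. ov (U n - K n) \<le> \<epsilon> * (1 / 2) ^ Suc n"
    by metis
  define V where "V = (\<Union>n. U n - K n)"
  have op: "open (U n - K n)" for n
    using KU by (intro open_Diff compact_imp_closed)
  then have V: "open V" unfolding V_def by (rule open_UN[OF ballI])
  have ovV: "ov V \<le> \<epsilon>"
    unfolding V_def by (rule ov_UN_geometric[OF op KU(5)]) (use e in simp)
  have empty: "K 0 \<inter> (\<Inter>n\<in>UNIV. K n) = {}" 
  proof -
    have "(\<Inter>n. K n) \<subseteq> (\<Inter>n. B n)" by (rule INF_mono) (use KU(3) in blast)
    then show ?thesis using B(3) by simp
  qed
  have "\<exists>I. finite I \<and> K 0 \<inter> (\<Inter>n\<in>I. K n) = {}"
  proof (rule ccontr)
    assume "\<not> ?thesis"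
    then have ne: "K 0 \<inter> (\<Inter>n\<in>I. K n) \<noteq> {}" if "finite I" for I
      using that by blast
    have "K 0 \<inter> (\<Inter>n\<in>UNIV. K n) \<noteq> {}"
    proof (rule compact_imp_fip_image[OF KU(1)])
      show "closed (K n)" for n using KU(1) by (rule compact_imp_closed)
      show "K 0 \<inter> (\<Inter>n\<in>I. K n) \<noteq> {}" if "finite I" for I using that by (rule ne)
    qed
    with empty show False by contradiction
  qed
  then obtain I where I: "finite I" "K 0 \<inter> (\<Inter>n\<in>I. K n) = {}" by blast
  then obtain N where N: "\<And>n. n \<in> I \<Longrightarrow> n \<le> N"
    by (meson finite_nat_set_iff_bounded_le)
  have "B N \<subseteq> V"
  proof
    fix z assume z: "z \<in> B N"
    have "z \<notin> K 0 \<inter> (\<Inter>n\<in>I. K n)" using I(2) by simp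
    then obtain n where n: "n \<le> N" "z \<notin> K n" using N by auto
    then have "z \<in> U n" using z decseqD[OF B(2) n(1)] KU(4) by blast
    then show "z \<in> V" using n(2) by (auto simp: V_def)
  qed
  then show thesis by (rule that[OF V _ ovV])
qed

end

section \<open>The measure represented by an operator\<close>

lemma norm_disjoint_indicator_sum_le:
  fixes x :: "'i \<Rightarrow> 'e::real_normed_vector"
  assumes "finite I" "disjoint_family_on A I" "\<And>i. i \<in> I \<Longrightarrow> norm (x i) \<le> B" "0 \<le> B"
  shows "norm (\<Sum>i\<in>I. indicator (A i) z *\<^sub>R x i) \<le> B"
proof (cases "\<exists>i\<in>I. z \<in> A i")
  case True
  then obtain i where i: "i \<in> I" "z \<in> A i" by blast
  have "(\<Sum>j\<in>I. indicator (A j) z *\<^sub>R x j) = (\<Sum>j\<in>I. if j = i then x i else 0)"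
    using assms(2) i by (intro sum.cong) (auto simp: disjoint_family_on_def indicator_def)
  then show ?thesis using assms(1,3) i(1) by simp
next
  case False
  then show ?thesis using assms(4) by (simp add: indicator_def)
qed

context strongly_bounded_operator
begin

text \<open>\<open>rep f y\<close> says that \<open>y\<close> is the value at \<open>f\<close> of the extension of \<open>T\<close> by bounded
  approximation outside of open sets of small semivariation.\<close>

definition rep :: "('z \<Rightarrow> 'e) \<Rightarrow> 'f \<Rightarrow> bool"
  where "rep f y \<longleftrightarrow> (\<exists>C. \<forall>\<epsilon>>0. \<exists>g V. open V \<and> ov V \<le> \<epsilon> \<and> norm g \<le> C \<and>
    (\<forall>z. z \<notin> V \<longrightarrow> norm (f z - apply_c0 g z) \<le> \<epsilon>) \<and> norm (y - T g) \<le> \<epsilon>)"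

section \<open>Linearity, bounds and uniqueness of the extension\<close>

lemma rep_c0: "rep (apply_c0 g) (T g)"
  unfolding rep_def
proof (intro exI[of _ "norm g"] allI impI)
  fix \<epsilon> :: real assume "0 < \<epsilon>"
  then show "\<exists>g' V. open V \<and> ov V \<le> \<epsilon> \<and> norm g' \<le> norm g \<and>
      (\<forall>z. z \<notin> V \<longrightarrow> norm (apply_c0 g z - apply_c0 g' z) \<le> \<epsilon>) \<and> norm (T g - T g') \<le> \<epsilon>"
    by (intro exI[of _ g] exI[of _ "{}"]) (simp add: ov_empty)
qed

lemma rep_add:
  assumes "rep f y" "rep f' y'"
  shows "rep (\<lambda>z. f z + f' z) (y + y')"
proof -
  obtain C where C: "\<And>\<epsilon>. 0 < \<epsilon> \<Longrightarrow> \<exists>g V. open V \<and> ov V \<le> \<epsilon> \<and> norm g \<le> C \<and>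
      (\<forall>z. z \<notin> V \<longrightarrow> norm (f z - apply_c0 g z) \<le> \<epsilon>) \<and> norm (y - T g) \<le> \<epsilon>"
    using assms(1) unfolding rep_def by blast
  obtain C' where C': "\<And>\<epsilon>. 0 < \<epsilon> \<Longrightarrow> \<exists>g V. open V \<and> ov V \<le> \<epsilon> \<and> norm g \<le> C' \<and>
      (\<forall>z. z \<notin> V \<longrightarrow> norm (f' z - apply_c0 g z) \<le> \<epsilon>) \<and> norm (y' - T g) \<le> \<epsilon>"
    using assms(2) unfolding rep_def by blast
  show ?thesis
    unfolding rep_def
  proof (intro exI[of _ "C + C'"] allI impI)
    fix \<epsilon> :: real assume "0 < \<epsilon>"
    then have e: "0 < \<epsilon> / 2" by simp
    obtain g V where gV: "open V" "ov V \<le> \<epsilon> / 2" "norm g \<le> C"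
      "\<And>z. z \<notin> V \<Longrightarrow> norm (f z - apply_c0 g z) \<le> \<epsilon> / 2" "norm (y - T g) \<le> \<epsilon> / 2"
      using C[OF e] by (elim exE conjE) simp
    obtain g' V' where gV': "open V'" "ov V' \<le> \<epsilon> / 2" "norm g' \<le> C'"
      "\<And>z. z \<notin> V' \<Longrightarrow> norm (f' z - apply_c0 g' z) \<le> \<epsilon> / 2" "norm (y' - T g') \<le> \<epsilon> / 2"
      using C'[OF e] by (elim exE conjE) simp
    show "\<exists>h W. open W \<and> ov W \<le> \<epsilon> \<and> norm h \<le> C + C' \<and>
      (\<forall>z. z \<notin> W \<longrightarrow> norm (f z + f' z - apply_c0 h z) \<le> \<epsilon>) \<and> norm (y + y' - T h) \<le> \<epsilon>"
    proof (intro exI[of _ "g + g'"] exI[of _ "V \<union> V'"] conjI allI impI)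
      show "open (V \<union> V')" using gV(1) gV'(1) by (rule open_Un)
      show "ov (V \<union> V') \<le> \<epsilon>" using ov_Un[OF gV(1) gV'(1)] gV(2) gV'(2) by linarith
      show "norm (g + g') \<le> C + C'" using norm_triangle_mono[OF gV(3) gV'(3)] .
      show "norm (f z + f' z - apply_c0 (g + g') z) \<le> \<epsilon>" if "z \<notin> V \<union> V'" for z
      proof -
        have eq: "f z + f' z - apply_c0 (g + g') z = (f z - apply_c0 g z) + (f' z - apply_c0 g' z)"
          by (simp add: plus_c0fun.rep_eq)
        show ?thesis
          unfolding eq using norm_triangle_mono[OF gV(4) gV'(4), of z z] that by simp
      qed
      have eq: "y + y' - T (g + g') = (y - T g) + (y' - T g')"
        by (simp add: blinfun.add_right)
      show "norm (y + y' - T (g + g')) \<le> \<epsilon>"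
        unfolding eq using norm_triangle_mono[OF gV(5) gV'(5)] by simp
    qed
  qed
qed

text \<open>One proof for real scalars and for scalars of \<open>'k\<close>: \<open>A\<close> acts
  on the values of functions, \<open>B\<close> on the range, and \<open>ex\<close> says that
  \<open>T\<close> intertwines them.\<close>

lemma rep_map:
  fixes A :: "'e \<Rightarrow> 'e" and B :: "'f \<Rightarrow> 'f"
  assumes f: "rep f y" and "0 \<le> \<kappa>"
    and ex: "\<And>g. \<exists>g'. (\<forall>z. apply_c0 g' z = A (apply_c0 g z)) \<and> T g' = B (T g)"
    and A: "\<And>x x'. norm (A x - A x') \<le> \<kappa> * norm (x - x')" "A 0 = 0"
    and B: "\<And>x x'. norm (B x - B x') \<le> \<kappa> * norm (x - x')"
  shows "rep (\<lambda>z. A (f z)) (B y)"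
proof -
  obtain C where C: "\<And>\<epsilon>. 0 < \<epsilon> \<Longrightarrow> \<exists>g V. open V \<and> ov V \<le> \<epsilon> \<and> norm g \<le> C \<and>
      (\<forall>z. z \<notin> V \<longrightarrow> norm (f z - apply_c0 g z) \<le> \<epsilon>) \<and> norm (y - T g) \<le> \<epsilon>"
    using f unfolding rep_def by blast
  show ?thesis
    unfolding rep_def
  proof (intro exI[of _ "\<kappa> * C"] allI impI)
    fix \<epsilon> :: real assume e0: "0 < \<epsilon>"
    define \<epsilon>' where "\<epsilon>' = \<epsilon> / (\<kappa> + 1)"
    have e: "0 < \<epsilon>'" "\<epsilon>' \<le> \<epsilon>"
      using e0 \<open>0 \<le> \<kappa>\<close> by (auto simp: \<epsilon>'_def divide_le_eq mult_le_cancel_left1)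
    have "\<kappa> / (\<kappa> + 1) \<le> 1" using \<open>0 \<le> \<kappa>\<close> by (simp add: divide_le_eq)
    then have ke: "\<kappa> * \<epsilon>' \<le> \<epsilon>"
      using mult_left_mono[of "\<kappa> / (\<kappa> + 1)" 1 \<epsilon>] e0 by (simp add: \<epsilon>'_def mult.commute)
    obtain g V where gV: "open V" "ov V \<le> \<epsilon>'" "norm g \<le> C"
      "\<And>z. z \<notin> V \<Longrightarrow> norm (f z - apply_c0 g z) \<le> \<epsilon>'" "norm (y - T g) \<le> \<epsilon>'"
      using C[OF e(1)] by (elim exE conjE) simp
    obtain g' where g': "\<And>z. apply_c0 g' z = A (apply_c0 g z)" "T g' = B (T g)"
      using ex[of g] by blast
    show "\<exists>g V. open V \<and> ov V \<le> \<epsilon> \<and> norm g \<le> \<kappa> * C \<and>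
      (\<forall>z. z \<notin> V \<longrightarrow> norm (A (f z) - apply_c0 g z) \<le> \<epsilon>) \<and> norm (B y - T g) \<le> \<epsilon>"
    proof (intro exI[of _ g'] exI[of _ V] conjI allI impI)
      show "open V" by fact
      show "ov V \<le> \<epsilon>" using gV(2) e(2) by simp
      show "norm g' \<le> \<kappa> * C"
      proof (rule norm_c0_least)
        fix z
        have "norm (apply_c0 g' z) \<le> \<kappa> * norm (apply_c0 g z)"
          using A(1)[of "apply_c0 g z" 0] A(2) by (simp add: g')
        also have "\<dots> \<le> \<kappa> * C"
          using norm_c0_le[of g z] gV(3) \<open>0 \<le> \<kappa>\<close> by (intro mult_left_mono) auto
        finally show "norm (apply_c0 g' z) \<le> \<kappa> * C" .
      qed
      show "norm (A (f z) - apply_c0 g' z) \<le> \<epsilon>" if "z \<notin> V" for z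
      proof -
        have "norm (A (f z) - apply_c0 g' z) \<le> \<kappa> * norm (f z - apply_c0 g z)"
          using A(1) by (simp add: g')
        also have "\<dots> \<le> \<kappa> * \<epsilon>'" using gV(4)[OF that] \<open>0 \<le> \<kappa>\<close> by (rule mult_left_mono)
        finally show ?thesis using ke by simp
      qed
      have "norm (B y - T g') \<le> \<kappa> * norm (y - T g)" using B by (simp add: g')
      also have "\<dots> \<le> \<kappa> * \<epsilon>'" using gV(5) \<open>0 \<le> \<kappa>\<close> by (rule mult_left_mono)
      finally show "norm (B y - T g') \<le> \<epsilon>" using ke by simp
    qed
  qed
qed

lemma rep_scaleR:
  assumes "rep f y"
  shows "rep (\<lambda>z. r *\<^sub>R f z) (r *\<^sub>R y)"
proof (rule rep_map[OF assms, of "\<bar>r\<bar>"])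
  show "\<exists>g'. (\<forall>z. apply_c0 g' z = r *\<^sub>R apply_c0 g z) \<and> T g' = r *\<^sub>R T g" for g
    by (intro exI[of _ "r *\<^sub>R g"]) (simp add: scaleR_c0fun.rep_eq blinfun.scaleR_right)
qed (simp_all flip: scaleR_right_diff_distrib)

lemma rep_scale:
  fixes sE :: "'k::real_or_complex \<Rightarrow> 'e \<Rightarrow> 'e"
  assumes "normed_over sE" "normed_over sF" "T \<in> linops (c0_scale sE) sF" "rep f y"
  shows "rep (\<lambda>z. sE c (f z)) (sF c y)"
proof -
  interpret E: normed_over sE by fact
  interpret F: normed_over sF by fact
  show ?thesis
  proof (rule rep_map[OF assms(4), of "norm c"])
    show "\<exists>g'. (\<forall>z. apply_c0 g' z = sE c (apply_c0 g z)) \<and> T g' = sF c (T g)" for g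
      by (intro exI[of _ "c0_scale sE c g"])
        (simp add: apply_c0_scale[OF assms(1)] linops_apply[OF assms(3)])
  qed (simp_all add: E.norm_scale F.norm_scale flip: E.scale_right_diff_distrib F.scale_right_diff_distrib)
qed

lemma rep_diff:
  assumes "rep f y" "rep f' y'"
  shows "rep (\<lambda>z. f z - f' z) (y - y')"
  using rep_add[OF assms(1) rep_scaleR[OF assms(2), of "-1"]] by simp

text \<open>The estimate on which all uses of \<open>rep\<close> rest. An approximant
  \<open>g\<close> is truncated at height \<open>B + \<epsilon>\<close>. The part cut off lives on
  \<open>V\<close> and is bounded by \<open>C\<close>, so it costs \<open>C * \<epsilon>\<close>,
  which tends to zero because \<open>C\<close> is fixed before \<open>\<epsilon>\<close>; the
  truncation \<open>h\<close> is small off \<open>U \<union> V\<close>.\<close>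

lemma rep_bound:
  assumes "rep f y" "\<And>z. norm (f z) \<le> B" "open U" "\<And>z. z \<notin> U \<Longrightarrow> f z = 0"
  shows "norm y \<le> B * ov U"
proof -
  obtain C where C: "\<And>\<epsilon>. 0 < \<epsilon> \<Longrightarrow> \<exists>g V. open V \<and> ov V \<le> \<epsilon> \<and> norm g \<le> C \<and>
      (\<forall>z. z \<notin> V \<longrightarrow> norm (f z - apply_c0 g z) \<le> \<epsilon>) \<and> norm (y - T g) \<le> \<epsilon>"
    using assms(1) unfolding rep_def by blast
  have B: "0 \<le> B" using assms(2) norm_ge_zero order_trans by blast
  \<comment> \<open>The errors in order: \<open>norm (y - T g)\<close>, the part cut off, and the
    two terms of \<open>norm_apply_le_ov\<close> for \<open>h\<close>.\<close>
  define R where "R \<epsilon> = \<epsilon> + C * \<epsilon> + (B + \<epsilon>) * (ov U + \<epsilon>) + norm T * \<epsilon>" for \<epsilon>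
  have le: "norm y \<le> R \<epsilon>" if e: "0 < \<epsilon>" for \<epsilon>
  proof -
    obtain g V where gV: "open V" "ov V \<le> \<epsilon>" "norm g \<le> C"
      "\<And>z. z \<notin> V \<Longrightarrow> norm (f z - apply_c0 g z) \<le> \<epsilon>" "norm (y - T g) \<le> \<epsilon>"
      using C[OF e] by (elim exE conjE) simp
    have C0: "0 \<le> C" using gV(3) norm_ge_zero[of g] by linarith
    have Be: "0 < B + \<epsilon>" using B e by simp
    obtain h :: "('z, 'e) c0fun" where h: "\<And>z. apply_c0 h z = radial (B + \<epsilon>) (apply_c0 g z)"
      using c0_radial[OF Be] by metis
    have gb: "norm (apply_c0 g z) \<le> norm (f z) + \<epsilon>" if "z \<notin> V" for z
      using gV(4)[OF that] norm_triangle_ineq2[of "apply_c0 g z" "f z"] by (simp add: norm_minus_commute)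
    have "norm (T (g - h)) \<le> C * ov V"
    proof (rule ov_upper)
      show "norm (g - h) \<le> C"
      proof (rule norm_c0_least)
        show "norm (apply_c0 (g - h) z) \<le> C" for z
          using norm_c0_le[of g z] gV(3) C0 Be
          unfolding minus_c0fun.rep_eq h norm_minus_radial[OF Be] by simp
      qed
      show "apply_c0 (g - h) z = 0" if "z \<notin> V" for z
        using gb[OF that] assms(2)[of z] Be by (simp add: minus_c0fun.rep_eq h radial_id)
    qed
    also have "\<dots> \<le> C * \<epsilon>" using gV(2) C0 by (rule mult_left_mono)
    finally have 1: "norm (T (g - h)) \<le> C * \<epsilon>" .
    have "norm (T h) \<le> (B + \<epsilon>) * ov (U \<union> V) + norm T * \<epsilon>"
    proof (rule norm_apply_le_ov[OF _ _ e])
      show "norm h \<le> B + \<epsilon>"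
        by (rule norm_c0_least) (simp add: h norm_radial_le Be)
      show "norm (apply_c0 h z) \<le> \<epsilon>" if "z \<notin> U \<union> V" for z
        using gb[of z] assms(4)[of z] that norm_radial_le_norm[OF Be, of "apply_c0 g z"] by (simp add: h)
    qed
    also have "(B + \<epsilon>) * ov (U \<union> V) \<le> (B + \<epsilon>) * (ov U + \<epsilon>)"
      using ov_Un[OF assms(3) gV(1)] gV(2) Be by (intro mult_left_mono) auto
    finally have 2: "norm (T h) \<le> (B + \<epsilon>) * (ov U + \<epsilon>) + norm T * \<epsilon>" by simp
    have "y = (y - T g) + (T (g - h) + T h)" by (simp add: blinfun.diff_right)
    then have "norm y \<le> norm (y - T g) + (norm (T (g - h)) + norm (T h))"
      by (metis norm_triangle_ineq norm_triangle_mono order_refl)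
    then show ?thesis using gV(5) 1 2 by (simp add: R_def)
  qed
  show ?thesis
  proof (rule tendsto_lowerbound)
    have "(\<lambda>n. R (inverse (real (Suc n)))) \<longlonglongrightarrow> 0 + C * 0 + (B + 0) * (ov U + 0) + norm T * 0"
      unfolding R_def by (intro tendsto_intros LIMSEQ_inverse_real_of_nat)
    then show "(\<lambda>n. R (inverse (real (Suc n)))) \<longlonglongrightarrow> B * ov U" by simp
    show "\<forall>\<^sub>F n in sequentially. norm y \<le> R (inverse (real (Suc n)))"
      using le by (intro always_eventually) auto
  qed simp
qed

lemma rep_unique:
  assumes "rep f y" "rep f y'"
  shows "y = y'"
  using rep_bound[OF rep_diff[OF assms], of 0 "{}"] by simp

text \<open>Bumps that are \<open>x\<close> on \<open>K n\<close> and zero off \<open>U n\<close>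
  agree with the function to be represented off the open gap \<open>U n - K n\<close>. Two of them
  differ only on two gaps of small \<open>ov\<close>, so their images form a Cauchy
  sequence.\<close>

lemma rep_indicator_exists:
  assumes "A \<in> sets borel"
  shows "\<exists>y. rep (\<lambda>z. indicator A z *\<^sub>R x) y"
proof -
  define e where "e n = inverse (real (Suc n))" for n
  have e: "0 < e n" for n by (simp add: e_def)
  have "\<exists>K U. compact K \<and> open U \<and> K \<subseteq> A \<and> A \<subseteq> U \<and> ov (U - K) \<le> e n" for n
    using reg_borel[OF assms] e[of n] unfolding reg_def by blast
  then obtain K U where KU: "\<And>n. compact (K n)" "\<And>n. open (U n)" "\<And>n. K n \<subseteq> A" "\<And>n. A \<subseteq> U n"
      "\<And>n. ov (U n - K n) \<le> e n"
    by metis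
  have "\<exists>g. norm g \<le> norm x \<and> (\<forall>z\<in>K n. apply_c0 g z = x) \<and> (\<forall>z. z \<notin> U n \<longrightarrow> apply_c0 g z = 0)" for n
    using c0_bump[OF lc KU(1) KU(2) order_trans[OF KU(3) KU(4)], where x=x] by metis
  then obtain g where g: "\<And>n. norm (g n) \<le> norm x" "\<And>n z. z \<in> K n \<Longrightarrow> apply_c0 (g n) z = x"
      "\<And>n z. z \<notin> U n \<Longrightarrow> apply_c0 (g n) z = 0"
    by metis
  have op: "open (U n - K n)" for n
    using KU by (intro open_Diff compact_imp_closed)
  have ind: "apply_c0 (g n) z = indicator A z *\<^sub>R x" if "z \<notin> U n - K n" for n z
  proof (cases "z \<in> K n")
    case True
    then show ?thesis using g(2) KU(3)[of n] by auto
  next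
    case False
    then have "z \<notin> U n" using that by simp
    moreover then have "z \<notin> A" using KU(4)[of n] by auto
    ultimately show ?thesis using g(3) by simp
  qed
  have diff: "norm (T (g n) - T (g m)) \<le> 2 * norm x * (e n + e m)" for n m
  proof -
    have "norm (T (g n - g m)) \<le> (norm x + norm x) * ov ((U n - K n) \<union> (U m - K m))"
    proof (rule ov_upper)
      show "norm (g n - g m) \<le> norm x + norm x"
        using norm_triangle_ineq4[of "g n" "g m"] g(1)[of n] g(1)[of m] by linarith
      show "apply_c0 (g n - g m) z = 0" if "z \<notin> (U n - K n) \<union> (U m - K m)" for z
        using ind[of z n] ind[of z m] that by (simp add: minus_c0fun.rep_eq)
    qed
    also have "\<dots> \<le> (norm x + norm x) * (e n + e m)"
      using ov_Un[OF op op, of n m] KU(5)[of n] KU(5)[of m] by (intro mult_left_mono) auto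
    finally show ?thesis by (simp add: blinfun.diff_right)
  qed
  have "Cauchy (\<lambda>n. T (g n))"
  proof (rule metric_CauchyI)
    fix \<epsilon> :: real assume "0 < \<epsilon>"
    have "(\<lambda>n. 2 * norm x * (e n + e n)) \<longlonglongrightarrow> 2 * norm x * (0 + 0)"
      unfolding e_def by (intro tendsto_intros LIMSEQ_inverse_real_of_nat)
    then obtain N where N: "2 * norm x * (e N + e N) < \<epsilon>"
      using order_tendstoD(2)[of _ _ sequentially \<epsilon>] \<open>0 < \<epsilon>\<close> unfolding eventually_sequentially
      by (metis add.right_neutral le_refl mult_zero_right)
    have "dist (T (g m)) (T (g n)) < \<epsilon>" if "N \<le> m" "N \<le> n" for m n
    proof -
      have "e m \<le> e N" "e n \<le> e N"
        using that by (auto simp: e_def intro: le_imp_inverse_le)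
      then have "2 * norm x * (e m + e n) \<le> 2 * norm x * (e N + e N)"
        by (intro mult_left_mono) auto
      then show ?thesis using diff[of m n] N by (simp add: dist_norm)
    qed
    then show "\<exists>M. \<forall>m\<ge>M. \<forall>n\<ge>M. dist (T (g m)) (T (g n)) < \<epsilon>" by blast
  qed
  then obtain y where y: "(\<lambda>n. T (g n)) \<longlonglongrightarrow> y"
    using Cauchy_convergent_iff convergent_def by blast
  have "rep (\<lambda>z. indicator A z *\<^sub>R x) y"
    unfolding rep_def
  proof (intro exI[of _ "norm x"] allI impI)
    fix \<epsilon> :: real assume "0 < \<epsilon>"
    have "\<forall>\<^sub>F n in sequentially. dist (T (g n)) y < \<epsilon>"
      using tendstoD[OF y \<open>0 < \<epsilon>\<close>] .
    moreover have "\<forall>\<^sub>F n in sequentially. e n < \<epsilon>"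
      unfolding e_def using LIMSEQ_inverse_real_of_nat \<open>0 < \<epsilon>\<close> by (rule order_tendstoD)
    ultimately have "\<forall>\<^sub>F n in sequentially. dist (T (g n)) y < \<epsilon> \<and> e n < \<epsilon>"
      by (rule eventually_conj)
    then obtain n where n: "dist (T (g n)) y < \<epsilon>" "e n < \<epsilon>"
      unfolding eventually_sequentially by blast
    show "\<exists>g V. open V \<and> ov V \<le> \<epsilon> \<and> norm g \<le> norm x \<and>
      (\<forall>z. z \<notin> V \<longrightarrow> norm (indicator A z *\<^sub>R x - apply_c0 g z) \<le> \<epsilon>) \<and> norm (y - T g) \<le> \<epsilon>"
    proof (intro exI[of _ "g n"] exI[of _ "U n - K n"] conjI allI impI)
      show "norm (indicator A z *\<^sub>R x - apply_c0 (g n) z) \<le> \<epsilon>" if "z \<notin> U n - K n" for z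
        using ind[OF that] \<open>0 < \<epsilon>\<close> by simp
      show "ov (U n - K n) \<le> \<epsilon>" using KU(5)[of n] n(2) by simp
      show "norm (y - T (g n)) \<le> \<epsilon>" using n(1) by (simp add: dist_norm norm_minus_commute)
    qed (rule op g(1))+
  qed
  then show ?thesis ..
qed

text \<open>Values outside the Borel sets carry no meaning; \<open>restrict\<close> fixes them, so
  that the measure can be unique as a function on all sets.\<close>

definition rep_measure :: "'z set \<Rightarrow> 'e \<Rightarrow>\<^sub>L 'f"
  where "rep_measure = restrict
    (\<lambda>A. Blinfun (\<lambda>x. THE y. rep (\<lambda>z. indicator A z *\<^sub>R x) y)) (sets borel)"

lemma rep_rep_measure:
  assumes A: "A \<in> sets borel"
  shows "rep (\<lambda>z. indicator A z *\<^sub>R x) (rep_measure A x)"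
proof -
  define m where "m x = (THE y. rep (\<lambda>z. indicator A z *\<^sub>R x) y)" for x
  have m: "rep (\<lambda>z. indicator A z *\<^sub>R x) (m x)" for x
    unfolding m_def using rep_indicator_exists[OF A, of x] rep_unique by (metis theI')
  have "bounded_linear m"
  proof (rule bounded_linear_intro)
    show "m (x + x') = m x + m x'" for x x'
      using rep_add[OF m[of x] m[of x']] m[of "x + x'"] by (simp add: scaleR_right_distrib rep_unique)
    show "m (r *\<^sub>R x) = r *\<^sub>R m x" for r x
      using rep_scaleR[OF m[of x], of r] m[of "r *\<^sub>R x"] by (simp add: mult.commute rep_unique)
    show "norm (m x) \<le> norm x * ov UNIV" for x
      by (rule rep_bound[OF m]) (auto simp: indicator_def)
  qed
  moreover have "rep_measure A = Blinfun m"
    using A by (simp add: rep_measure_def m_def[abs_def])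
  ultimately have "rep_measure A x = m x"
    by (simp add: bounded_linear_Blinfun_apply)
  then show ?thesis using m by simp
qed

lemma rep_sum:
  assumes "finite I" "\<And>i. i \<in> I \<Longrightarrow> A i \<in> sets borel"
  shows "rep (\<lambda>z. \<Sum>i\<in>I. indicator (A i) z *\<^sub>R x i) (\<Sum>i\<in>I. rep_measure (A i) (x i))"
  using assms
proof (induction I rule: finite_induct)
  case empty
  have "rep (apply_c0 0) (T 0)" by (rule rep_c0)
  then show ?case by (simp add: zero_c0fun.rep_eq blinfun.zero_right)
next
  case (insert i I)
  show ?case
    unfolding sum.insert[OF insert(1,2)] using insert.prems
    by (intro rep_add rep_rep_measure insert.IH) auto
qed

text \<open>The common source of both convergence statements for the measure: the tails of a
  disjoint sequence decrease to the empty set and are therefore swallowed by an open set of small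
  \<open>ov\<close>.\<close>

lemma rep_measure_tail:
  fixes A :: "nat \<Rightarrow> 'z set"
  assumes A: "range A \<subseteq> sets borel" "disjoint_family A" and e: "0 < \<epsilon>"
  shows "\<exists>N V. open V \<and> ov V \<le> \<epsilon> \<and> (\<Union>n\<in>{N..}. A n) \<subseteq> V"
proof -
  define B where "B N = (\<Union>n\<in>{N..}. A n)" for N
  have "(\<Inter>N. B N) = {}"
  proof (rule equals0I)
    fix z assume z: "z \<in> (\<Inter>N. B N)"
    then have "z \<in> B 0" by blast
    then obtain n where n: "z \<in> A n" by (auto simp: B_def)
    have "z \<in> B (Suc n)" using z by blast
    then obtain m where "Suc n \<le> m" "z \<in> A m" by (auto simp: B_def)
    then show False
      using n A(2) unfolding disjoint_family_on_def by (metis IntI Suc_n_not_le_n UNIV_I emptyE)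
  qed
  moreover have "decseq B"
    unfolding decseq_def B_def by (intro allI impI UN_mono) auto
  moreover have "B n \<in> sets borel" for n
    unfolding B_def using A(1) by (intro sets.countable_UN') auto
  ultimately obtain N V where "open V" "B N \<subseteq> V" "ov V \<le> \<epsilon>"
    using ov_decreasing_borel[of B \<epsilon>] e by metis
  then show ?thesis unfolding B_def by blast
qed

text \<open>A tail of either series is represented by a function that vanishes off the open set of
  \<open>rep_measure_tail\<close>. By disjointness this function obeys the common bound of the
  vectors, however they vary with \<open>n\<close>, so \<open>rep_bound\<close> applies; this
  uniformity is what independent convergence asks for.\<close>

lemma i_measure_rep_measure:
  fixes sE :: "'k::real_or_complex \<Rightarrow> 'e \<Rightarrow> 'e"
  assumes sE: "normed_over sE" and sF: "normed_over sF" and T: "T \<in> linops (c0_scale sE) sF"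
  shows "i_measure sE sF borel rep_measure"
  unfolding i_measure_def independently_convergent_def
proof (intro conjI ballI allI impI)
  interpret E: normed_over sE by fact
  have comm: "sE c (r *\<^sub>R x) = r *\<^sub>R sE c x" for c r x
    by (metis E.scale_of_real E.scale_left_commute)
  fix A :: "'z set" assume A: "A \<in> sets borel"
  show "rep_measure A \<in> linops sE sF"
  proof (rule linopsI[OF sE sF])
    show "rep_measure A (sE c x) = sF c (rep_measure A x)" for c x
      using rep_scale[OF sE sF T rep_rep_measure[OF A, of x], of c] rep_rep_measure[OF A, of "sE c x"]
      by (simp add: comm rep_unique)
  qed
next
  fix A :: "nat \<Rightarrow> 'z set" and x
  assume A: "range A \<subseteq> sets borel" "disjoint_family A"
  then have An: "A n \<in> sets borel" for n by auto
  have UA: "(\<Union>n. A n) \<in> sets borel" using An by blast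
  show "(\<lambda>n. rep_measure (A n) x) sums rep_measure (\<Union>n. A n) x"
    unfolding sums_def
  proof (rule metric_LIMSEQ_I)
    fix \<epsilon> :: real assume "0 < \<epsilon>"
    have pos: "0 < norm x + 1" using norm_ge_zero[of x] by linarith
    then have "0 < \<epsilon> / (norm x + 1)" using \<open>0 < \<epsilon>\<close> by simp
    from rep_measure_tail[OF A this] obtain N V where
      V: "open V" "ov V \<le> \<epsilon> / (norm x + 1)" "(\<Union>n\<in>{N..}. A n) \<subseteq> V" by blast
    have "dist (\<Sum>n<k. rep_measure (A n) x) (rep_measure (\<Union>n. A n) x) < \<epsilon>" if k: "N \<le> k" for k
    proof -
      have "rep (\<lambda>z. indicator (\<Union>n. A n) z *\<^sub>R x - (\<Sum>n<k. indicator (A n) z *\<^sub>R x))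
          (rep_measure (\<Union>n. A n) x - (\<Sum>n<k. rep_measure (A n) x))"
        using An by (intro rep_diff rep_rep_measure UA rep_sum) auto
      moreover have "indicator (\<Union>n. A n) z *\<^sub>R x - (\<Sum>n<k. indicator (A n) z *\<^sub>R x) =
          indicator (\<Union>n\<in>{k..}. A n) z *\<^sub>R x" for z
      proof (cases "\<exists>n. z \<in> A n")
        case True
        then obtain n where n: "z \<in> A n" by blast
        then have iff: "z \<in> A m \<longleftrightarrow> m = n" for m
          using A(2) by (auto simp: disjoint_family_on_def)
        then have "(\<Sum>m<k. indicator (A m) z *\<^sub>R x) = (\<Sum>m<k. if m = n then x else 0)"
          by (intro sum.cong) (auto simp: indicator_def)
        then show ?thesis
          using iff by (auto simp: indicator_def)
      next
        case False
        then show ?thesis by (simp add: indicator_def)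
      qed
      ultimately have "rep (\<lambda>z. indicator (\<Union>n\<in>{k..}. A n) z *\<^sub>R x)
          (rep_measure (\<Union>n. A n) x - (\<Sum>n<k. rep_measure (A n) x))" by simp
      then have "norm (rep_measure (\<Union>n. A n) x - (\<Sum>n<k. rep_measure (A n) x)) \<le> norm x * ov V"
      proof (rule rep_bound)
        show "norm (indicator (\<Union>n\<in>{k..}. A n) z *\<^sub>R x) \<le> norm x" for z
          by (simp add: indicator_def)
        show "indicator (\<Union>n\<in>{k..}. A n) z *\<^sub>R x = 0" if "z \<notin> V" for z
          using V(3) that k by (force simp: indicator_def)
      qed fact
      also have "\<dots> \<le> norm x * (\<epsilon> / (norm x + 1))"
        using V(2) by (intro mult_left_mono) auto
      also have "\<dots> < \<epsilon>"
        using mult_strict_left_mono[of "norm x / (norm x + 1)" 1 \<epsilon>] pos \<open>0 < \<epsilon>\<close>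
        by (simp add: mult.commute)
      finally show ?thesis by (simp add: dist_norm norm_minus_commute)
    qed
    then show "\<exists>no. \<forall>n\<ge>no. dist (\<Sum>n<n. rep_measure (A n) x) (rep_measure (\<Union>n. A n) x) < \<epsilon>" by blast
  qed
next
  fix A :: "nat \<Rightarrow> 'z set" and x :: "nat \<Rightarrow> 'e"
  assume A: "range A \<subseteq> sets borel" "disjoint_family A" and "bounded (range x)"
  then obtain B where B: "0 < B" "\<And>n. norm (x n) \<le> B"
    by (auto simp: bounded_pos)
  show "summable (\<lambda>n. rep_measure (A n) (x n))"
    unfolding summable_Cauchy
  proof (intro allI impI)
    fix \<epsilon> :: real assume "0 < \<epsilon>"
    then have "0 < \<epsilon> / (2 * B)" using B(1) by simp
    from rep_measure_tail[OF A this] obtain N V where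
      V: "open V" "ov V \<le> \<epsilon> / (2 * B)" "(\<Union>n\<in>{N..}. A n) \<subseteq> V" by blast
    have "norm (\<Sum>n\<in>{m..<k}. rep_measure (A n) (x n)) < \<epsilon>" if "N \<le> m" for m k
    proof -
      have "norm (\<Sum>n\<in>{m..<k}. rep_measure (A n) (x n)) \<le> B * ov V"
      proof (rule rep_bound[OF rep_sum])
        show "norm (\<Sum>i\<in>{m..<k}. indicator (A i) z *\<^sub>R x i) \<le> B" for z
          using A(2) B by (intro norm_disjoint_indicator_sum_le) (auto simp: disjoint_family_on_def)
        show "(\<Sum>i\<in>{m..<k}. indicator (A i) z *\<^sub>R x i) = 0" if "z \<notin> V" for z
          using V(3) that \<open>N \<le> m\<close> by (intro sum.neutral) (force simp: indicator_def)
      qed (use A V in auto)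
      also have "\<dots> \<le> B * (\<epsilon> / (2 * B))" using V(2) B(1) by (intro mult_left_mono) auto
      also have "\<dots> < \<epsilon>" using B(1) \<open>0 < \<epsilon>\<close> by simp
      finally show ?thesis .
    qed
    then show "\<exists>N. \<forall>m\<ge>N. \<forall>n. norm (\<Sum>k = m..<n. rep_measure (A k) (x k)) < \<epsilon>" by blast
  qed
qed

text \<open>A Borel subset of \<open>A\<close> that misses all \<open>K n\<close> lies in every gap
  \<open>U n - K n\<close>, and the \<open>ov\<close> of these gaps tends to zero.\<close>

lemma regular_rep_measure:
  fixes sE :: "'k::real_or_complex \<Rightarrow> 'e \<Rightarrow> 'e"
  assumes "normed_over sE" "normed_over sF" "T \<in> linops (c0_scale sE) sF"
  shows "regular_i_measure sE sF rep_measure"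
  unfolding regular_i_measure_def
proof (intro conjI ballI i_measure_rep_measure assms)
  fix A :: "'z set" assume A: "A \<in> sets borel"
  define e where "e n = inverse (real (Suc n))" for n
  have e: "0 < e n" for n by (simp add: e_def)
  have "\<exists>K U. compact K \<and> open U \<and> K \<subseteq> A \<and> A \<subseteq> U \<and> ov (U - K) \<le> e n" for n
    using reg_borel[OF A] e[of n] unfolding reg_def by blast
  then obtain K U where KU: "\<And>n. compact (K n)" "\<And>n. open (U n)" "\<And>n. K n \<subseteq> A" "\<And>n. A \<subseteq> U n"
      "\<And>n. ov (U n - K n) \<le> e n"
    by metis
  have "rep_measure B = 0" if B: "B \<in> sets borel" "B \<subseteq> A - (\<Union>n. K n)" for B
  proof (rule blinfun_eqI)
    fix x
    have "norm (rep_measure B x) \<le> norm x * e n" for n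
    proof -
      have "norm (rep_measure B x) \<le> norm x * ov (U n - K n)"
      proof (rule rep_bound[OF rep_rep_measure[OF B(1)]])
        show "open (U n - K n)" using KU by (intro open_Diff compact_imp_closed)
        show "norm (indicator B z *\<^sub>R x) \<le> norm x" for z by (simp add: indicator_def)
        show "indicator B z *\<^sub>R x = 0" if "z \<notin> U n - K n" for z
        proof -
          have "z \<notin> B" using that B(2) KU(4)[of n] by blast
          then show ?thesis by simp
        qed
      qed
      also have "\<dots> \<le> norm x * e n" using KU(5) by (intro mult_left_mono) auto
      finally show ?thesis .
    qed
    moreover have "(\<lambda>n. norm x * e n) \<longlonglongrightarrow> norm x * 0"
      unfolding e_def by (intro tendsto_intros LIMSEQ_inverse_real_of_nat)
    ultimately have "norm (rep_measure B x) \<le> 0"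
      by (intro LIMSEQ_le_const[where X = "\<lambda>n. norm x * e n"]) auto
    then show "rep_measure B x = (0 :: 'e \<Rightarrow>\<^sub>L 'f) x" by (simp add: blinfun.zero_left)
  qed
  then have "(\<forall>n. compact (K n)) \<and> (\<Union>n. K n) \<subseteq> A \<and>
      (\<forall>B\<in>sets borel. B \<subseteq> A - (\<Union>n. K n) \<longrightarrow> rep_measure B = 0)"
    using KU(1,3) by (intro conjI allI ballI impI UN_least)
  then show "\<exists>C :: nat \<Rightarrow> 'z set. (\<forall>n. compact (C n)) \<and> (\<Union>n. C n) \<subseteq> A \<and>
      (\<forall>B\<in>sets borel. B \<subseteq> A - (\<Union>n. C n) \<longrightarrow> rep_measure B = 0)"
    by (intro exI[of _ K])
qed

text \<open>A function \<open>s\<close> of finite range is represented by its own integral. Hence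
  \<open>T f\<close> minus this integral is represented by the difference of
  \<open>apply_c0 f\<close> and \<open>s\<close>, and \<open>rep_bound\<close> applies with the
  whole space as the open set.\<close>

lemma S_integral_rep_measure:
  assumes fin: "finite (range s)" and meas: "\<And>e. s -` {e} \<in> sets borel"
    and close: "\<And>z. norm (apply_c0 f z - s z) \<le> \<epsilon>"
  shows "norm (T f - S_integral borel rep_measure s) \<le> \<epsilon> * norm T"
proof -
  have empty: "rep_measure {} = 0"
  proof (rule blinfun_eqI)
    fix x
    have "norm (rep_measure {} x) \<le> norm x * ov {}"
      by (rule rep_bound[OF rep_rep_measure]) auto
    then show "rep_measure {} x = (0 :: 'e \<Rightarrow>\<^sub>L 'f) x" by (simp add: ov_empty blinfun.zero_left)
  qed
  have "S_integral borel rep_measure s = (\<Sum>\<^sub>\<infinity>e\<in>range s. rep_measure (s -` {e}) e)"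
    unfolding S_integral_def
  proof (rule infsum_cong_neutral)
    fix e assume "e \<in> UNIV - range s"
    then have "s -` {e} = {}" by auto
    then show "rep_measure (s -` {e} \<inter> space borel) e = 0" by (simp add: empty blinfun.zero_left)
  qed auto
  also have "\<dots> = (\<Sum>e\<in>range s. rep_measure (s -` {e}) e)"
    using fin by (rule infsum_finite)
  finally have int: "S_integral borel rep_measure s = (\<Sum>e\<in>range s. rep_measure (s -` {e}) e)" .
  have "rep (\<lambda>z. \<Sum>e\<in>range s. indicator (s -` {e}) z *\<^sub>R e) (S_integral borel rep_measure s)"
    unfolding int by (rule rep_sum[OF fin meas])
  moreover have "(\<Sum>e\<in>range s. indicator (s -` {e}) z *\<^sub>R e) = s z" for z
  proof -
    have "(\<Sum>e\<in>range s. indicator (s -` {e}) z *\<^sub>R e) = (\<Sum>e\<in>range s. if e = s z then s z else 0)"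
      by (intro sum.cong) (auto simp: indicator_def)
    then show ?thesis using fin by simp
  qed
  ultimately have "rep s (S_integral borel rep_measure s)" by simp
  then have "norm (T f - S_integral borel rep_measure s) \<le> \<epsilon> * ov UNIV"
    by (rule rep_bound[OF rep_diff[OF rep_c0]]) (use close in simp_all)
  also have "\<dots> \<le> \<epsilon> * norm T"
    using ov_le_norm order_trans[OF norm_ge_zero close] by (intro mult_left_mono) auto
  finally show ?thesis .
qed

end

section \<open>Countable additivity and semivariation of an i-measure\<close>

lemma summable_on_if_Cauchy:
  fixes y :: "'i \<Rightarrow> 'f::banach"
  assumes "\<And>\<epsilon>. 0 < \<epsilon> \<Longrightarrow> \<exists>F. finite F \<and> F \<subseteq> A \<and>
    (\<forall>G. finite G \<longrightarrow> G \<subseteq> A \<longrightarrow> G \<inter> F = {} \<longrightarrow> norm (sum y G) < \<epsilon>)"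
  shows "y summable_on A"
proof -
  have "\<exists>P. eventually P (finite_subsets_at_top A) \<and>
      (\<forall>F1 F2. P F1 \<and> P F2 \<longrightarrow> dist (sum y F1) (sum y F2) < \<epsilon>)" if "0 < \<epsilon>" for \<epsilon>
  proof -
    have "\<exists>F. finite F \<and> F \<subseteq> A \<and>
        (\<forall>G. finite G \<longrightarrow> G \<subseteq> A \<longrightarrow> G \<inter> F = {} \<longrightarrow> norm (sum y G) < \<epsilon> / 2)"
      by (rule assms) (use that in simp)
    then obtain F where F: "finite F" "F \<subseteq> A"
      and FG: "\<forall>G. finite G \<longrightarrow> G \<subseteq> A \<longrightarrow> G \<inter> F = {} \<longrightarrow> norm (sum y G) < \<epsilon> / 2"
      by (elim exE conjE)
    define P where "P F' \<longleftrightarrow> finite F' \<and> F \<subseteq> F' \<and> F' \<subseteq> A" for F'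
    have "eventually P (finite_subsets_at_top A)"
      unfolding eventually_finite_subsets_at_top P_def using F by (intro exI[of _ F]) auto
    moreover have "dist (sum y F1) (sum y F) < \<epsilon> / 2" if "P F1" for F1
    proof -
      have "sum y F1 - sum y F = sum y (F1 - F)"
        using that F(1) unfolding P_def by (subst sum_diff) auto
      then show ?thesis
        using FG[rule_format, of "F1 - F"] that unfolding P_def by (auto simp: dist_norm)
    qed
    ultimately show ?thesis
      by (intro exI[of _ P]) (meson dist_triangle_half_l)
  qed
  then have "cauchy_filter (filtermap (sum y) (finite_subsets_at_top A))"
    by (simp add: cauchy_filter_metric_filtermap)
  moreover have "complete (UNIV :: 'f set)"
    by (rule complete_UNIV)
  ultimately obtain L where "(sum y \<longlongrightarrow> L) (finite_subsets_at_top A)"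
    using complete_uniform[where S="UNIV :: 'f set"] by (force simp: filterlim_def)
  then show ?thesis
    using summable_on_def has_sum_def by blast
qed

text \<open>Otherwise finite blocks of norm at least \<open>\<epsilon>\<close> occur arbitrarily far
  out. Placed in consecutive intervals, they form an index set \<open>J\<close> whose subseries
  violates the Cauchy criterion.\<close>

lemma summable_on_if_subseries_summable:
  fixes y :: "nat \<Rightarrow> 'f::banach"
  assumes "\<And>J. summable (\<lambda>n. if n \<in> J then y n else 0)"
  shows "y summable_on UNIV"
proof (rule summable_on_if_Cauchy, rule ccontr)
  fix \<epsilon> :: real assume "0 < \<epsilon>"
    and contr: "\<not> (\<exists>F. finite F \<and> F \<subseteq> UNIV \<and>
      (\<forall>G. finite G \<longrightarrow> G \<subseteq> UNIV \<longrightarrow> G \<inter> F = {} \<longrightarrow> norm (sum y G) < \<epsilon>))"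
  have "\<exists>G. finite G \<and> G \<subseteq> {m..} \<and> \<epsilon> \<le> norm (sum y G)" for m
  proof -
    have "\<not> (\<forall>G. finite G \<longrightarrow> G \<subseteq> UNIV \<longrightarrow> G \<inter> {..<m} = {} \<longrightarrow> norm (sum y G) < \<epsilon>)"
      using contr by (metis finite_lessThan subset_UNIV)
    then obtain G where "finite G" "G \<inter> {..<m} = {}" "\<epsilon> \<le> norm (sum y G)"
      by (auto simp: not_less)
    moreover from this have "G \<subseteq> {m..}"
      by (auto simp: disjoint_iff not_less)
    ultimately show ?thesis by blast
  qed
  then obtain G where G: "\<And>m. finite (G m)" "\<And>m. G m \<subseteq> {m..}" "\<And>m. \<epsilon> \<le> norm (sum y (G m))"
    by metis
  \<comment> \<open>\<open>m (Suc k)\<close> lies beyond the block chosen at \<open>m k\<close>, so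
    \<open>J\<close> meets \<open>{m k..<m (Suc k)}\<close> in this block alone.\<close>
  define m where "m = rec_nat 0 (\<lambda>_ k. Suc (Max (insert k (G k))))"
  have mS: "m (Suc k) = Suc (Max (insert (m k) (G (m k))))" for k
    by (simp add: m_def)
  have fin: "finite (insert (m k) (G (m k)))" for k using G(1) by simp
  have lt: "m k < m (Suc k)" for k
    using Max_ge[OF fin[of k], of "m k"] by (simp add: mS less_Suc_eq_le)
  then have sm: "strict_mono m" by (rule strict_monoI_Suc)
  have Gm: "G (m k) \<subseteq> {m k..<m (Suc k)}" for k
  proof
    fix i assume i: "i \<in> G (m k)"
    then have "i \<le> Max (insert (m k) (G (m k)))" using fin by (intro Max_ge) auto
    moreover have "m k \<le> i" using i G(2) by auto
    ultimately show "i \<in> {m k..<m (Suc k)}" by (simp add: mS)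
  qed
  define J where "J = (\<Union>k. G (m k))"
  have J: "J \<inter> {m k..<m (Suc k)} = G (m k)" for k
  proof
    show "G (m k) \<subseteq> J \<inter> {m k..<m (Suc k)}" using Gm by (auto simp: J_def)
    show "J \<inter> {m k..<m (Suc k)} \<subseteq> G (m k)"
    proof
      fix i assume i: "i \<in> J \<inter> {m k..<m (Suc k)}"
      then obtain l where l: "i \<in> G (m l)" by (auto simp: J_def)
      then have il: "m l \<le> i" "i < m (Suc l)" using Gm[of l] by auto
      have "m l < m (Suc k)" "m k < m (Suc l)" using i il by auto
      then have "l < Suc k" "k < Suc l" using sm strict_mono_less by blast+
      then have "l = k" by simp
      then show "i \<in> G (m k)" using l by simp
    qed
  qed
  obtain N where N: "\<And>p q. N \<le> p \<Longrightarrow> norm (\<Sum>n\<in>{p..<q}. if n \<in> J then y n else 0) < \<epsilon>"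
    using assms[of J] \<open>0 < \<epsilon>\<close> unfolding summable_Cauchy by metis
  have "(\<Sum>n\<in>{m N..<m (Suc N)}. if n \<in> J then y n else 0) = sum y ({m N..<m (Suc N)} \<inter> J)"
    by (simp add: sum.inter_restrict)
  also have "\<dots> = sum y (G (m N))"
    using J[of N] by (simp add: Int_commute)
  finally have "norm (sum y (G (m N))) < \<epsilon>"
    using N[of "m N" "m (Suc N)"] strict_mono_imp_increasing[OF sm, of N] by simp
  then show False using G(3)[of "m N"] by simp
qed

locale vector_i_measure =
  fixes sE :: "'k::real_or_complex \<Rightarrow> 'e::banach \<Rightarrow> 'e" and sF :: "'k \<Rightarrow> 'f::banach \<Rightarrow> 'f"
    and M :: "'z measure" and \<mu> :: "'z set \<Rightarrow> 'e \<Rightarrow>\<^sub>L 'f"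
  assumes sE: "normed_over sE" and sF: "normed_over sF" and i_measure: "i_measure sE sF M \<mu>"
begin

section \<open>Unordered summation over countable disjoint families\<close>

lemma sums_UN:
  fixes A :: "nat \<Rightarrow> 'z set"
  assumes "range A \<subseteq> sets M" "disjoint_family A"
  shows "(\<lambda>n. \<mu> (A n) x) sums \<mu> (\<Union>n. A n) x"
  using i_measure assms unfolding i_measure_def by blast

lemma empty [simp]: "\<mu> {} = 0"
proof (rule blinfun_eqI)
  fix x
  have "(\<lambda>n::nat. \<mu> {} x) sums \<mu> (\<Union>n::nat. {}) x"
    using sums_UN[of "\<lambda>_. {}"] by (simp add: disjoint_family_on_def)
  then have "summable (\<lambda>n::nat. \<mu> {} x)" by (rule sums_summable)
  then show "\<mu> {} x = (0 :: 'e \<Rightarrow>\<^sub>L 'f) x"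
    by (simp add: summable_const_iff blinfun.zero_left)
qed

text \<open>Independent convergence permits replacing any of the vectors by zero, so every subseries
  converges; this makes the convergence unconditional.\<close>

lemma summable_on_nat:
  fixes A :: "nat \<Rightarrow> 'z set" and x :: "nat \<Rightarrow> 'e"
  assumes "range A \<subseteq> sets M" "disjoint_family A" "\<And>n. norm (x n) \<le> C"
  shows "(\<lambda>n. \<mu> (A n) (x n)) summable_on UNIV"
proof (rule summable_on_if_subseries_summable)
  fix J
  define x' where "x' n = (if n \<in> J then x n else 0)" for n
  have "norm (x' n) \<le> max 0 C" for n
    using assms(3)[of n] by (simp add: x'_def le_max_iff_disj)
  then have "bounded (range x')"
    by (auto simp: bounded_iff)
  then have "summable (\<lambda>n. \<mu> (A n) (x' n))"
    using i_measure assms(1,2) unfolding i_measure_def independently_convergent_def by blast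
  moreover have "(\<lambda>n. \<mu> (A n) (x' n)) = (\<lambda>n. if n \<in> J then \<mu> (A n) (x n) else 0)"
    by (auto simp: x'_def blinfun.zero_right)
  ultimately show "summable (\<lambda>n. if n \<in> J then \<mu> (A n) (x n) else 0)" by simp
qed

text \<open>Passage from a countable index set to sequences. Numbers outside the image of
  \<open>I\<close> get the empty set, whose measure is zero.\<close>

lemma countable_index:
  assumes "countable I" "\<forall>i\<in>I. A i \<in> sets M" "disjoint_family_on A I"
  shows "\<exists>A' :: nat \<Rightarrow> 'z set. range A' \<subseteq> sets M \<and> disjoint_family A' \<and>
    (\<forall>i\<in>I. A' (to_nat_on I i) = A i) \<and> (\<forall>n. n \<notin> to_nat_on I ` I \<longrightarrow> A' n = {}) \<and>
    (\<Union>n. A' n) = (\<Union>i\<in>I. A i)"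
proof -
  define A' where "A' n = (if n \<in> to_nat_on I ` I then A (from_nat_into I n) else {})" for n
  have A'I: "A' (to_nat_on I i) = A i" if "i \<in> I" for i
    using that assms(1) by (simp add: A'_def)
  have A'0: "A' n = {}" if "n \<notin> to_nat_on I ` I" for n using that by (simp add: A'_def)
  show ?thesis
  proof (intro exI[of _ A'] conjI ballI allI impI A'I A'0)
    show "range A' \<subseteq> sets M"
    proof
      fix B assume "B \<in> range A'"
      then obtain n where n: "B = A' n" by blast
      show "B \<in> sets M"
        by (cases "n \<in> to_nat_on I ` I") (use n A'I A'0 assms(2) in auto)
    qed
    show "disjoint_family A'"
      unfolding disjoint_family_on_def
    proof (intro ballI impI)
      fix m n :: nat assume "m \<noteq> n"
      show "A' m \<inter> A' n = {}"
      proof (cases "m \<in> to_nat_on I ` I \<and> n \<in> to_nat_on I ` I")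
        case True
        then obtain i j where ij: "i \<in> I" "j \<in> I" "m = to_nat_on I i" "n = to_nat_on I j" by blast
        then have "i \<noteq> j" using \<open>m \<noteq> n\<close> by auto
        then show ?thesis
          using assms(3) ij A'I unfolding disjoint_family_on_def by metis
      next
        case False
        then show ?thesis using A'0 by auto
      qed
    qed
    show "(\<Union>n. A' n) = (\<Union>i\<in>I. A i)"
    proof (intro equalityI subsetI)
      fix z assume "z \<in> (\<Union>n. A' n)"
      then obtain n where n: "z \<in> A' n" by blast
      then have "n \<in> to_nat_on I ` I" using A'0 by auto
      then show "z \<in> (\<Union>i\<in>I. A i)" using n A'I by auto
    next
      fix z assume "z \<in> (\<Union>i\<in>I. A i)"
      then obtain i where "i \<in> I" "z \<in> A i" by blast
      then show "z \<in> (\<Union>n. A' n)" using A'I by blast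
    qed
  qed
qed

lemma summable_on_disjoint:
  assumes "countable I" "\<And>i. i \<in> I \<Longrightarrow> A i \<in> sets M" "disjoint_family_on A I"
    and "\<And>i. i \<in> I \<Longrightarrow> norm (x i) \<le> C"
  shows "(\<lambda>i. \<mu> (A i) (x i)) summable_on I"
proof -
  have AM: "\<forall>i\<in>I. A i \<in> sets M" using assms(2) by blast
  obtain A' :: "nat \<Rightarrow> 'z set" where A': "range A' \<subseteq> sets M" "disjoint_family A'"
    "\<forall>i\<in>I. A' (to_nat_on I i) = A i"
    using countable_index[OF assms(1) AM assms(3)] by (elim exE conjE)
  define x' where "x' n = (if n \<in> to_nat_on I ` I then x (from_nat_into I n) else 0)" for n
  have x': "x' (to_nat_on I i) = x i" if "i \<in> I" for i
    using that assms(1) by (simp add: x'_def)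
  have "norm (x' n) \<le> max 0 C" for n
  proof (cases "n \<in> to_nat_on I ` I")
    case True
    then show ?thesis using x' assms(4) by (auto intro: max.coboundedI2)
  qed (simp add: x'_def)
  then have "(\<lambda>n. \<mu> (A' n) (x' n)) summable_on UNIV"
    by (rule summable_on_nat[OF A'(1,2)])
  then have "(\<lambda>n. \<mu> (A' n) (x' n)) summable_on (to_nat_on I ` I)"
    by (rule summable_on_subset_banach) simp
  then have "((\<lambda>n. \<mu> (A' n) (x' n)) \<circ> to_nat_on I) summable_on I"
    using summable_on_reindex[OF inj_on_to_nat_on[OF assms(1)]] by blast
  then show ?thesis
    by (rule summable_on_cong[THEN iffD1, rotated]) (simp add: A'(3) x')
qed

lemma has_sum_UN:
  assumes "countable I" "\<And>i. i \<in> I \<Longrightarrow> A i \<in> sets M" "disjoint_family_on A I"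
  shows "((\<lambda>i. \<mu> (A i) x) has_sum \<mu> (\<Union>i\<in>I. A i) x) I"
proof -
  have AM: "\<forall>i\<in>I. A i \<in> sets M" using assms(2) by blast
  obtain A' :: "nat \<Rightarrow> 'z set" where A': "range A' \<subseteq> sets M" "disjoint_family A'"
    "\<forall>i\<in>I. A' (to_nat_on I i) = A i" "\<forall>n. n \<notin> to_nat_on I ` I \<longrightarrow> A' n = {}"
    "(\<Union>n. A' n) = (\<Union>i\<in>I. A i)"
    using countable_index[OF assms(1) AM assms(3)] by (elim exE conjE)
  have "(\<lambda>n. \<mu> (A' n) x) summable_on UNIV"
    by (rule summable_on_nat[OF A'(1,2) order_refl])
  then have 1: "((\<lambda>n. \<mu> (A' n) x) has_sum infsum (\<lambda>n. \<mu> (A' n) x) UNIV) UNIV"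
    by simp
  then have "infsum (\<lambda>n. \<mu> (A' n) x) UNIV = \<mu> (\<Union>i\<in>I. A i) x"
    using sums_unique2[OF has_sum_imp_sums sums_UN[OF A'(1,2)]] A'(5) by simp
  then have "((\<lambda>n. \<mu> (A' n) x) has_sum \<mu> (\<Union>i\<in>I. A i) x) UNIV" using 1 by simp
  then have "((\<lambda>n. \<mu> (A' n) x) has_sum \<mu> (\<Union>i\<in>I. A i) x) (to_nat_on I ` I)"
    by (rule has_sum_cong_neutral[THEN iffD1, rotated 3]) (auto simp: A'(4) blinfun.zero_left)
  then have "((\<lambda>n. \<mu> (A' n) x) \<circ> to_nat_on I has_sum \<mu> (\<Union>i\<in>I. A i) x) I"
    using has_sum_reindex[OF inj_on_to_nat_on[OF assms(1)]] by blast
  then show ?thesis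
    by (rule has_sum_cong[THEN iffD1, rotated]) (simp add: A'(3))
qed

lemma finite_UN:
  assumes "finite I" "\<And>i. i \<in> I \<Longrightarrow> A i \<in> sets M" "disjoint_family_on A I"
  shows "\<mu> (\<Union>i\<in>I. A i) x = (\<Sum>i\<in>I. \<mu> (A i) x)"
  using has_sum_UN[OF countable_finite[OF assms(1)] assms(2,3)] assms(1)
  by (simp add: has_sum_finite_iff)

lemma add_disjoint:
  assumes "A \<in> sets M" "B \<in> sets M" "A \<inter> B = {}"
  shows "\<mu> (A \<union> B) x = \<mu> A x + \<mu> B x"
proof -
  have "disjoint_family_on (\<lambda>b. if b then A else B) UNIV"
    using assms(3) by (auto simp: disjoint_family_on_def)
  then have "\<mu> (\<Union>b\<in>UNIV. if b then A else B) x = (\<Sum>b\<in>UNIV. \<mu> (if b then A else B) x)"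
    using assms by (intro finite_UN) auto
  then show ?thesis
    by (simp add: UNIV_bool Un_commute add.commute)
qed

lemma diff_subset:
  assumes "A \<in> sets M" "B \<in> sets M" "B \<subseteq> A"
  shows "\<mu> (A - B) x = \<mu> A x - \<mu> B x"
proof -
  have "(A - B) \<inter> B = {}" "(A - B) \<union> B = A" using assms(3) by blast+
  then show ?thesis using add_disjoint[of "A - B" B x] assms(1,2) by simp
qed

lemma minus_decreasing_tendsto:
  fixes B :: "nat \<Rightarrow> 'z set"
  assumes C: "C \<in> sets M" and B: "\<And>n. B n \<in> sets M" "decseq B" "(\<Inter>n. B n) = {}"
  shows "(\<lambda>n. \<mu> (C - B n) x) \<longlonglongrightarrow> \<mu> C x"
proof -
  define D where "D k = C \<inter> (B k - B (Suc k))" for k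
  have D: "D k \<in> sets M" for k unfolding D_def using C B(1) by blast
  have dis: "D k \<inter> D l = {}" if "k < l" for k l
    using decseqD[OF B(2), of "Suc k" l] that by (auto simp: D_def)
  then have disj: "disjoint_family D"
    unfolding disjoint_family_on_def by (metis Int_commute nat_neq_iff)
  have part: "(\<Union>k<n. D k) = (C \<inter> B 0) - B n" for n
  proof (induction n)
    case (Suc n)
    have "B (Suc n) \<subseteq> B n" "B n \<subseteq> B 0" using decseqD[OF B(2)] by auto
    then show ?case using Suc by (auto simp: lessThan_Suc D_def)
  qed simp
  have "C \<inter> B 0 \<subseteq> (\<Union>k. D k)"
  proof
    fix z assume z: "z \<in> C \<inter> B 0"
    obtain n where "z \<notin> B n" using B(3) by blast
    then have "z \<in> (\<Union>k<n. D k)" using z part by auto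
    then show "z \<in> (\<Union>k. D k)" by auto
  qed
  moreover have "(\<Union>k. D k) \<subseteq> C \<inter> B 0" using decseqD[OF B(2)] by (auto simp: D_def)
  ultimately have U: "(\<Union>k. D k) = C \<inter> B 0" by (rule equalityI[rotated])
  have "(\<lambda>n. \<Sum>k<n. \<mu> (D k) x) \<longlonglongrightarrow> \<mu> (C \<inter> B 0) x"
    using sums_UN[OF _ disj, of x] D U unfolding sums_def by (simp add: image_subset_iff)
  moreover have "(\<Sum>k<n. \<mu> (D k) x) = \<mu> ((C \<inter> B 0) - B n) x" for n
    using finite_UN[of "{..<n}" D x] D disj part by (simp add: disjoint_family_on_def)
  ultimately have lim: "(\<lambda>n. \<mu> ((C \<inter> B 0) - B n) x) \<longlonglongrightarrow> \<mu> (C \<inter> B 0) x" by simp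
  have "(\<lambda>n. \<mu> ((C \<inter> B 0) - B n) x + \<mu> (C - B 0) x) \<longlonglongrightarrow> \<mu> (C \<inter> B 0) x + \<mu> (C - B 0) x"
    by (rule tendsto_add[OF lim tendsto_const])
  moreover have "\<mu> ((C \<inter> B 0) - B n) x + \<mu> (C - B 0) x = \<mu> (C - B n) x" for n
  proof -
    have "\<mu> ((C \<inter> B 0 - B n) \<union> (C - B 0)) x = \<mu> ((C \<inter> B 0) - B n) x + \<mu> (C - B 0) x"
      using C B(1) by (intro add_disjoint) auto
    moreover have "(C \<inter> B 0 - B n) \<union> (C - B 0) = C - B n"
      using decseqD[OF B(2), of 0 n] by auto
    ultimately show ?thesis by simp
  qed
  moreover have "\<mu> (C \<inter> B 0) x + \<mu> (C - B 0) x = \<mu> C x"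
    using diff_subset[of C "C \<inter> B 0" x] C B(1) by (simp add: Diff_Int_distrib2 Diff_Int)
  ultimately show ?thesis by simp
qed

text \<open>The sums in \<open>semivariation\<close>, localized to subsets of \<open>A\<close> and
  kept real; the supremum is formed only after boundedness is proved.\<close>

definition sv_set :: "'z set \<Rightarrow> real set"
  where "sv_set A = {norm (\<Sum>n<N. \<mu> (B n) (x n)) | (N::nat) B x.
    (\<forall>n<N. B n \<in> sets M \<and> B n \<subseteq> A \<and> norm (x n) \<le> 1) \<and> disjoint_family_on B {..<N}}"

lemma sv_setI:
  fixes B :: "nat \<Rightarrow> 'z set" and x :: "nat \<Rightarrow> 'e"
  assumes "\<And>n. n < N \<Longrightarrow> B n \<in> sets M" "\<And>n. n < N \<Longrightarrow> B n \<subseteq> A" "\<And>n. n < N \<Longrightarrow> norm (x n) \<le> 1"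
    "disjoint_family_on B {..<N}"
  shows "norm (\<Sum>n<N. \<mu> (B n) (x n)) \<in> sv_set A"
  unfolding sv_set_def using assms by blast

lemma sv_setD:
  assumes "c \<in> sv_set A"
  shows "\<exists>(N::nat) B x. c = norm (\<Sum>n<N. \<mu> (B n) (x n)) \<and> (\<forall>n<N. B n \<in> sets M) \<and>
    (\<forall>n<N. B n \<subseteq> A) \<and> (\<forall>n<N. norm (x n) \<le> 1) \<and> disjoint_family_on B {..<N}"
  using assms unfolding sv_set_def mem_Collect_eq
  by (elim exE conjE, intro exI conjI allI impI) (assumption | simp)+

lemma sv_set_sum:
  assumes fin: "finite I" and "\<And>i. i \<in> I \<Longrightarrow> B i \<in> sets M" "\<And>i. i \<in> I \<Longrightarrow> B i \<subseteq> A"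
    "\<And>i. i \<in> I \<Longrightarrow> norm (x i) \<le> 1" "disjoint_family_on B I"
  shows "norm (\<Sum>i\<in>I. \<mu> (B i) (x i)) \<in> sv_set A"
proof -
  obtain h where h: "bij_betw h {..<card I} I"
    using ex_bij_betw_nat_finite[OF fin] by (auto simp: atLeast0LessThan)
  then have hI: "h n \<in> I" if "n < card I" for n
    using that by (auto simp: bij_betw_def)
  have "(\<Sum>i\<in>I. \<mu> (B i) (x i)) = (\<Sum>n<card I. \<mu> (B (h n)) (x (h n)))"
    using sum.reindex_bij_betw[OF h, of "\<lambda>i. \<mu> (B i) (x i)"] by simp
  moreover have "norm (\<Sum>n<card I. \<mu> (B (h n)) (x (h n))) \<in> sv_set A"
  proof (rule sv_setI)
    show "disjoint_family_on (\<lambda>n. B (h n)) {..<card I}"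
      using assms(5) h hI unfolding disjoint_family_on_def bij_betw_def inj_on_def by (metis lessThan_iff)
  qed (use assms hI in auto)
  ultimately show ?thesis by simp
qed

lemma sv_set_single: "B \<in> sets M \<Longrightarrow> B \<subseteq> A \<Longrightarrow> norm x \<le> 1 \<Longrightarrow> norm (\<mu> B x) \<in> sv_set A"
  using sv_set_sum[of "{()}" "\<lambda>_. B" A "\<lambda>_. x"] by (simp add: disjoint_family_on_def)

lemma sv_set_mono: "A \<subseteq> A' \<Longrightarrow> sv_set A \<subseteq> sv_set A'"
  unfolding sv_set_def by blast

text \<open>The sums behind all the \<open>c n\<close> together involve one countable disjoint
  family with vectors of norm at most one, which is unordered summable; grouping by \<open>n\<close>
  gives a convergent series with terms of norm \<open>c n\<close>. Finiteness and continuity of the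
  semivariation are both obtained by contradicting this.\<close>

lemma sv_set_disjoint_null:
  fixes D :: "nat \<Rightarrow> 'z set"
  assumes D: "disjoint_family D" and c: "\<And>n. c n \<in> sv_set (D n)"
  shows "c \<longlonglongrightarrow> 0"
proof -
  define Q where "Q n N B x \<longleftrightarrow> c n = norm (\<Sum>i<N. \<mu> (B i) (x i)) \<and> (\<forall>i<N. B i \<in> sets M) \<and>
      (\<forall>i<N. B i \<subseteq> D n) \<and> (\<forall>i<N. norm (x i) \<le> 1) \<and> disjoint_family_on B {..<N}"
    for n and N :: nat and B x
  have "\<forall>n. \<exists>N B x. Q n N B x"
    unfolding Q_def by (intro allI sv_setD c)
  then obtain N B x where Q: "\<And>n. Q n (N n) (B n) (x n)" by metis
  note NBx = Q[unfolded Q_def, THEN conjunct1] Q[unfolded Q_def, THEN conjunct2, THEN conjunct1]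
    Q[unfolded Q_def, THEN conjunct2, THEN conjunct2, THEN conjunct1]
    Q[unfolded Q_def, THEN conjunct2, THEN conjunct2, THEN conjunct2, THEN conjunct1]
    Q[unfolded Q_def, THEN conjunct2, THEN conjunct2, THEN conjunct2, THEN conjunct2]
  define I where "I = (SIGMA n:UNIV. {..<N n})"
  have I: "snd p < N (fst p)" if "p \<in> I" for p using that by (auto simp: I_def)
  have "(\<lambda>p. \<mu> (B (fst p) (snd p)) (x (fst p) (snd p))) summable_on I"
  proof (rule summable_on_disjoint)
    show "disjoint_family_on (\<lambda>p. B (fst p) (snd p)) I"
      unfolding disjoint_family_on_def
    proof (intro ballI impI)
      fix p q assume pq: "p \<in> I" "q \<in> I" "p \<noteq> q"
      show "B (fst p) (snd p) \<inter> B (fst q) (snd q) = {}"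
      proof (cases "fst p = fst q")
        case True
        then have "snd p \<noteq> snd q" using pq(3) by (simp add: prod_eq_iff)
        moreover have "snd p \<in> {..<N (fst p)}" "snd q \<in> {..<N (fst p)}"
          using pq(1,2) True by (auto simp: I_def)
        ultimately have "B (fst p) (snd p) \<inter> B (fst p) (snd q) = {}"
          using NBx(5)[of "fst p"] unfolding disjoint_family_on_def by blast
        then show ?thesis using True by simp
      next
        case False
        then have "D (fst p) \<inter> D (fst q) = {}"
          using D by (simp add: disjoint_family_on_def)
        moreover have "B (fst p) (snd p) \<subseteq> D (fst p)" "B (fst q) (snd q) \<subseteq> D (fst q)"
          using NBx(3) I[OF pq(1)] I[OF pq(2)] by blast+
        ultimately show ?thesis by blast
      qed
    qed
    show "norm (x (fst p) (snd p)) \<le> 1" if "p \<in> I" for p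
      using NBx(4) I[OF that] by blast
    show "B (fst p) (snd p) \<in> sets M" if "p \<in> I" for p
      using NBx(2) I[OF that] by blast
  qed (simp add: I_def)
  then obtain a where "((\<lambda>p. \<mu> (B (fst p) (snd p)) (x (fst p) (snd p))) has_sum a) I"
    by (auto simp: summable_on_def)
  then have "((\<lambda>n. \<Sum>i<N n. \<mu> (B n i) (x n i)) has_sum a) UNIV"
    unfolding I_def by (rule has_sum_SigmaD) simp
  then have "summable (\<lambda>n. \<Sum>i<N n. \<mu> (B n i) (x n i))"
    by (meson has_sum_imp_sums sums_summable)
  then have "(\<lambda>n. \<Sum>i<N n. \<mu> (B n i) (x n i)) \<longlonglongrightarrow> 0"
    by (rule summable_LIMSEQ_zero)
  then show ?thesis
    unfolding NBx(1) by (rule tendsto_norm_zero)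
qed

section \<open>Finiteness of the semivariation\<close>

lemma sv_set_Un_bounded:
  assumes "P \<in> sets M" "Q \<in> sets M" "P \<inter> Q = {}"
    and "\<And>c. c \<in> sv_set P \<Longrightarrow> c \<le> p" "\<And>c. c \<in> sv_set Q \<Longrightarrow> c \<le> q" and c: "c \<in> sv_set (P \<union> Q)"
  shows "c \<le> p + q"
proof -
  obtain N :: nat and B x where B': "c = norm (\<Sum>n<N. \<mu> (B n) (x n))"
    "\<forall>n<N. B n \<in> sets M" "\<forall>n<N. B n \<subseteq> P \<union> Q" "\<forall>n<N. norm (x n) \<le> 1"
    "disjoint_family_on B {..<N}"
    using sv_setD[OF c] by (elim exE conjE)
  note B = B'(1) B'(2-4)[rule_format] B'(5)
  have "\<mu> (B n) (x n) = \<mu> (B n \<inter> P) (x n) + \<mu> (B n \<inter> Q) (x n)" if "n < N" for n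
  proof -
    have "B n = (B n \<inter> P) \<union> (B n \<inter> Q)" using B(3)[OF that] by blast
    then show ?thesis
      using add_disjoint[of "B n \<inter> P" "B n \<inter> Q" "x n"] B(2)[OF that] assms(1-3) by auto
  qed
  then have "c = norm ((\<Sum>n<N. \<mu> (B n \<inter> P) (x n)) + (\<Sum>n<N. \<mu> (B n \<inter> Q) (x n)))"
    unfolding B(1) sum.distrib[symmetric] by (metis (no_types, lifting) lessThan_iff sum.cong)
  also have "\<dots> \<le> norm (\<Sum>n<N. \<mu> (B n \<inter> P) (x n)) + norm (\<Sum>n<N. \<mu> (B n \<inter> Q) (x n))"
    by (rule norm_triangle_ineq)
  also have "\<dots> \<le> p + q"
  proof (intro add_mono assms(4,5) sv_setI)
    show "disjoint_family_on (\<lambda>n. B n \<inter> P) {..<N}" "disjoint_family_on (\<lambda>n. B n \<inter> Q) {..<N}"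
      using B(5) by (auto simp: disjoint_family_on_def)
  qed (use B(2,4) assms(1,2) in auto)
  finally show ?thesis .
qed

definition unb :: "'z set \<Rightarrow> bool"
  where "unb A \<longleftrightarrow> A \<in> sets M \<and> \<not> bdd_above (sv_set A)"

lemma unb_split:
  assumes "unb A" "P \<in> sets M" "P \<subseteq> A"
  shows "unb P \<or> unb (A - P)"
proof (rule ccontr)
  assume "\<not> ?thesis"
  then obtain p q where "\<And>c. c \<in> sv_set P \<Longrightarrow> c \<le> p" "\<And>c. c \<in> sv_set (A - P) \<Longrightarrow> c \<le> q"
    using assms unfolding unb_def bdd_above_def by (metis sets.Diff)
  then have "c \<le> p + q" if "c \<in> sv_set (P \<union> (A - P))" for c
    using sv_set_Un_bounded[of P "A - P" p q c] assms that by (auto simp: unb_def)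
  moreover have "P \<union> (A - P) = A" using assms(3) by blast
  ultimately have "bdd_above (sv_set A)" by (metis bdd_above.I)
  then show False using assms(1) by (simp add: unb_def)
qed

lemma unb_finite_split:
  fixes N :: nat
  assumes "unb A" "\<And>n. n < N \<Longrightarrow> B n \<in> sets M" "\<And>n. n < N \<Longrightarrow> B n \<subseteq> A"
    "disjoint_family_on B {..<N}"
  shows "(\<exists>n<N. unb (B n)) \<or> unb (A - (\<Union>n<N. B n))"
  using assms(2-4)
proof (induction N)
  case 0
  then show ?case using assms(1) by simp
next
  case (Suc N)
  then have "(\<exists>n<N. unb (B n)) \<or> unb (A - (\<Union>n<N. B n))"
    by (auto simp: disjoint_family_on_def)
  then show ?case
  proof
    assume "\<exists>n<N. unb (B n)"
    then show ?thesis by (meson less_Suc_eq)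
  next
    assume unb: "unb (A - (\<Union>n<N. B n))"
    have "B N \<inter> B n = {}" if "n < N" for n
      using disjoint_family_onD[OF Suc.prems(3), of N n] that by simp
    moreover have "B N \<subseteq> A" by (rule Suc.prems(2)) simp
    ultimately have "B N \<subseteq> A - (\<Union>n<N. B n)" by blast
    then have "unb (B N) \<or> unb ((A - (\<Union>n<N. B n)) - B N)"
      using unb Suc.prems(1) by (intro unb_split) auto
    moreover have "(A - (\<Union>n<N. B n)) - B N = A - (\<Union>n<Suc N. B n)"
      by (auto simp: less_Suc_eq)
    ultimately show ?thesis by (metis lessI)
  qed
qed

text \<open>By \<open>unb_finite_split\<close>, unboundedness survives on one of the
  \<open>B n\<close> or on the rest of \<open>A\<close>. If on the rest, the whole sum lives on the
  complement of the rest. If on \<open>B n\<close>, the part \<open>A - B n\<close> carries the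
  other terms of the sum and also \<open>\<mu> (A - B n) (x n)\<close>, whose norm is at least that
  of \<open>\<mu> (B n) (x n)\<close> up to \<open>norm (\<mu> A)\<close>; one of the two must be
  large.\<close>

lemma unb_reduce:
  assumes "unb A"
  shows "\<exists>A'. unb A' \<and> A' \<subseteq> A \<and> (\<exists>c\<in>sv_set (A - A'). 1 \<le> c)"
proof -
  \<comment> \<open>The threshold leaves, after \<open>norm (\<mu> A)\<close> is deducted, more than
    \<open>2\<close> to be shared by two quantities, so that one of them reaches
    \<open>1\<close>.\<close>
  obtain c where c: "c \<in> sv_set A" "2 + norm (\<mu> A) < c"
    using assms unfolding unb_def bdd_above_def by (meson not_le)
  obtain N :: nat and B x where B': "c = norm (\<Sum>n<N. \<mu> (B n) (x n))"
    "\<forall>n<N. B n \<in> sets M" "\<forall>n<N. B n \<subseteq> A" "\<forall>n<N. norm (x n) \<le> 1"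
    "disjoint_family_on B {..<N}"
    using sv_setD[OF c(1)] by (elim exE conjE)
  note B = B'(1) B'(2-4)[rule_format] B'(5)
  have A: "A \<in> sets M" using assms by (simp add: unb_def)
  consider (rest) "unb (A - (\<Union>n<N. B n))" | (part) n where "n < N" "unb (B n)"
    using unb_finite_split[OF assms B(2,3,5)] by blast
  then show ?thesis
  proof cases
    case rest
    have "c \<in> sv_set (A - (A - (\<Union>n<N. B n)))"
      unfolding B(1) by (rule sv_setI) (use B in auto)
    moreover have "1 \<le> c" using c(2) norm_ge_zero[of "\<mu> A"] by linarith
    ultimately show ?thesis using rest by (intro exI[of _ "A - (\<Union>n<N. B n)"]) blast
  next
    case part
    define c' where "c' = norm (\<Sum>m\<in>{..<N} - {n}. \<mu> (B m) (x m))"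
    have c': "c' \<in> sv_set (A - B n)"
      unfolding c'_def
    proof (rule sv_set_sum)
      show "B m \<subseteq> A - B n" if "m \<in> {..<N} - {n}" for m
        using that B(3)[of m] disjoint_family_onD[OF B(5), of m n] part(1) by auto
      show "disjoint_family_on B ({..<N} - {n})"
        using B(5) by (auto simp: disjoint_family_on_def)
    qed (use B in auto)
    have "(\<Sum>m<N. \<mu> (B m) (x m)) = \<mu> (B n) (x n) + (\<Sum>m\<in>{..<N} - {n}. \<mu> (B m) (x m))"
      using part(1) by (simp add: sum.remove)
    then have le: "c \<le> norm (\<mu> (B n) (x n)) + c'"
      unfolding B(1) c'_def by (simp add: norm_triangle_ineq)
    have "norm (\<mu> A (x n)) \<le> norm (\<mu> A)"
      using norm_blinfun[of "\<mu> A" "x n"] B(4)[OF part(1)] mult_left_le[of "norm (x n)" "norm (\<mu> A)"]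
      by simp
    moreover have "norm (\<mu> (B n) (x n)) \<le> norm (\<mu> (A - B n) (x n)) + norm (\<mu> A (x n))"
      using diff_subset[OF A B(2,3)[OF part(1)], of "x n"] norm_triangle_ineq4[of "\<mu> A (x n)" "\<mu> A (x n) - \<mu> (B n) (x n)"]
      by simp
    ultimately have "1 \<le> c' \<or> 1 \<le> norm (\<mu> (A - B n) (x n))"
      using le c(2) by linarith
    moreover have "norm (\<mu> (A - B n) (x n)) \<in> sv_set (A - B n)"
      using A B(2,4)[OF part(1)] by (intro sv_set_single) auto
    ultimately show ?thesis
      using part c' B(3)[OF part(1)] by (intro exI[of _ "B n"]) blast
  qed
qed

text \<open>Iterating \<open>unb_reduce\<close> gives disjoint differences \<open>D n\<close>, each
  with a sum of norm at least one, contrary to \<open>sv_set_disjoint_null\<close>.\<close>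

lemma bdd_above_sv_set: "bdd_above (sv_set A)"
proof (rule ccontr)
  assume nb: "\<not> bdd_above (sv_set A)"
  have sub: "sv_set A \<subseteq> sv_set (space M)"
    unfolding sv_set_def using sets.sets_into_space by blast
  then have unb0: "unb (space M)"
    using nb bdd_above_mono[OF _ sub] by (auto simp: unb_def)
  obtain R where R: "\<And>A. unb A \<Longrightarrow> unb (R A) \<and> R A \<subseteq> A \<and> (\<exists>c\<in>sv_set (A - R A). 1 \<le> c)"
    using unb_reduce by metis
  define a where "a n = (R ^^ n) (space M)" for n
  have aS: "a (Suc n) = R (a n)" for n by (simp add: a_def)
  have unb: "unb (a n)" for n
    by (induction n) (use unb0 R aS in \<open>auto simp: a_def\<close>)
  have dec: "decseq a"
    using R[OF unb] aS by (intro decseq_SucI) auto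
  define D where "D n = a n - a (Suc n)" for n
  have dis: "D k \<inter> D l = {}" if "k < l" for k l
    using decseqD[OF dec, of "Suc k" l] that by (auto simp: D_def)
  then have disj: "disjoint_family D"
    unfolding disjoint_family_on_def by (metis Int_commute nat_neq_iff)
  have "\<exists>c. c \<in> sv_set (D n) \<and> 1 \<le> c" for n
    using R[OF unb[of n]] by (auto simp: D_def aS)
  then obtain c where c: "\<And>n. c n \<in> sv_set (D n)" "\<And>n. 1 \<le> c n" by metis
  have "c \<longlonglongrightarrow> 0" by (rule sv_set_disjoint_null[OF disj c(1)])
  then have "(1::real) \<le> 0" by (rule LIMSEQ_le_const) (use c(2) in auto)
  then show False by simp
qed

section \<open>The semivariation as a set function\<close>

definition sv :: "'z set \<Rightarrow> real"
  where "sv A = Sup (sv_set A)"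

lemma sv_upper: "c \<in> sv_set A \<Longrightarrow> c \<le> sv A"
  unfolding sv_def by (rule cSup_upper[OF _ bdd_above_sv_set])

lemma zero_in_sv_set: "0 \<in> sv_set A"
  using sv_set_single[of "{}" A 0] by (simp add: blinfun.zero_right)

lemma sv_least: "(\<And>c. c \<in> sv_set A \<Longrightarrow> c \<le> b) \<Longrightarrow> sv A \<le> b"
  unfolding sv_def using zero_in_sv_set by (intro cSup_least) auto

lemma sv_nonneg: "0 \<le> sv A"
  by (rule sv_upper[OF zero_in_sv_set])

lemma sv_mono: "A \<subseteq> B \<Longrightarrow> sv A \<le> sv B"
  by (intro sv_least sv_upper) (use sv_set_mono in auto)

lemma sv_Un:
  assumes "A \<in> sets M" "B \<in> sets M"
  shows "sv (A \<union> B) \<le> sv A + sv B"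
proof (rule sv_least)
  fix c assume "c \<in> sv_set (A \<union> B)"
  then have "c \<in> sv_set (A \<union> (B - A))" by simp
  then have "c \<le> sv A + sv (B - A)"
    using assms by (intro sv_set_Un_bounded[of A "B - A"]) (auto intro: sv_upper)
  also have "\<dots> \<le> sv A + sv B"
    using sv_mono[of "B - A" B] by auto
  finally show "c \<le> sv A + sv B" .
qed

lemma sum_le_sv:
  assumes "finite I" "\<And>i. i \<in> I \<Longrightarrow> B i \<in> sets M" "\<And>i. i \<in> I \<Longrightarrow> B i \<subseteq> A"
    "\<And>i. i \<in> I \<Longrightarrow> norm (x i) \<le> C" "disjoint_family_on B I" "0 \<le> C"
  shows "norm (\<Sum>i\<in>I. \<mu> (B i) (x i)) \<le> C * sv A"
proof (cases "C = 0")
  case True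
  then have "\<mu> (B i) (x i) = 0" if "i \<in> I" for i
    using assms(4)[OF that] by (simp add: blinfun.zero_right)
  then show ?thesis using True by simp
next
  case False
  then have C: "0 < C" using assms(6) by simp
  have "norm (\<Sum>i\<in>I. \<mu> (B i) (x i /\<^sub>R C)) \<le> sv A"
    using assms C by (intro sv_upper sv_set_sum) (auto simp: field_simps)
  also have "(\<Sum>i\<in>I. \<mu> (B i) (x i /\<^sub>R C)) = (\<Sum>i\<in>I. \<mu> (B i) (x i)) /\<^sub>R C"
    by (simp add: blinfun.scaleR_right scaleR_sum_right)
  finally show ?thesis
    using C by (simp add: field_simps)
qed

lemma semivariation_eq: "semivariation M \<mu> = ennreal (sv (space M))"
proof (rule antisym)
  have *: "norm (\<Sum>n<N. \<mu> (A n) (x n)) \<in> sv_set (space M)"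
    if "\<forall>n<N. A n \<in> sets M \<and> norm (x n) \<le> 1" "disjoint_family_on A {..<N}" for N :: nat and A x
    using that sets.sets_into_space by (intro sv_setI) blast+
  show "semivariation M \<mu> \<le> ennreal (sv (space M))"
    unfolding semivariation_def by (rule Sup_least) (use * sv_upper in \<open>auto intro!: ennreal_leI\<close>)
  have "c \<in> sv_set (space M) \<Longrightarrow> ennreal c \<le> semivariation M \<mu>" for c
    unfolding semivariation_def by (rule Sup_upper) (auto simp: sv_set_def)
  then have "ennreal c \<le> semivariation M \<mu>" if "c \<in> sv_set (space M)" for c
    using that by blast
  note le = this
  show "ennreal (sv (space M)) \<le> semivariation M \<mu>"
  proof (cases "semivariation M \<mu>")
    case (real b)
    then have "sv (space M) \<le> b"
      using le by (intro sv_least) (simp add: ennreal_le_iff)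
    then show ?thesis unfolding real(2) by (rule ennreal_leI)
  qed simp
qed

text \<open>A gliding hump. A finite sum on \<open>B k\<close> of norm above
  \<open>\<epsilon>\<close> stays above it when a far \<open>B m\<close> is removed from its sets;
  convergence at each vector suffices, as only finitely many occur. Iteration yields disjoint
  blocks, contrary to \<open>sv_set_disjoint_null\<close>.\<close>

lemma sv_decreasing:
  fixes B :: "nat \<Rightarrow> 'z set"
  assumes B: "\<And>n. B n \<in> sets M" "decseq B" "(\<Inter>n. B n) = {}" and e: "0 < \<epsilon>"
  shows "\<exists>N. sv (B N) \<le> \<epsilon>"
proof (rule ccontr)
  assume "\<not> ?thesis"
  then have big: "\<epsilon> < sv (B N)" for N by (simp add: not_le)
  have "\<exists>m>k. \<exists>c\<in>sv_set (B k - B m). \<epsilon> \<le> c" for k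
  proof -
    obtain c where c: "c \<in> sv_set (B k)" "\<epsilon> < c"
      using big[of k] sv_least[of "B k" \<epsilon>] by (meson not_le)
    obtain N :: nat and A x where A': "c = norm (\<Sum>n<N. \<mu> (A n) (x n))"
      "\<forall>n<N. A n \<in> sets M" "\<forall>n<N. A n \<subseteq> B k" "\<forall>n<N. norm (x n) \<le> 1"
      "disjoint_family_on A {..<N}"
      using sv_setD[OF c(1)] by (elim exE conjE)
    note A = A'(1) A'(2-4)[rule_format] A'(5)
    have "(\<lambda>m. norm (\<Sum>n<N. \<mu> (A n - B m) (x n))) \<longlonglongrightarrow> c"
      unfolding A(1) by (intro tendsto_norm tendsto_sum minus_decreasing_tendsto B A(2)) auto
    then have "\<forall>\<^sub>F m in sequentially. \<epsilon> < norm (\<Sum>n<N. \<mu> (A n - B m) (x n))"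
      using c(2) by (rule order_tendstoD)
    then obtain m0 where m0: "\<And>m. m0 \<le> m \<Longrightarrow> \<epsilon> < norm (\<Sum>n<N. \<mu> (A n - B m) (x n))"
      unfolding eventually_sequentially by blast
    \<comment> \<open>Taking the maximum with \<open>Suc k\<close> ensures \<open>k < m\<close>, so
      that iterating \<open>h\<close> gives a strictly increasing sequence.\<close>
    define m where "m = max m0 (Suc k)"
    have "norm (\<Sum>n<N. \<mu> (A n - B m) (x n)) \<in> sv_set (B k - B m)"
    proof (rule sv_setI)
      show "disjoint_family_on (\<lambda>n. A n - B m) {..<N}"
        using A(5) by (auto simp: disjoint_family_on_def)
    qed (use A B(1) in auto)
    moreover have "\<epsilon> \<le> norm (\<Sum>n<N. \<mu> (A n - B m) (x n))"
      using m0[of m] by (simp add: m_def)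
    moreover have "k < m" by (simp add: m_def)
    ultimately show ?thesis by blast
  qed
  then obtain h where h: "\<And>k. k < h k" "\<And>k. \<exists>c\<in>sv_set (B k - B (h k)). \<epsilon> \<le> c" by metis
  define m where "m n = (h ^^ n) 0" for n
  have mS: "m (Suc n) = h (m n)" for n by (simp add: m_def)
  have sm: "strict_mono m" by (rule strict_monoI_Suc) (simp add: mS h(1))
  define D where "D n = B (m n) - B (m (Suc n))" for n
  have dis: "D k \<inter> D l = {}" if "k < l" for k l
  proof -
    have "m (Suc k) \<le> m l" using that sm by (simp add: strict_mono_less_eq)
    then show ?thesis using decseqD[OF B(2), of "m (Suc k)" "m l"] by (auto simp: D_def)
  qed
  then have disj: "disjoint_family D"
    unfolding disjoint_family_on_def by (metis Int_commute nat_neq_iff)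
  have "\<exists>c. c \<in> sv_set (D n) \<and> \<epsilon> \<le> c" for n
    using h(2)[of "m n"] by (auto simp: D_def mS)
  then obtain c where c: "\<And>n. c n \<in> sv_set (D n)" "\<And>n. \<epsilon> \<le> c n" by metis
  have "c \<longlonglongrightarrow> 0" by (rule sv_set_disjoint_null[OF disj c(1)])
  then have "\<epsilon> \<le> 0" by (rule LIMSEQ_le_const) (use c(2) in auto)
  then show False using e by simp
qed

end

section \<open>The integral\<close>

lemma le_if_le_add_small_mult:
  fixes x a b :: real
  assumes "\<And>\<epsilon>. 0 < \<epsilon> \<Longrightarrow> x \<le> a + \<epsilon> * b"
  shows "x \<le> a"
proof (rule field_le_epsilon)
  fix e :: real assume "0 < e"
  define \<epsilon> where "\<epsilon> = e / (\<bar>b\<bar> + 1)"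
  have pos: "0 < \<bar>b\<bar> + 1" by simp
  then have "0 < \<epsilon>" using \<open>0 < e\<close> by (simp add: \<epsilon>_def)
  then have "x \<le> a + \<epsilon> * b" by (rule assms)
  also have "\<epsilon> * b \<le> \<epsilon> * (\<bar>b\<bar> + 1)" using \<open>0 < \<epsilon>\<close> by (intro mult_left_mono) auto
  also have "\<dots> = e" using pos by (simp add: \<epsilon>_def)
  finally show "x \<le> a + e" by simp
qed

lemma norm_has_sum_le:
  fixes f :: "'i \<Rightarrow> 'f::real_normed_vector"
  assumes "(f has_sum a) I" "\<And>F. finite F \<Longrightarrow> F \<subseteq> I \<Longrightarrow> norm (sum f F) \<le> b"
  shows "norm a \<le> b"
proof (rule Lim_norm_ubound)
  show "(sum f \<longlongrightarrow> a) (finite_subsets_at_top I)"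
    using assms(1) by (simp add: has_sum_def)
  show "\<forall>\<^sub>F F in finite_subsets_at_top I. norm (sum f F) \<le> b"
    using assms(2) by (intro eventually_finite_subsets_at_top_weakI) auto
qed simp

section \<open>Functions with countably many values and their density\<close>

lemma countable_fibres_sets:
  assumes "countable (q ` space M)" "\<And>i. i \<in> q ` space M \<Longrightarrow> q -` {i} \<inter> space M \<in> sets M"
  shows "q -` B \<inter> space M \<in> sets M"
proof -
  have "q -` B \<inter> space M = (\<Union>i\<in>q ` space M \<inter> B. q -` {i} \<inter> space M)" by auto
  also have "\<dots> \<in> sets M"
    using assms by (intro sets.countable_UN'') auto
  finally show ?thesis .
qed

lemma S_fun_compose:
  assumes "countable (q ` space M)" "\<And>i. i \<in> q ` space M \<Longrightarrow> q -` {i} \<inter> space M \<in> sets M"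
    "\<And>i. i \<in> q ` space M \<Longrightarrow> norm (h i) \<le> C"
  shows "(\<lambda>z. h (q z)) \<in> S_fun M"
  unfolding S_fun_def mem_Collect_eq
proof (intro conjI allI)
  show "bounded ((\<lambda>z. h (q z)) ` space M)"
    using assms(3) by (intro boundedI[where B=C]) auto
  have "(\<lambda>z. h (q z)) ` space M = h ` (q ` space M)" by auto
  then show "countable ((\<lambda>z. h (q z)) ` space M)"
    using assms(1) by simp
  fix e
  have "(\<lambda>z. h (q z)) -` {e} \<inter> space M = q -` (h -` {e}) \<inter> space M" by auto
  then show "(\<lambda>z. h (q z)) -` {e} \<inter> space M \<in> sets M"
    using countable_fibres_sets[OF assms(1,2)] by simp
qed

lemma S_funD:
  assumes "f \<in> S_fun M"
  shows "countable (f ` space M)" "f -` {e} \<inter> space M \<in> sets M" "\<exists>C\<ge>0. \<forall>z\<in>space M. norm (f z) \<le> C"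
proof -
  show "countable (f ` space M)" "f -` {e} \<inter> space M \<in> sets M"
    using assms by (auto simp: S_fun_def)
  have "bounded (f ` space M)" using assms by (auto simp: S_fun_def)
  then obtain C where "0 < C" "\<forall>x\<in>f ` space M. norm x \<le> C" by (auto simp: bounded_pos)
  then show "\<exists>C\<ge>0. \<forall>z\<in>space M. norm (f z) \<le> C" by (intro exI[of _ C]) auto
qed

lemma Pair_fibres:
  assumes "countable (f ` space M)" "\<And>i. f -` {i} \<inter> space M \<in> sets M"
    "countable (g ` space M)" "\<And>i. g -` {i} \<inter> space M \<in> sets M"
  shows "countable ((\<lambda>z. (f z, g z)) ` space M)" "(\<lambda>z. (f z, g z)) -` {i} \<inter> space M \<in> sets M"
proof -
  have "(\<lambda>z. (f z, g z)) ` space M \<subseteq> f ` space M \<times> g ` space M" by auto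
  then show "countable ((\<lambda>z. (f z, g z)) ` space M)"
    using assms by (meson countable_SIGMA countable_subset)
  have "(\<lambda>z. (f z, g z)) -` {i} \<inter> space M = (f -` {fst i} \<inter> space M) \<inter> (g -` {snd i} \<inter> space M)"
    by (auto simp: prod_eq_iff)
  then show "(\<lambda>z. (f z, g z)) -` {i} \<inter> space M \<in> sets M"
    using assms by simp
qed

lemma S_fun_indicator:
  assumes "s \<in> S_fun M" "A \<in> sets M"
  shows "(\<lambda>z. indicator A z *\<^sub>R s z) \<in> S_fun M"
proof -
  note s = S_funD[OF assms(1)]
  obtain C where C: "0 \<le> C" "\<And>z. z \<in> space M \<Longrightarrow> norm (s z) \<le> C" using s(3) by blast
  have A: "countable ((\<lambda>z. z \<in> A) ` space M)" by (rule countableI_type)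
  have A': "(\<lambda>z. z \<in> A) -` {b} \<inter> space M \<in> sets M" for b
  proof -
    have "(\<lambda>z. z \<in> A) -` {b} \<inter> space M = (if b then A \<inter> space M else space M - A)" by auto
    then show ?thesis using assms(2) by auto
  qed
  have "(\<lambda>z. (\<lambda>(x, b). if b then x else 0) (s z, z \<in> A)) \<in> S_fun M"
    by (rule S_fun_compose[where C=C]) (use Pair_fibres[OF s(1,2) A A'] C in auto)
  moreover have "(\<lambda>z. (\<lambda>(x, b). if b then x else 0) (s z, z \<in> A)) = (\<lambda>z. indicator A z *\<^sub>R s z)"
    by (auto simp: indicator_def)
  ultimately show ?thesis by simp
qed

lemma M_fun_real_measurable:
  fixes sE :: "'k::real_or_complex \<Rightarrow> 'e::banach \<Rightarrow> 'e" and \<phi> :: "'e \<Rightarrow>\<^sub>L real"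
  assumes sE: "normed_over sE" and "f \<in> M_fun sE M"
  shows "(\<lambda>z. \<phi> (f z)) \<in> borel_measurable M"
proof -
  obtain re :: "'k \<Rightarrow>\<^sub>L real" where "bij_betw (\<lambda>\<psi>. re o\<^sub>L \<psi>) (dual sE) UNIV"
    using real_part_dual[OF sE] by metis
  then obtain \<psi> where \<psi>: "\<psi> \<in> dual sE" "\<phi> = re o\<^sub>L \<psi>"
    by (metis UNIV_I bij_betw_imp_surj_on imageE)
  have "(\<lambda>z. \<psi> (f z)) \<in> borel_measurable M"
    using assms(2) \<psi>(1) by (simp add: M_fun_def)
  moreover have "blinfun_apply re \<in> borel_measurable borel"
    by (intro borel_measurable_continuous_onI continuous_intros)
  ultimately show ?thesis
    unfolding \<psi>(2) blinfun_apply_blinfun_compose by (rule measurable_compose)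
qed

lemma S_fun_subset_M_fun:
  fixes sE :: "'k::real_or_complex \<Rightarrow> 'e::banach \<Rightarrow> 'e"
  shows "S_fun M \<subseteq> M_fun sE M"
proof
  fix f :: "'a \<Rightarrow> 'e" assume f: "f \<in> S_fun M"
  show "f \<in> M_fun sE M"
    unfolding M_fun_def mem_Collect_eq
  proof (intro conjI ballI)
    show "bounded (f ` space M)" using f by (simp add: S_fun_def)
    show "separable_space (top_of_set (f ` space M))"
      unfolding separable_space_def using S_funD(1)[OF f]
      by (intro exI[of _ "f ` space M"]) (auto simp: closure_of_subtopology intro: subsetD[OF closure_subset])
    fix \<psi> assume "\<psi> \<in> dual sE"
    show "(\<lambda>z. \<psi> (f z)) \<in> borel_measurable M"
    proof (rule measurableI)
      fix B :: "'k set"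
      have "(\<lambda>z. \<psi> (f z)) -` B \<inter> space M = f -` (blinfun_apply \<psi> -` B) \<inter> space M" by auto
      then show "(\<lambda>z. \<psi> (f z)) -` B \<inter> space M \<in> sets M"
        using countable_fibres_sets[OF S_funD(1,2)[OF f]] by simp
    qed simp
  qed
qed

text \<open>Pettis' argument: countably many norming functionals turn weak into strong measurability.\<close>

lemma S_fun_dense:
  fixes sE :: "'k::real_or_complex \<Rightarrow> 'e::banach \<Rightarrow> 'e"
  assumes sE: "normed_over sE" and f: "f \<in> M_fun sE M" and e: "0 < \<epsilon>"
  shows "\<exists>g\<in>S_fun M. \<forall>z\<in>space M. norm (f z - g z) \<le> \<epsilon>"
proof (cases "space M = {}")
  case True
  have "(\<lambda>_. 0 :: 'e) \<in> S_fun M"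
    using True by (simp add: S_fun_def)
  then show ?thesis using True by blast
next
  case False
  have "separable_space (top_of_set (f ` space M))" using f by (simp add: M_fun_def)
  then obtain D where D: "countable D" "D \<subseteq> f ` space M"
    "top_of_set (f ` space M) closure_of D = f ` space M"
    unfolding separable_space_def topspace_euclidean_subtopology by (elim exE conjE)
  have dense: "f ` space M \<subseteq> closure D"
    using D(2,3) by (auto simp: closure_of_subtopology Int_absorb1)
  then have "D \<noteq> {}" using False by auto
  define d where "d = from_nat_into D"
  have d: "range d = D" unfolding d_def by (rule range_from_nat_into[OF \<open>D \<noteq> {}\<close> D(1)])
  have near: "\<exists>n. norm (f z - d n) < \<delta>" if z: "z \<in> space M" and \<delta>: "0 < \<delta>" for z \<delta>
  proof -
    have "f z \<in> closure D" using dense z by blast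
    then obtain y where "y \<in> D" "dist y (f z) < \<delta>"
      using \<delta> closure_approachable by blast
    then show ?thesis using d by (metis dist_commute dist_norm rangeE)
  qed
  \<comment> \<open>\<open>\<phi> m n\<close> norms \<open>d m - d n\<close>, so it nearly norms
    \<open>f z - d n\<close> once \<open>d m\<close> is close to \<open>f z\<close>. Hence the
    countably many scalar inequalities in \<open>E_eq\<close> describe the preimage of a norm ball
    around \<open>d n\<close>.\<close>
  have "\<exists>\<phi> :: 'e \<Rightarrow>\<^sub>L real. norm \<phi> \<le> 1 \<and> blinfun_apply \<phi> (d m - d n) = norm (d m - d n)" for m n
    by (metis norming_functional)
  then obtain \<phi> :: "nat \<Rightarrow> nat \<Rightarrow> 'e \<Rightarrow>\<^sub>L real"
    where \<phi>: "\<And>m n. norm (\<phi> m n) \<le> 1" "\<And>m n. blinfun_apply (\<phi> m n) (d m - d n) = norm (d m - d n)"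
    by metis
  have \<phi>_le: "\<phi> m n x \<le> norm x" for m n x
    using norm_blinfun[of "\<phi> m n" x] mult_right_mono[OF \<phi>(1)[of m n] norm_ge_zero[of x]] by simp
  define E where "E n = {z \<in> space M. norm (f z - d n) \<le> \<epsilon>}" for n
  have E_eq: "E n = (\<Inter>m. {z \<in> space M. \<phi> m n (f z) \<le> \<epsilon> + \<phi> m n (d n)})" for n
  proof (intro equalityI subsetI)
    fix z assume z: "z \<in> E n"
    have "\<phi> m n (f z) \<le> \<epsilon> + \<phi> m n (d n)" for m
      using \<phi>_le[of m n "f z - d n"] z by (simp add: E_def blinfun.diff_right)
    then show "z \<in> (\<Inter>m. {z \<in> space M. \<phi> m n (f z) \<le> \<epsilon> + \<phi> m n (d n)})"
      using z by (simp add: E_def)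
  next
    fix z assume z: "z \<in> (\<Inter>m. {z \<in> space M. \<phi> m n (f z) \<le> \<epsilon> + \<phi> m n (d n)})"
    then have zs: "z \<in> space M" and le: "\<phi> m n (f z) \<le> \<epsilon> + \<phi> m n (d n)" for m by auto
    have "norm (f z - d n) \<le> \<epsilon> + \<delta> * 2" if \<delta>: "0 < \<delta>" for \<delta>
    proof -
      obtain m where m: "norm (f z - d m) < \<delta>" using near[OF zs \<delta>] by blast
      have "norm (f z - d n) \<le> norm (f z - d m) + norm (d m - d n)"
        using norm_triangle_ineq[of "f z - d m" "d m - d n"] by simp
      also have "norm (d m - d n) = \<phi> m n (d m - f z) + (\<phi> m n (f z) - \<phi> m n (d n))"
        using \<phi>(2)[of m n] by (simp add: blinfun.diff_right)
      also have "\<dots> \<le> norm (f z - d m) + \<epsilon>"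
        using \<phi>_le[of m n "d m - f z"] le[of m] by (simp add: norm_minus_commute)
      finally show ?thesis using m by simp
    qed
    then have "norm (f z - d n) \<le> \<epsilon>" by (rule le_if_le_add_small_mult)
    then show "z \<in> E n" using zs by (simp add: E_def)
  qed
  have E: "E n \<in> sets M" for n
    unfolding E_eq using M_fun_real_measurable[OF sE f]
    by (intro sets.countable_INT) (auto intro!: borel_measurable_le)
  have ex: "\<exists>n. z \<in> E n" if "z \<in> space M" for z
    using near[OF that e] that by (auto simp: E_def intro: less_imp_le)
  \<comment> \<open>Taking the least index turns the cover by the sets \<open>E n\<close> into a
    measurable partition.\<close>
  define k where "k z = (LEAST n. z \<in> E n)" for z
  have kE: "z \<in> E (k z)" if "z \<in> space M" for z
    unfolding k_def using ex[OF that] by (rule LeastI_ex)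
  have k_eq: "k -` {n} \<inter> space M = E n - (\<Union>m<n. E m)" for n
  proof (intro equalityI subsetI)
    fix z assume z: "z \<in> k -` {n} \<inter> space M"
    then have "z \<in> E n" using kE by auto
    moreover have "z \<notin> E m" if "m < n" for m
      using z that not_less_Least[of m "\<lambda>n. z \<in> E n"] by (auto simp: k_def)
    ultimately show "z \<in> E n - (\<Union>m<n. E m)" by auto
  next
    fix z assume z: "z \<in> E n - (\<Union>m<n. E m)"
    then have "k z = n"
      unfolding k_def by (intro Least_equality) (auto simp: not_less[symmetric])
    then show "z \<in> k -` {n} \<inter> space M" using z by (auto simp: E_def)
  qed
  have "bounded (f ` space M)" using f by (simp add: M_fun_def)
  then obtain C where C': "\<forall>x\<in>f ` space M. norm x \<le> C"
    unfolding bounded_iff by (elim exE)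
  have C: "norm x \<le> C" if "x \<in> f ` space M" for x using C' that by (rule bspec)
  have dC: "norm (d n) \<le> C" for n
  proof (rule C)
    show "d n \<in> f ` space M" using d D(2) by auto
  qed
  have "(\<lambda>z. d (k z)) \<in> S_fun M"
  proof (rule S_fun_compose[where q=k and h=d and C=C])
    show "countable (k ` space M)" by (rule countableI_type)
    show "k -` {i} \<inter> space M \<in> sets M" for i unfolding k_eq using E by auto
    show "norm (d i) \<le> C" for i by (rule dC)
  qed
  moreover have "norm (f z - d (k z)) \<le> \<epsilon>" if "z \<in> space M" for z
    using kE[OF that] by (simp add: E_def)
  ultimately show ?thesis by (intro bexI[of _ "\<lambda>z. d (k z)"] ballI)
qed

section \<open>The integral of countably valued functions and its extension\<close>

context vector_i_measure
begin

text \<open>\<open>S_integral\<close> sums over the values of a function, but two functions are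
  compared on a common finer partition. Here the partition comes from \<open>q\<close>; grouping its
  cells by the value of \<open>h\<close>, with \<open>has_sum_UN\<close> on each group, recovers the
  definition.\<close>

lemma S_integral_compose:
  fixes q :: "'z \<Rightarrow> 'i" and h :: "'i \<Rightarrow> 'e"
  assumes cnt: "countable (q ` space M)"
    and meas: "\<And>i. i \<in> q ` space M \<Longrightarrow> q -` {i} \<inter> space M \<in> sets M"
    and bnd: "\<And>i. i \<in> q ` space M \<Longrightarrow> norm (h i) \<le> C"
  shows "((\<lambda>i. \<mu> (q -` {i} \<inter> space M) (h i)) has_sum S_integral M \<mu> (\<lambda>z. h (q z))) (q ` space M)"
proof -
  define J where "J = q ` space M"
  define P where "P i = q -` {i} \<inter> space M" for i
  have disj: "disjoint_family_on P I" for I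
    by (auto simp: disjoint_family_on_def P_def)
  have "(\<lambda>i. \<mu> (P i) (h i)) summable_on J"
    by (rule summable_on_disjoint[OF _ _ disj]) (use cnt meas bnd in \<open>auto simp: J_def P_def\<close>)
  then obtain a where a: "((\<lambda>i. \<mu> (P i) (h i)) has_sum a) J" by (auto simp: summable_on_def)
  define Jh where "Jh e = {i\<in>J. h i = e}" for e
  have bij: "bij_betw (\<lambda>i. (h i, i)) J (Sigma (h ` J) Jh)"
    unfolding bij_betw_def
  proof (intro conjI equalityI subsetI)
    show "inj_on (\<lambda>i. (h i, i)) J" by (auto simp: inj_on_def)
    show "p \<in> Sigma (h ` J) Jh" if "p \<in> (\<lambda>i. (h i, i)) ` J" for p
      using that by (auto simp: Jh_def)
    show "p \<in> (\<lambda>i. (h i, i)) ` J" if "p \<in> Sigma (h ` J) Jh" for p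
      using that by (intro image_eqI[of _ _ "snd p"]) (auto simp: Jh_def)
  qed
  have "((\<lambda>(e, i). \<mu> (P i) e) has_sum a) (Sigma (h ` J) Jh)"
    using a has_sum_reindex_bij_betw[OF bij, of "\<lambda>(e, i). \<mu> (P i) e" a] by simp
  then have "((\<lambda>e. \<mu> (\<Union>i\<in>Jh e. P i) e) has_sum a) (h ` J)"
  proof (rule has_sum_SigmaD)
    fix e assume "e \<in> h ` J"
    have "((\<lambda>i. \<mu> (P i) e) has_sum \<mu> (\<Union>i\<in>Jh e. P i) e) (Jh e)"
      by (rule has_sum_UN[OF _ _ disj]) (use cnt meas in \<open>auto simp: Jh_def J_def P_def\<close>)
    then show "((\<lambda>i. case (e, i) of (e, i) \<Rightarrow> \<mu> (P i) e) has_sum \<mu> (\<Union>i\<in>Jh e. P i) e) (Jh e)" by simp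
  qed
  moreover have "(\<Union>i\<in>Jh e. P i) = (\<lambda>z. h (q z)) -` {e} \<inter> space M" for e
    by (auto simp: Jh_def J_def P_def)
  ultimately have "((\<lambda>e. \<mu> ((\<lambda>z. h (q z)) -` {e} \<inter> space M) e) has_sum a) (h ` J)" by simp
  then have "((\<lambda>e. \<mu> ((\<lambda>z. h (q z)) -` {e} \<inter> space M) e) has_sum a) UNIV"
  proof (rule has_sum_cong_neutral[THEN iffD1, rotated 3])
    fix e assume "e \<in> UNIV - h ` J"
    then have "(\<lambda>z. h (q z)) -` {e} \<inter> space M = {}" by (auto simp: J_def)
    then show "\<mu> ((\<lambda>z. h (q z)) -` {e} \<inter> space M) e = 0" by (simp add: blinfun.zero_left)
  qed auto
  then have "S_integral M \<mu> (\<lambda>z. h (q z)) = a"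
    unfolding S_integral_def by (rule infsumI)
  then show ?thesis using a by (simp add: J_def P_def)
qed

text \<open>The common refinement of the partitions of \<open>f\<close> and \<open>g\<close>, on
  which linearity of the integral can be read off term by term.\<close>

lemma S_integral_pair:
  assumes "f \<in> S_fun M" "g \<in> S_fun M"
    and "\<And>z. z \<in> space M \<Longrightarrow> norm (h (f z) (g z)) \<le> C"
  shows "((\<lambda>i. \<mu> ((\<lambda>z. (f z, g z)) -` {i} \<inter> space M) (h (fst i) (snd i))) has_sum
      S_integral M \<mu> (\<lambda>z. h (f z) (g z))) ((\<lambda>z. (f z, g z)) ` space M)"
    "(\<lambda>z. h (f z) (g z)) \<in> S_fun M"
proof -
  note pair = Pair_fibres[OF S_funD(1,2)[OF assms(1)] S_funD(1,2)[OF assms(2)]]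
  have "((\<lambda>i. \<mu> ((\<lambda>z. (f z, g z)) -` {i} \<inter> space M) ((\<lambda>i. h (fst i) (snd i)) i)) has_sum
      S_integral M \<mu> (\<lambda>z. (\<lambda>i. h (fst i) (snd i)) (f z, g z))) ((\<lambda>z. (f z, g z)) ` space M)"
    by (rule S_integral_compose[where C=C]) (use pair assms(3) in auto)
  then show "((\<lambda>i. \<mu> ((\<lambda>z. (f z, g z)) -` {i} \<inter> space M) (h (fst i) (snd i))) has_sum
      S_integral M \<mu> (\<lambda>z. h (f z) (g z))) ((\<lambda>z. (f z, g z)) ` space M)" by simp
  have "(\<lambda>z. (\<lambda>i. h (fst i) (snd i)) (f z, g z)) \<in> S_fun M"
    by (rule S_fun_compose[where C=C]) (use pair assms(3) in auto)
  then show "(\<lambda>z. h (f z) (g z)) \<in> S_fun M" by simp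
qed

lemma S_integral_linear_combination:
  assumes f: "f \<in> S_fun M" and g: "g \<in> S_fun M"
  shows "S_integral M \<mu> (\<lambda>z. f z + r *\<^sub>R g z) = S_integral M \<mu> f + r *\<^sub>R S_integral M \<mu> g" (is ?eq)
    and "(\<lambda>z. f z + r *\<^sub>R g z) \<in> S_fun M" (is ?mem)
proof -
  obtain A where A: "\<And>z. z \<in> space M \<Longrightarrow> norm (f z) \<le> A" using S_funD(3)[OF f] by blast
  obtain B where B: "\<And>z. z \<in> space M \<Longrightarrow> norm (g z) \<le> B" using S_funD(3)[OF g] by blast
  have AB: "norm (f z + r *\<^sub>R g z) \<le> A + \<bar>r\<bar> * B" if "z \<in> space M" for z
    using A[OF that] B[OF that] by (intro norm_triangle_mono) (auto intro: mult_left_mono)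
  note c = S_integral_pair[OF f g, of "\<lambda>x y. x + r *\<^sub>R y", OF AB]
  have "((\<lambda>i. \<mu> ((\<lambda>z. (f z, g z)) -` {i} \<inter> space M) (fst i)) has_sum S_integral M \<mu> f)
      ((\<lambda>z. (f z, g z)) ` space M)"
    using S_integral_pair(1)[OF f g, of "\<lambda>x y. x", OF A] by simp
  moreover have "((\<lambda>i. r *\<^sub>R \<mu> ((\<lambda>z. (f z, g z)) -` {i} \<inter> space M) (snd i)) has_sum r *\<^sub>R S_integral M \<mu> g)
      ((\<lambda>z. (f z, g z)) ` space M)"
    using S_integral_pair(1)[OF f g, of "\<lambda>x y. y", OF B]
    by (intro has_sum_bounded_linear[OF bounded_linear_scaleR_right]) simp
  ultimately have "((\<lambda>i. \<mu> ((\<lambda>z. (f z, g z)) -` {i} \<inter> space M) (fst i + r *\<^sub>R snd i)) has_sum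
      (S_integral M \<mu> f + r *\<^sub>R S_integral M \<mu> g)) ((\<lambda>z. (f z, g z)) ` space M)"
    unfolding blinfun.add_right blinfun.scaleR_right by (rule has_sum_add)
  then show ?eq using c(1) has_sum_unique by blast
  show ?mem by (rule c(2))
qed

lemma S_integral_add:
  assumes "f \<in> S_fun M" "g \<in> S_fun M"
  shows "S_integral M \<mu> (\<lambda>z. f z + g z) = S_integral M \<mu> f + S_integral M \<mu> g"
    and "(\<lambda>z. f z + g z) \<in> S_fun M"
  using S_integral_linear_combination[OF assms, of 1] by simp_all

lemma S_integral_diff:
  assumes "f \<in> S_fun M" "g \<in> S_fun M"
  shows "S_integral M \<mu> (\<lambda>z. f z - g z) = S_integral M \<mu> f - S_integral M \<mu> g"
    and "(\<lambda>z. f z - g z) \<in> S_fun M"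
  using S_integral_linear_combination[OF assms, of "-1"] by simp_all

lemma S_integral_scale:
  assumes f: "f \<in> S_fun M"
  shows "S_integral M \<mu> (\<lambda>z. sE c (f z)) = sF c (S_integral M \<mu> f)" (is ?eq)
    and "(\<lambda>z. sE c (f z)) \<in> S_fun M" (is ?mem)
proof -
  interpret E: normed_over sE by (rule sE)
  obtain A where A: "\<And>z. z \<in> space M \<Longrightarrow> norm (f z) \<le> A" using S_funD(3)[OF f] by blast
  have cA: "norm (sE c x) \<le> norm c * A" if "x \<in> f ` space M" for x
    using A that by (auto simp: E.norm_scale intro: mult_left_mono)
  have lin: "\<mu> B \<in> linops sE sF" if "B \<in> sets M" for B
    using i_measure that by (simp add: i_measure_def)
  note fm = S_funD(1,2)[OF f]
  have "((\<lambda>i. \<mu> (f -` {i} \<inter> space M) ((\<lambda>x. x) i)) has_sum S_integral M \<mu> (\<lambda>z. (\<lambda>x. x) (f z))) (f ` space M)"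
    by (rule S_integral_compose[where C=A]) (use fm A in auto)
  then have hs: "((\<lambda>i. \<mu> (f -` {i} \<inter> space M) i) has_sum S_integral M \<mu> f) (f ` space M)"
    by simp
  have "((\<lambda>i. sF c (\<mu> (f -` {i} \<inter> space M) i)) has_sum sF c (S_integral M \<mu> f)) (f ` space M)"
    by (rule has_sum_bounded_linear[OF bounded_linear_scale[OF sF] hs])
  then have "((\<lambda>i. \<mu> (f -` {i} \<inter> space M) (sE c i)) has_sum sF c (S_integral M \<mu> f)) (f ` space M)"
    using linops_apply[OF lin[OF fm(2)]] by simp
  moreover have "((\<lambda>i. \<mu> (f -` {i} \<inter> space M) (sE c i)) has_sum S_integral M \<mu> (\<lambda>z. sE c (f z))) (f ` space M)"
    by (rule S_integral_compose[OF _ _ cA]) (use fm in auto)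
  ultimately show ?eq using has_sum_unique by blast
  show ?mem by (rule S_fun_compose[OF _ _ cA]) (use fm in auto)
qed

lemma norm_S_integral_le:
  assumes f: "f \<in> S_fun M" and "0 \<le> C" and A: "\<And>z. z \<in> space M \<Longrightarrow> norm (f z) \<le> C"
    "\<And>z. z \<in> space M \<Longrightarrow> z \<notin> A \<Longrightarrow> f z = 0"
  shows "norm (S_integral M \<mu> f) \<le> C * sv A"
proof -
  note fm = S_funD(1,2)[OF f]
  have "((\<lambda>i. \<mu> (f -` {i} \<inter> space M) ((\<lambda>x. x) i)) has_sum S_integral M \<mu> (\<lambda>z. (\<lambda>x. x) (f z))) (f ` space M)"
    by (rule S_integral_compose[where C=C]) (use fm A in auto)
  then have hs: "((\<lambda>i. \<mu> (f -` {i} \<inter> space M) i) has_sum S_integral M \<mu> f) (f ` space M)" by simp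
  show ?thesis
  proof (rule norm_has_sum_le[OF hs])
    fix F assume F: "finite F" "F \<subseteq> f ` space M"
    have "(\<Sum>i\<in>F. \<mu> (f -` {i} \<inter> space M) i) = (\<Sum>i\<in>F - {0}. \<mu> (f -` {i} \<inter> space M) i)"
      using F(1) by (intro sum.mono_neutral_right) (auto simp: blinfun.zero_right)
    also have "norm \<dots> \<le> C * sv A"
    proof (rule sum_le_sv)
      show "f -` {i} \<inter> space M \<subseteq> A" if "i \<in> F - {0}" for i using that A(2) by auto
      show "norm i \<le> C" if "i \<in> F - {0}" for i using that A(1) F(2) by auto
    qed (use F fm assms(2) in \<open>auto simp: disjoint_family_on_def\<close>)
    finally show "norm (\<Sum>i\<in>F. \<mu> (f -` {i} \<inter> space M) i) \<le> C * sv A" .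
  qed
qed

lemma S_integral_close:
  assumes "f \<in> S_fun M" "g \<in> S_fun M" "0 \<le> C" "\<And>z. z \<in> space M \<Longrightarrow> norm (f z - g z) \<le> C"
  shows "norm (S_integral M \<mu> f - S_integral M \<mu> g) \<le> C * sv (space M)"
  unfolding S_integral_diff(1)[OF assms(1,2), symmetric]
  using assms(3,4) by (intro norm_S_integral_le S_integral_diff(2) assms(1,2)) auto

text \<open>Characterized by its distance to the integrals of all countably valued functions rather
  than as the limit along one chosen sequence, so no independence of a choice has to be shown
  afterwards.\<close>

definition Int_limit :: "('z \<Rightarrow> 'e) \<Rightarrow> 'f"
  where "Int_limit f = (SOME I. \<forall>g\<in>S_fun M. \<forall>C\<ge>0. (\<forall>z\<in>space M. norm (f z - g z) \<le> C) \<longrightarrow>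
    norm (I - S_integral M \<mu> g) \<le> C * sv (space M))"

text \<open>Existence of such a value: the integrals of approximants with error \<open>e n\<close>
  are Cauchy, and their limit inherits the estimate against every \<open>g\<close>.\<close>

lemma Int_limit_close:
  assumes f: "f \<in> M_fun sE M" and "g \<in> S_fun M" "0 \<le> C" "\<And>z. z \<in> space M \<Longrightarrow> norm (f z - g z) \<le> C"
  shows "norm (Int_limit f - S_integral M \<mu> g) \<le> C * sv (space M)"
proof -
  define e where "e n = inverse (real (Suc n))" for n
  have e: "0 < e n" for n by (simp add: e_def)
  have e_lim: "e \<longlonglongrightarrow> 0" unfolding e_def by (rule LIMSEQ_inverse_real_of_nat)
  have "\<exists>g\<in>S_fun M. \<forall>z\<in>space M. norm (f z - g z) \<le> e n" for n
    by (rule S_fun_dense[OF sE f e])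
  then obtain s where s: "\<And>n. s n \<in> S_fun M" "\<And>n. \<forall>z\<in>space M. norm (f z - s n z) \<le> e n" by metis
  have tri: "norm (S_integral M \<mu> (s n) - S_integral M \<mu> g) \<le> (e n + C) * sv (space M)"
    if "g \<in> S_fun M" "0 \<le> C" "\<forall>z\<in>space M. norm (f z - g z) \<le> C" for g C n
  proof (rule S_integral_close[OF s(1) that(1)])
    show "norm (s n z - g z) \<le> e n + C" if z: "z \<in> space M" for z
    proof -
      have "norm (s n z - g z) \<le> norm (s n z - f z) + norm (f z - g z)"
        using norm_triangle_ineq[of "s n z - f z" "f z - g z"] by simp
      then show ?thesis
        using s(2)[of n] \<open>\<forall>z\<in>space M. norm (f z - g z) \<le> C\<close> z by (force simp: norm_minus_commute)
    qed
  qed (use e[of n] that in simp)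
  have "Cauchy (\<lambda>n. S_integral M \<mu> (s n))"
  proof (rule metric_CauchyI)
    fix \<epsilon> :: real assume "0 < \<epsilon>"
    have "(\<lambda>n. (e n + e n) * sv (space M)) \<longlonglongrightarrow> (0 + 0) * sv (space M)"
      by (intro tendsto_intros e_lim)
    then have "\<forall>\<^sub>F n in sequentially. (e n + e n) * sv (space M) < \<epsilon>"
      using \<open>0 < \<epsilon>\<close> by (intro order_tendstoD(2)) auto
    then obtain N where N: "(e N + e N) * sv (space M) < \<epsilon>"
      unfolding eventually_sequentially by blast
    have "dist (S_integral M \<mu> (s m)) (S_integral M \<mu> (s n)) < \<epsilon>" if "N \<le> m" "N \<le> n" for m n
    proof -
      have "e m \<le> e N" "e n \<le> e N"
        using that by (auto simp: e_def intro: le_imp_inverse_le)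
      then have "(e m + e n) * sv (space M) \<le> (e N + e N) * sv (space M)"
        using sv_nonneg by (intro mult_right_mono) auto
      then show ?thesis
        using tri[OF s(1) less_imp_le[OF e] s(2), of m n] N by (simp add: dist_norm)
    qed
    then show "\<exists>M'. \<forall>m\<ge>M'. \<forall>n\<ge>M'. dist (S_integral M \<mu> (s m)) (S_integral M \<mu> (s n)) < \<epsilon>" by blast
  qed
  then obtain I where I: "(\<lambda>n. S_integral M \<mu> (s n)) \<longlonglongrightarrow> I"
    using Cauchy_convergent_iff convergent_def by blast
  have "norm (I - S_integral M \<mu> g) \<le> C * sv (space M)"
    if "g \<in> S_fun M" "0 \<le> C" "\<forall>z\<in>space M. norm (f z - g z) \<le> C" for g C
  proof (rule LIMSEQ_le)
    show "(\<lambda>n. norm (S_integral M \<mu> (s n) - S_integral M \<mu> g)) \<longlonglongrightarrow> norm (I - S_integral M \<mu> g)"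
      by (intro tendsto_intros I)
    have "(\<lambda>n. (e n + C) * sv (space M)) \<longlonglongrightarrow> (0 + C) * sv (space M)"
      by (intro tendsto_intros e_lim)
    then show "(\<lambda>n. (e n + C) * sv (space M)) \<longlonglongrightarrow> C * sv (space M)" by simp
  qed (use tri[OF that] in blast)
  then have "\<exists>I. \<forall>g\<in>S_fun M. \<forall>C\<ge>0. (\<forall>z\<in>space M. norm (f z - g z) \<le> C) \<longrightarrow>
    norm (I - S_integral M \<mu> g) \<le> C * sv (space M)" by blast
  then have "\<forall>g\<in>S_fun M. \<forall>C\<ge>0. (\<forall>z\<in>space M. norm (f z - g z) \<le> C) \<longrightarrow>
    norm (Int_limit f - S_integral M \<mu> g) \<le> C * sv (space M)"
    unfolding Int_limit_def by (rule someI_ex)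
  then show ?thesis using assms(2-4) by blast
qed

lemma Int_limit_Lipschitz:
  assumes f: "f \<in> M_fun sE M" "g \<in> M_fun sE M" and "0 \<le> C" "\<And>z. z \<in> space M \<Longrightarrow> norm (f z - g z) \<le> C"
  shows "norm (Int_limit f - Int_limit g) \<le> C * sv (space M)"
proof (rule le_if_le_add_small_mult)
  fix \<epsilon> :: real assume e: "0 < \<epsilon>"
  obtain s where s: "s \<in> S_fun M" "\<forall>z\<in>space M. norm (g z - s z) \<le> \<epsilon>"
    using S_fun_dense[OF sE f(2) e] by blast
  have "norm (f z - s z) \<le> C + \<epsilon>" if "z \<in> space M" for z
    using norm_triangle_ineq[of "f z - g z" "g z - s z"] assms(4)[OF that] s(2) that by force
  then have "norm (Int_limit f - S_integral M \<mu> s) \<le> (C + \<epsilon>) * sv (space M)"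
    using assms(3) e by (intro Int_limit_close[OF f(1) s(1)]) auto
  moreover have "norm (Int_limit g - S_integral M \<mu> s) \<le> \<epsilon> * sv (space M)"
    using e s(2) by (intro Int_limit_close[OF f(2) s(1)]) auto
  ultimately show "norm (Int_limit f - Int_limit g) \<le> C * sv (space M) + \<epsilon> * (2 * sv (space M))"
    using norm_triangle_ineq4[of "Int_limit f - S_integral M \<mu> s" "Int_limit g - S_integral M \<mu> s"]
    by (simp add: algebra_simps)
qed

lemma Int_limit_S_fun:
  assumes "f \<in> S_fun M"
  shows "Int_limit f = S_integral M \<mu> f"
  using Int_limit_close[of f f 0] assms S_fun_subset_M_fun[of M sE] by auto

text \<open>Discharges the \<open>THE\<close> in \<open>i_integral\<close>: Lipschitz continuity
  gives existence, density of \<open>S_fun M\<close> gives uniqueness. It opens the way from the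
  integral to the estimates on \<open>Int_limit\<close>.\<close>

lemma i_integral_eq_Int_limit:
  "i_integral sE M \<mu> = restrict Int_limit (M_fun sE M)"
  unfolding i_integral_def
proof (rule the_equality)
  have "(\<lambda>n. Int_limit (s n)) \<longlonglongrightarrow> Int_limit f"
    if f: "f \<in> M_fun sE M" and s: "range s \<subseteq> M_fun sE M" and lim: "uniform_limit (space M) s f sequentially" for f s
  proof (rule metric_LIMSEQ_I)
    fix \<epsilon> :: real assume "0 < \<epsilon>"
    define \<delta> where "\<delta> = \<epsilon> / (sv (space M) + 1)"
    have pos: "0 < sv (space M) + 1" using sv_nonneg[of "space M"] by linarith
    have \<delta>: "0 < \<delta>" using pos \<open>0 < \<epsilon>\<close> by (simp add: \<delta>_def)
    obtain N where N: "\<And>n z. N \<le> n \<Longrightarrow> z \<in> space M \<Longrightarrow> dist (s n z) (f z) < \<delta>"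
      using lim \<delta> unfolding uniform_limit_sequentially_iff by meson
    have "dist (Int_limit (s n)) (Int_limit f) < \<epsilon>" if "N \<le> n" for n
    proof -
      have "norm (Int_limit (s n) - Int_limit f) \<le> \<delta> * sv (space M)"
        using N[OF that] s \<delta> by (intro Int_limit_Lipschitz f) (auto simp: dist_norm intro: less_imp_le)
      also have "\<dots> < \<delta> * (sv (space M) + 1)" using \<delta> by simp
      also have "\<dots> = \<epsilon>" using pos by (simp add: \<delta>_def)
      finally show ?thesis by (simp add: dist_norm)
    qed
    then show "\<exists>N. \<forall>n\<ge>N. dist (Int_limit (s n)) (Int_limit f) < \<epsilon>" by blast
  qed
  then show "restrict Int_limit (M_fun sE M) \<in> extensional (M_fun sE M) \<and>
      (\<forall>f\<in>S_fun M. restrict Int_limit (M_fun sE M) f = S_integral M \<mu> f) \<and>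
      (\<forall>f\<in>M_fun sE M. \<forall>s. range s \<subseteq> M_fun sE M \<longrightarrow> uniform_limit (space M) s f sequentially \<longrightarrow>
        (\<lambda>n. restrict Int_limit (M_fun sE M) (s n)) \<longlonglongrightarrow> restrict Int_limit (M_fun sE M) f)"
    using S_fun_subset_M_fun[of M sE] Int_limit_S_fun by (auto simp: image_subset_iff subset_iff)
  fix I
  assume I: "I \<in> extensional (M_fun sE M) \<and> (\<forall>f\<in>S_fun M. I f = S_integral M \<mu> f) \<and>
      (\<forall>f\<in>M_fun sE M. \<forall>s. range s \<subseteq> M_fun sE M \<longrightarrow>
        uniform_limit (space M) s f sequentially \<longrightarrow> (\<lambda>n. I (s n)) \<longlonglongrightarrow> I f)"
  show "I = restrict Int_limit (M_fun sE M)"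
  proof (rule extensionalityI)
    fix f assume f: "f \<in> M_fun sE M"
    define e where "e n = inverse (real (Suc n))" for n
    have e: "0 < e n" for n by (simp add: e_def)
    have e_lim: "e \<longlonglongrightarrow> 0" unfolding e_def by (rule LIMSEQ_inverse_real_of_nat)
    have "\<exists>g\<in>S_fun M. \<forall>z\<in>space M. norm (f z - g z) \<le> e n" for n
      by (rule S_fun_dense[OF sE f e])
    then obtain s where s: "\<And>n. s n \<in> S_fun M" "\<And>n. \<forall>z\<in>space M. norm (f z - s n z) \<le> e n" by metis
    have "uniform_limit (space M) s f sequentially"
    proof (rule uniform_limitI)
      fix \<epsilon> :: real assume "0 < \<epsilon>"
      then have "\<forall>\<^sub>F n in sequentially. e n < \<epsilon>"
        using e_lim by (intro order_tendstoD(2))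
      then show "\<forall>\<^sub>F n in sequentially. \<forall>x\<in>space M. dist (s n x) (f x) < \<epsilon>"
      proof (rule eventually_mono)
        fix n assume "e n < \<epsilon>"
        then show "\<forall>x\<in>space M. dist (s n x) (f x) < \<epsilon>"
          using s(2)[of n] by (force simp: dist_norm norm_minus_commute)
      qed
    qed
    moreover have "range s \<subseteq> M_fun sE M" using s(1) S_fun_subset_M_fun[of M sE] by auto
    ultimately have "(\<lambda>n. I (s n)) \<longlonglongrightarrow> I f" using I f by simp
    then have "(\<lambda>n. S_integral M \<mu> (s n)) \<longlonglongrightarrow> I f" using I s(1) by simp
    moreover have "(\<lambda>n. S_integral M \<mu> (s n)) \<longlonglongrightarrow> Int_limit f"
    proof (rule Lim_null_comparison[THEN LIM_zero_cancel])
      show "\<forall>\<^sub>F n in sequentially. norm (S_integral M \<mu> (s n) - Int_limit f) \<le> e n * sv (space M)"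
        using Int_limit_close[OF f s(1) less_imp_le[OF e]] s(2)
        by (intro always_eventually allI) (subst norm_minus_commute, blast)
      have "(\<lambda>n. e n * sv (space M)) \<longlonglongrightarrow> 0 * sv (space M)"
        by (intro tendsto_intros e_lim)
      then show "(\<lambda>n. e n * sv (space M)) \<longlonglongrightarrow> 0" by simp
    qed
    ultimately have "I f = Int_limit f" by (rule LIMSEQ_unique)
    then show "I f = restrict Int_limit (M_fun sE M) f" using f by simp
  qed (use I in auto)
qed

section \<open>Linearity and bounds of the integral\<close>

lemma i_integral_close:
  assumes "f \<in> M_fun sE M" "g \<in> S_fun M" "0 \<le> C" "\<And>z. z \<in> space M \<Longrightarrow> norm (f z - g z) \<le> C"
  shows "norm (i_integral sE M \<mu> f - S_integral M \<mu> g) \<le> C * sv (space M)"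
  using Int_limit_close[OF assms] assms(1) by (simp add: i_integral_eq_Int_limit)

lemma i_integral_add:
  assumes f: "f \<in> M_fun sE M" and g: "g \<in> M_fun sE M" and fg: "(\<lambda>z. f z + g z) \<in> M_fun sE M"
  shows "i_integral sE M \<mu> (\<lambda>z. f z + g z) = i_integral sE M \<mu> f + i_integral sE M \<mu> g"
proof -
  let ?I = "i_integral sE M \<mu>" and ?S = "S_integral M \<mu>"
  have "norm (?I (\<lambda>z. f z + g z) - (?I f + ?I g)) \<le> 0"
  proof (rule le_if_le_add_small_mult)
    fix \<epsilon> :: real assume e: "0 < \<epsilon>"
    obtain s where s: "s \<in> S_fun M" "\<forall>z\<in>space M. norm (f z - s z) \<le> \<epsilon>"
      using S_fun_dense[OF sE f e] by blast
    obtain t where t: "t \<in> S_fun M" "\<forall>z\<in>space M. norm (g z - t z) \<le> \<epsilon>"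
      using S_fun_dense[OF sE g e] by blast
    have 1: "norm (?I f - ?S s) \<le> \<epsilon> * sv (space M)"
      using s e by (intro i_integral_close[OF f]) auto
    have 2: "norm (?I g - ?S t) \<le> \<epsilon> * sv (space M)"
      using t e by (intro i_integral_close[OF g]) auto
    have "norm (f z + g z - (s z + t z)) \<le> \<epsilon> + \<epsilon>" if "z \<in> space M" for z
      unfolding add_diff_add using s(2) t(2) that by (intro norm_triangle_mono) auto
    then have 3: "norm (?I (\<lambda>z. f z + g z) - (?S s + ?S t)) \<le> (\<epsilon> + \<epsilon>) * sv (space M)"
      unfolding S_integral_add(1)[OF s(1) t(1), symmetric]
      using e by (intro i_integral_close[OF fg S_integral_add(2)[OF s(1) t(1)]]) auto
    have "?I (\<lambda>z. f z + g z) - (?I f + ?I g) =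
      (?I (\<lambda>z. f z + g z) - (?S s + ?S t)) - ((?I f - ?S s) + (?I g - ?S t))" by simp
    then have "norm (?I (\<lambda>z. f z + g z) - (?I f + ?I g)) \<le>
      norm (?I (\<lambda>z. f z + g z) - (?S s + ?S t)) + norm ((?I f - ?S s) + (?I g - ?S t))"
      by (simp only: norm_triangle_ineq4)
    also have "\<dots> \<le> (\<epsilon> + \<epsilon>) * sv (space M) + (\<epsilon> * sv (space M) + \<epsilon> * sv (space M))"
      by (intro add_mono 3 norm_triangle_mono 1 2)
    finally show "norm (?I (\<lambda>z. f z + g z) - (?I f + ?I g)) \<le> 0 + \<epsilon> * (4 * sv (space M))"
      by (simp add: algebra_simps)
  qed
  then show ?thesis by simp
qed

lemma i_integral_scale:
  assumes f: "f \<in> M_fun sE M" and cf: "(\<lambda>z. sE c (f z)) \<in> M_fun sE M"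
  shows "i_integral sE M \<mu> (\<lambda>z. sE c (f z)) = sF c (i_integral sE M \<mu> f)"
proof -
  interpret E: normed_over sE by (rule sE)
  interpret F: normed_over sF by (rule sF)
  let ?I = "i_integral sE M \<mu>" and ?S = "S_integral M \<mu>"
  have "norm (?I (\<lambda>z. sE c (f z)) - sF c (?I f)) \<le> 0"
  proof (rule le_if_le_add_small_mult)
    fix \<epsilon> :: real assume e: "0 < \<epsilon>"
    obtain s where s: "s \<in> S_fun M" "\<forall>z\<in>space M. norm (f z - s z) \<le> \<epsilon>"
      using S_fun_dense[OF sE f e] by blast
    have "norm (?I f - ?S s) \<le> \<epsilon> * sv (space M)"
      using s e by (intro i_integral_close[OF f]) auto
    then have 1: "norm (sF c (?S s) - sF c (?I f)) \<le> norm c * (\<epsilon> * sv (space M))"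
      unfolding F.scale_right_diff_distrib[symmetric] F.norm_scale
      by (subst norm_minus_commute) (intro mult_left_mono, auto)
    have "norm (sE c (f z) - sE c (s z)) \<le> norm c * \<epsilon>" if "z \<in> space M" for z
      unfolding E.scale_right_diff_distrib[symmetric] E.norm_scale
      using s(2) that by (intro mult_left_mono) auto
    then have 2: "norm (?I (\<lambda>z. sE c (f z)) - sF c (?S s)) \<le> (norm c * \<epsilon>) * sv (space M)"
      unfolding S_integral_scale(1)[OF s(1), symmetric]
      using e by (intro i_integral_close[OF cf S_integral_scale(2)[OF s(1)]]) auto
    have "norm (?I (\<lambda>z. sE c (f z)) - sF c (?I f)) \<le>
      norm (?I (\<lambda>z. sE c (f z)) - sF c (?S s)) + norm (sF c (?S s) - sF c (?I f))"
      using norm_triangle_ineq[of "?I (\<lambda>z. sE c (f z)) - sF c (?S s)" "sF c (?S s) - sF c (?I f)"] by simp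
    then show "norm (?I (\<lambda>z. sE c (f z)) - sF c (?I f)) \<le> 0 + \<epsilon> * (2 * norm c * sv (space M))"
      using 1 2 by (simp add: algebra_simps)
  qed
  then show ?thesis by simp
qed

text \<open>The approximant is multiplied by the indicator of \<open>A\<close>, so that
  \<open>sv A\<close> bounds its integral and \<open>sv (space M)\<close> enters only with the
  factor \<open>\<epsilon>\<close>.\<close>

lemma norm_i_integral_le:
  assumes f: "f \<in> M_fun sE M" and "A \<in> sets M" "0 \<le> C" "\<And>z. z \<in> space M \<Longrightarrow> norm (f z) \<le> C"
    "\<And>z. z \<in> space M \<Longrightarrow> z \<notin> A \<Longrightarrow> f z = 0"
  shows "norm (i_integral sE M \<mu> f) \<le> C * sv A"
proof (rule le_if_le_add_small_mult)
  fix \<epsilon> :: real assume e: "0 < \<epsilon>"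
  obtain s where s: "s \<in> S_fun M" "\<forall>z\<in>space M. norm (f z - s z) \<le> \<epsilon>"
    using S_fun_dense[OF sE f e] by blast
  define t where "t z = indicator A z *\<^sub>R s z" for z
  have t: "t \<in> S_fun M"
    unfolding t_def by (rule S_fun_indicator[OF s(1) assms(2)])
  have close: "norm (f z - t z) \<le> \<epsilon>" if "z \<in> space M" for z
    using s(2) that assms(5)[OF that] e by (cases "z \<in> A") (auto simp: t_def)
  have 1: "norm (i_integral sE M \<mu> f - S_integral M \<mu> t) \<le> \<epsilon> * sv (space M)"
    using e close by (intro i_integral_close[OF f t]) auto
  have "norm (t z) \<le> C + \<epsilon>" if "z \<in> space M" for z
    using norm_triangle_ineq2[of "t z" "f z"] close[OF that] assms(4)[OF that]
    by (simp add: norm_minus_commute)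
  then have 2: "norm (S_integral M \<mu> t) \<le> (C + \<epsilon>) * sv A"
    using assms(3) e by (intro norm_S_integral_le[OF t]) (auto simp: t_def)
  show "norm (i_integral sE M \<mu> f) \<le> C * sv A + \<epsilon> * (sv (space M) + sv A)"
    using norm_triangle_ineq[of "i_integral sE M \<mu> f - S_integral M \<mu> t" "S_integral M \<mu> t"] 1 2
    by (simp add: algebra_simps)
qed

end

section \<open>Representation of operators by regular measures\<close>

text \<open>Values off the compact superlevel set \<open>K\<close> are within
  \<open>\<epsilon> / 2\<close> of zero, so any one of them serves for all. The value at
  \<open>z0\<close> is taken instead of zero to keep the net inside the range.\<close>

lemma totally_bounded_range_c0:
  fixes f :: "('z::t2_space, 'e::real_normed_vector) c0fun"
  assumes "0 < \<epsilon>"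
  shows "\<exists>F. finite F \<and> F \<subseteq> range (apply_c0 f) \<and> (\<forall>z. \<exists>y\<in>F. dist y (apply_c0 f z) < \<epsilon>)"
proof -
  define K where "K = {z. \<epsilon> / 2 \<le> norm (apply_c0 f z)}"
  have "compact K"
    unfolding K_def using assms by (intro compact_superlevel_c0) simp
  then have "compact (apply_c0 f ` K)"
    by (intro compact_continuous_image continuous_on_subset[OF continuous_apply_c0]) auto
  then obtain C where C: "C \<subseteq> apply_c0 f ` K" "finite C" "apply_c0 f ` K \<subseteq> (\<Union>c\<in>C. ball c \<epsilon>)"
    by (rule compactE_image[where C="apply_c0 f ` K" and f="\<lambda>c. ball c \<epsilon>"]) (use assms in auto)
  have CK: "\<exists>y\<in>C. dist y (apply_c0 f z) < \<epsilon>" if "z \<in> K" for z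
  proof -
    have "apply_c0 f z \<in> (\<Union>c\<in>C. ball c \<epsilon>)" using C(3) that by blast
    then show ?thesis by simp
  qed
  show ?thesis
  proof (cases "K = UNIV")
    case True
    then show ?thesis using C CK by (intro exI[of _ C]) auto
  next
    case False
    then obtain z0 where z0: "z0 \<notin> K" by blast
    have "\<exists>y\<in>insert (apply_c0 f z0) C. dist y (apply_c0 f z) < \<epsilon>" for z
    proof (cases "z \<in> K")
      case True
      then show ?thesis using CK by blast
    next
      case False
      then have "dist (apply_c0 f z0) (apply_c0 f z) < \<epsilon> / 2 + \<epsilon> / 2"
        using z0 norm_triangle_ineq4[of "apply_c0 f z0" "apply_c0 f z"]
        by (simp add: K_def dist_norm not_le)
      then show ?thesis by simp
    qed
    then show ?thesis
      using C(1,2) by (intro exI[of _ "insert (apply_c0 f z0) C"]) auto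
  qed
qed

text \<open>\<open>S_fun_dense\<close> provides only countably many values, whereas
  \<open>rep_sum\<close> handles finite sums; total boundedness of the range supplies finitely many
  values.\<close>

lemma c0_simple_approximation:
  fixes f :: "('z::t2_space, 'e::banach) c0fun"
  assumes "0 < \<epsilon>"
  shows "\<exists>s. finite (range s) \<and> (\<forall>e. s -` {e} \<in> sets borel) \<and> (\<forall>z. norm (apply_c0 f z - s z) \<le> \<epsilon>)"
proof -
  obtain F where F: "finite F" "F \<subseteq> range (apply_c0 f)" "\<forall>z. \<exists>y\<in>F. dist y (apply_c0 f z) < \<epsilon>"
    using totally_bounded_range_c0[OF assms, of f] by (elim exE conjE)
  then have ne: "F \<noteq> {}" by auto
  define x where "x = from_nat_into F"
  have x: "range x = F"
    unfolding x_def by (rule range_from_nat_into[OF ne countable_finite[OF F(1)]])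
  define B where "B n = {z. dist (x n) (apply_c0 f z) < \<epsilon>}" for n
  have "open (B n)" for n
    unfolding B_def by (intro open_Collect_less continuous_intros continuous_apply_c0)
  then have B: "B n \<in> sets borel" for n by (rule borel_open)
  have ex: "\<exists>n. z \<in> B n" for z
    using F(3) x unfolding B_def by (metis mem_Collect_eq rangeE)
  define q where "q z = (LEAST n. z \<in> B n)" for z
  have qB: "z \<in> B (q z)" for z
    unfolding q_def using ex by (rule LeastI_ex)
  have q_eq: "q -` {n} = B n - (\<Union>m<n. B m)" for n
  proof (intro equalityI subsetI)
    fix z assume z: "z \<in> q -` {n}"
    then have "z \<in> B n" using qB by auto
    moreover have "z \<notin> B m" if "m < n" for m
      using z that not_less_Least[of m "\<lambda>n. z \<in> B n"] by (auto simp: q_def)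
    ultimately show "z \<in> B n - (\<Union>m<n. B m)" by auto
  next
    fix z assume z: "z \<in> B n - (\<Union>m<n. B m)"
    then have "q z = n"
      unfolding q_def by (intro Least_equality) (auto simp: not_less[symmetric])
    then show "z \<in> q -` {n}" by simp
  qed
  have "q -` A \<inter> space borel \<in> sets borel" for A
    by (rule countable_fibres_sets) (use B in \<open>auto simp: q_eq intro: countableI_type\<close>)
  then have qA: "q -` A \<in> sets borel" for A by simp
  have "(\<lambda>z. x (q z)) -` {e} \<in> sets borel" for e
  proof -
    have "(\<lambda>z. x (q z)) -` {e} = q -` (x -` {e})" by auto
    then show ?thesis using qA by simp
  qed
  moreover have "finite (range (\<lambda>z. x (q z)))"
    using x F(1) by (intro finite_subset[of "range (\<lambda>z. x (q z))" F]) auto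
  moreover have "norm (apply_c0 f z - x (q z)) \<le> \<epsilon>" for z
    using qB[of z] by (simp add: B_def dist_norm norm_minus_commute)
  ultimately show ?thesis by (intro exI[of _ "\<lambda>z. x (q z)"] conjI allI)
qed

text \<open>Separability of the range: the finite nets of radius
  \<open>inverse (real (Suc n))\<close> together form a countable dense subset.\<close>

lemma apply_c0_in_M_fun:
  fixes sE :: "'k::real_or_complex \<Rightarrow> 'e::banach \<Rightarrow> 'e" and f :: "('z::t2_space, 'e) c0fun"
  shows "apply_c0 f \<in> M_fun sE borel"
  unfolding M_fun_def mem_Collect_eq
proof (intro conjI ballI)
  show "bounded (apply_c0 f ` space borel)"
    using norm_c0_le[of f] by (intro boundedI[where B="norm f"]) auto
  have "\<exists>F. finite F \<and> F \<subseteq> range (apply_c0 f) \<and>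
      (\<forall>z. \<exists>y\<in>F. dist y (apply_c0 f z) < inverse (real (Suc n)))" for n
    by (rule totally_bounded_range_c0) simp
  then obtain F where F: "\<And>n. finite (F n)" "\<And>n. F n \<subseteq> range (apply_c0 f)"
    "\<And>n z. \<exists>y\<in>F n. dist y (apply_c0 f z) < inverse (real (Suc n))"
    by metis
  define D where "D = (\<Union>n. F n)"
  have D: "countable D" "D \<subseteq> range (apply_c0 f)"
    using F(1,2) by (auto simp: D_def intro: countable_finite)
  have "range (apply_c0 f) \<subseteq> closure D"
  proof (rule subsetI, unfold closure_approachable, intro allI impI)
    fix y and e :: real assume "y \<in> range (apply_c0 f)" "0 < e"
    then obtain z where z: "y = apply_c0 f z" by blast
    obtain n where n: "inverse (real (Suc n)) < e"
      using reals_Archimedean[OF \<open>0 < e\<close>] by blast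
    obtain y' where "y' \<in> F n" "dist y' (apply_c0 f z) < inverse (real (Suc n))"
      using F(3)[of n z] by blast
    then show "\<exists>y'\<in>D. dist y' y < e"
      using n z by (intro bexI[of _ y']) (auto simp: D_def)
  qed
  then show "separable_space (top_of_set (apply_c0 f ` space borel))"
    unfolding separable_space_def using D
    by (intro exI[of _ D]) (auto simp: closure_of_subtopology Int_absorb1)
  fix \<psi> :: "'e \<Rightarrow>\<^sub>L 'k"
  show "(\<lambda>z. \<psi> (apply_c0 f z)) \<in> borel_measurable borel"
    by (intro borel_measurable_continuous_onI continuous_intros continuous_apply_c0)
qed

context vector_i_measure
begin

lemma S_integral_indicator:
  assumes A: "A \<in> sets M"
  shows "S_integral M \<mu> (\<lambda>z. indicator A z *\<^sub>R x) = \<mu> A x"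
    and "(\<lambda>z. indicator A z *\<^sub>R x) \<in> S_fun M"
proof -
  define h :: "bool \<Rightarrow> 'e" where "h b = (if b then x else 0)" for b
  have hq: "(\<lambda>z. h (z \<in> A)) = (\<lambda>z. indicator A z *\<^sub>R x)"
    by (auto simp: h_def indicator_def)
  have fib: "(\<lambda>z. z \<in> A) -` {b} \<inter> space M = (if b then A else space M - A)" for b
    using sets.sets_into_space[OF A] by auto
  have meas: "(\<lambda>z. z \<in> A) -` {b} \<inter> space M \<in> sets M" for b
    using A by (simp add: fib)
  have hb: "norm (h b) \<le> norm x" for b by (simp add: h_def)
  have "(\<lambda>z. h (z \<in> A)) \<in> S_fun M"
    by (rule S_fun_compose[where q="\<lambda>z. z \<in> A" and h=h, OF _ meas hb]) (rule countableI_type)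
  then show "(\<lambda>z. indicator A z *\<^sub>R x) \<in> S_fun M" by (simp only: hq)
  have "((\<lambda>b. \<mu> ((\<lambda>z. z \<in> A) -` {b} \<inter> space M) (h b)) has_sum S_integral M \<mu> (\<lambda>z. h (z \<in> A)))
      ((\<lambda>z. z \<in> A) ` space M)"
    by (rule S_integral_compose[where q="\<lambda>z. z \<in> A" and h=h, OF _ meas hb]) (rule countableI_type)
  then have "((\<lambda>b. \<mu> (if b then A else space M - A) (h b)) has_sum S_integral M \<mu> (\<lambda>z. h (z \<in> A)))
      ((\<lambda>z. z \<in> A) ` space M)" by (simp only: fib)
  \<comment> \<open>Only the value \<open>True\<close> contributes. If it is not attained, then
    \<open>A\<close> is empty and its term vanishes, so summing over \<open>{True}\<close> is
    correct in every case.\<close>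
  then have "((\<lambda>b. \<mu> (if b then A else space M - A) (h b)) has_sum S_integral M \<mu> (\<lambda>z. h (z \<in> A))) {True}"
  proof (rule has_sum_cong_neutral[THEN iffD1, rotated 3])
    fix b assume "b \<in> {True} - (\<lambda>z. z \<in> A) ` space M"
    then have "A = {}" "b" using sets.sets_into_space[OF A] by auto
    then show "\<mu> (if b then A else space M - A) (h b) = 0" by (simp add: blinfun.zero_left)
  next
    fix b assume "b \<in> (\<lambda>z. z \<in> A) ` space M - {True}"
    then have "h b = 0" by (auto simp: h_def)
    then show "\<mu> (if b then A else space M - A) (h b) = 0" by (simp add: blinfun.zero_right)
  qed simp
  then have "S_integral M \<mu> (\<lambda>z. h (z \<in> A)) = \<mu> A (h True)"
    by (simp add: has_sum_finite_iff)
  then show "S_integral M \<mu> (\<lambda>z. indicator A z *\<^sub>R x) = \<mu> A x"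
    unfolding hq by (simp add: h_def)
qed

lemma S_integral_sum_indicator:
  assumes "finite I" "\<And>i. i \<in> I \<Longrightarrow> A i \<in> sets M"
  shows "S_integral M \<mu> (\<lambda>z. \<Sum>i\<in>I. indicator (A i) z *\<^sub>R x i) = (\<Sum>i\<in>I. \<mu> (A i) (x i)) \<and>
    (\<lambda>z. \<Sum>i\<in>I. indicator (A i) z *\<^sub>R x i) \<in> S_fun M"
  using assms
proof (induction I rule: finite_induct)
  case empty
  show ?case
    using S_integral_indicator[of "{}" 0] by (simp add: blinfun.zero_right)
next
  case (insert i I)
  have Ai: "A i \<in> sets M" using insert.prems by simp
  have IH: "S_integral M \<mu> (\<lambda>z. \<Sum>i\<in>I. indicator (A i) z *\<^sub>R x i) = (\<Sum>i\<in>I. \<mu> (A i) (x i)) \<and>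
    (\<lambda>z. \<Sum>i\<in>I. indicator (A i) z *\<^sub>R x i) \<in> S_fun M"
    by (rule insert.IH) (use insert.prems in simp)
  note ind = S_integral_indicator[OF Ai, of "x i"]
  show ?case
    unfolding sum.insert[OF insert(1,2)]
    using S_integral_add[OF ind(2) IH[THEN conjunct2]] ind(1) IH[THEN conjunct1] by simp
qed

end

section \<open>Regular measures and the equality of norms\<close>

locale regular_vector_measure = vector_i_measure sE sF borel \<mu>
  for sE :: "'k::real_or_complex \<Rightarrow> 'e::banach \<Rightarrow> 'e" and sF :: "'k \<Rightarrow> 'f::banach \<Rightarrow> 'f"
    and \<mu> :: "'z::t2_space set \<Rightarrow> 'e \<Rightarrow>\<^sub>L 'f" +
  assumes lc: "locally_compact_space (euclidean :: 'z topology)"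
    and regular: "regular_i_measure sE sF \<mu>"
begin

abbreviation integ :: "('z \<Rightarrow> 'e) \<Rightarrow> 'f"
  where "integ \<equiv> i_integral sE borel \<mu>"

text \<open>Regularity gives a \<sigma>-compact subset that carries everything; finite unions of its
  compact pieces exhaust it, and continuity at the empty set makes what they miss small.\<close>

lemma compact_inner:
  assumes A: "A \<in> sets borel" and e: "0 < \<epsilon>"
  shows "\<exists>K. compact K \<and> K \<subseteq> A \<and> sv (A - K) \<le> \<epsilon>"
proof -
  have "\<exists>C :: nat \<Rightarrow> 'z set. (\<forall>n. compact (C n)) \<and> (\<Union>n. C n) \<subseteq> A \<and>
      (\<forall>B\<in>sets borel. B \<subseteq> A - (\<Union>n. C n) \<longrightarrow> \<mu> B = 0)"
    using regular A unfolding regular_i_measure_def by blast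
  then obtain C :: "nat \<Rightarrow> 'z set" where C: "\<forall>n. compact (C n)" "(\<Union>n. C n) \<subseteq> A"
      "\<forall>B\<in>sets borel. B \<subseteq> A - (\<Union>n. C n) \<longrightarrow> \<mu> B = 0"
    by (elim exE conjE)
  define K where "K n = (\<Union>i\<le>n. C i)" for n
  have K: "compact (K n)" for n
    unfolding K_def using C(1) by (intro compact_UN) auto
  have Kb: "K n \<in> sets borel" for n
    by (rule borel_closed[OF compact_imp_closed[OF K]])
  have Cb: "C n \<in> sets borel" for n
    using C(1) by (intro borel_closed compact_imp_closed) simp
  then have UC: "(\<Union>n. C n) \<in> sets borel" by (intro sets.countable_UN) auto
  have "\<exists>N. sv ((\<Union>n. C n) - K N) \<le> \<epsilon>"
  proof (rule sv_decreasing)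
    show "(\<Union>n. C n) - K n \<in> sets borel" for n using UC Kb by (rule sets.Diff)
    have "K m \<subseteq> K n" if "m \<le> n" for m n
      unfolding K_def using that by (intro UN_mono) auto
    then show "decseq (\<lambda>n. (\<Union>n. C n) - K n)"
      unfolding decseq_def by blast
    show "(\<Inter>n. (\<Union>n. C n) - K n) = {}"
    proof (rule equals0I)
      fix z assume z: "z \<in> (\<Inter>n. (\<Union>n. C n) - K n)"
      then obtain n where "z \<in> C n" by blast
      then have "z \<in> K n" by (auto simp: K_def)
      then show False using z by blast
    qed
  qed fact
  then obtain N where N: "sv ((\<Union>n. C n) - K N) \<le> \<epsilon>" ..
  have null: "sv (A - (\<Union>n. C n)) \<le> 0"
  proof (rule sv_least)
    fix c assume c: "c \<in> sv_set (A - (\<Union>n. C n))"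
    obtain M :: nat and B x where B: "c = norm (\<Sum>n<M. \<mu> (B n) (x n))"
      "\<forall>n<M. B n \<in> sets borel" "\<forall>n<M. B n \<subseteq> A - (\<Union>n. C n)"
      using sv_setD[OF c] by (elim exE conjE)
    have "\<mu> (B n) (x n) = 0" if "n < M" for n
    proof -
      have "\<mu> (B n) = 0" using B(2,3) C(3) that by simp
      then show ?thesis by (simp add: blinfun.zero_left)
    qed
    then show "c \<le> 0" unfolding B(1) by simp
  qed
  have KC: "K N \<subseteq> (\<Union>n. C n)" by (auto simp: K_def)
  have "A - K N = ((\<Union>n. C n) - K N) \<union> (A - (\<Union>n. C n))"
    using C(2) KC by blast
  then have "sv (A - K N) \<le> sv ((\<Union>n. C n) - K N) + sv (A - (\<Union>n. C n))"
    using sv_Un[of "(\<Union>n. C n) - K N" "A - (\<Union>n. C n)"] A UC Kb by simp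
  then have "sv (A - K N) \<le> \<epsilon>" using N null by linarith
  then show ?thesis using K KC C(2) by (intro exI[of _ "K N"] conjI) auto
qed

lemma open_outer:
  assumes A: "A \<in> sets borel" and e: "0 < \<epsilon>"
  shows "\<exists>U. open U \<and> A \<subseteq> U \<and> sv (U - A) \<le> \<epsilon>"
proof -
  have Ac: "UNIV - A \<in> sets borel" using A sets.compl_sets[of A borel] by simp
  obtain L where L: "compact L" "L \<subseteq> UNIV - A" "sv ((UNIV - A) - L) \<le> \<epsilon>"
    using compact_inner[OF Ac e] by (elim exE conjE)
  have "(UNIV - L) - A = (UNIV - A) - L" by blast
  then show ?thesis
    using L by (intro exI[of _ "UNIV - L"] conjI open_Diff) (auto intro: compact_imp_closed)
qed

text \<open>Each bump vanishes on the other compact sets, so there the bumps do not interfere.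
  Elsewhere they may add up; \<open>radial 1\<close> brings the sum back into the unit ball without
  changing its values on the \<open>K n\<close>.\<close>

lemma disjoint_compacts_function:
  fixes K :: "nat \<Rightarrow> 'z set" and x :: "nat \<Rightarrow> 'e"
  assumes K: "\<And>n. n < N \<Longrightarrow> compact (K n)" "disjoint_family_on K {..<N}"
    and U: "open U" "\<And>n. n < N \<Longrightarrow> K n \<subseteq> U" and x: "\<And>n. n < N \<Longrightarrow> norm (x n) \<le> 1"
  shows "\<exists>h :: ('z, 'e) c0fun. norm h \<le> 1 \<and> (\<forall>z. z \<notin> U \<longrightarrow> apply_c0 h z = 0) \<and>
    (\<forall>n<N. \<forall>z\<in>K n. apply_c0 h z = x n)"
proof -
  define V where "V n = U - (\<Union>m\<in>{..<N} - {n}. K m)" for n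
  have V: "open (V n)" for n
    unfolding V_def using U(1) K(1) by (intro open_Diff closed_UN) (auto intro: compact_imp_closed)
  have KV: "K n \<subseteq> V n" if "n < N" for n
  proof -
    have "K n \<inter> K m = {}" if "m \<in> {..<N} - {n}" for m
      using disjoint_family_onD[OF K(2), of n m] \<open>n < N\<close> that by auto
    then show ?thesis unfolding V_def using U(2)[OF that] by blast
  qed
  have "\<exists>g :: ('z, 'e) c0fun. (\<forall>z\<in>K n. apply_c0 g z = x n) \<and> (\<forall>z. z \<notin> V n \<longrightarrow> apply_c0 g z = 0)"
    if "n < N" for n
    using c0_bump[OF lc K(1)[OF that] V KV[OF that], where x="x n"] by metis
  then obtain g :: "nat \<Rightarrow> ('z, 'e) c0fun"
    where g: "\<And>n z. n < N \<Longrightarrow> z \<in> K n \<Longrightarrow> apply_c0 (g n) z = x n"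
      "\<And>n z. n < N \<Longrightarrow> z \<notin> V n \<Longrightarrow> apply_c0 (g n) z = 0"
    by metis
  have sum: "apply_c0 (\<Sum>n\<in>I. g n) z = (\<Sum>n\<in>I. apply_c0 (g n) z)" for I z
    by (induction I rule: infinite_finite_induct) (auto simp: zero_c0fun.rep_eq plus_c0fun.rep_eq)
  obtain h :: "('z, 'e) c0fun" where h: "\<And>z. apply_c0 h z = radial 1 (apply_c0 (\<Sum>n<N. g n) z)"
    using c0_radial[of 1 "\<Sum>n<N. g n"] by (metis zero_less_one)
  show ?thesis
  proof (intro exI[of _ h] conjI allI impI ballI)
    show "norm h \<le> 1" by (rule norm_c0_least) (simp add: h norm_radial_le)
    show "apply_c0 h z = 0" if "z \<notin> U" for z
    proof -
      have "(\<Sum>n<N. apply_c0 (g n) z) = 0"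
        using g(2) that by (intro sum.neutral) (auto simp: V_def)
      then show ?thesis by (simp add: h sum)
    qed
    show "apply_c0 h z = x n" if n: "n < N" and z: "z \<in> K n" for n z
    proof -
      have "apply_c0 (g m) z = (if m = n then x n else 0)" if "m < N" for m
      proof (cases "m = n")
        case True
        then show ?thesis using g(1)[OF n z] by simp
      next
        case False
        then have "z \<notin> V m" using n z by (auto simp: V_def)
        then show ?thesis using g(2)[OF that] False by simp
      qed
      then have "(\<Sum>m<N. apply_c0 (g m) z) = (\<Sum>m<N. if m = n then x n else 0)"
        by (intro sum.cong) auto
      also have "\<dots> = x n" using n by simp
      finally show ?thesis using x[OF n] by (simp add: h sum radial_id)
    qed
  qed
qed

text \<open>Each finite sum behind the semivariation is approximated by the integral of a continuous
  \<open>h\<close>: the \<open>B n\<close> shrink to compact \<open>K n\<close>, where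
  \<open>h\<close> takes the values \<open>x n\<close>, and an open \<open>U\<close> with small
  \<open>sv (U - KK)\<close> makes the integral outside \<open>KK\<close> negligible. The bound
  \<open>b\<close> is left general: \<open>b = norm T\<close> gives the equality of norms,
  \<open>b = 0\<close> uniqueness.\<close>

lemma sv_le_operator_norm:
  assumes b: "\<And>f :: ('z, 'e) c0fun. norm (integ (apply_c0 f)) \<le> b * norm f" and "0 \<le> b"
  shows "sv UNIV \<le> b"
proof (rule sv_least)
  fix c assume c: "c \<in> sv_set UNIV"
  obtain N :: nat and B x where B': "c = norm (\<Sum>n<N. \<mu> (B n) (x n))"
    "\<forall>n<N. B n \<in> sets borel" "\<forall>n<N. norm (x n) \<le> 1" "disjoint_family_on B {..<N}"
    using sv_setD[OF c] by (elim exE conjE)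
  note B = B'(1) B'(2-3)[rule_format] B'(4)
  show "c \<le> b"
  proof (rule le_if_le_add_small_mult)
    fix \<epsilon> :: real assume e: "0 < \<epsilon>"
    have "\<forall>n. \<exists>K. n < N \<longrightarrow> compact K \<and> K \<subseteq> B n \<and> sv (B n - K) \<le> \<epsilon>"
      using compact_inner[OF B(2) e] by blast
    then obtain K where K': "\<forall>n. n < N \<longrightarrow> compact (K n) \<and> K n \<subseteq> B n \<and> sv (B n - K n) \<le> \<epsilon>"
      by (elim choice[THEN exE])
    have K: "compact (K n)" "K n \<subseteq> B n" "sv (B n - K n) \<le> \<epsilon>" if "n < N" for n
      using K' that by auto
    have Kb: "K n \<in> sets borel" if "n < N" for n
      by (rule borel_closed[OF compact_imp_closed[OF K(1)[OF that]]])
    have disj: "disjoint_family_on K {..<N}"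
      unfolding disjoint_family_on_def
    proof (intro ballI impI)
      fix m n assume mn: "m \<in> {..<N}" "n \<in> {..<N}" "m \<noteq> n"
      then have "B m \<inter> B n = {}" by (rule disjoint_family_onD[OF B(4)])
      moreover have "K m \<subseteq> B m" "K n \<subseteq> B n" using K(2) mn by auto
      ultimately show "K m \<inter> K n = {}" by blast
    qed
    define KK where "KK = (\<Union>n<N. K n)"
    have KKb: "KK \<in> sets borel" unfolding KK_def using Kb by (intro sets.finite_UN) auto
    \<comment> \<open>The approximant \<open>t\<close> below is bounded by
      \<open>1 + \<epsilon>\<close>, so this choice keeps its integral over \<open>U - KK\<close> at
      most \<open>\<epsilon>\<close>.\<close>
    define \<delta> where "\<delta> = \<epsilon> / (1 + \<epsilon>)"
    have \<delta>: "0 < \<delta>" "(1 + \<epsilon>) * \<delta> = \<epsilon>" using e by (auto simp: \<delta>_def)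
    obtain U where U: "open U" "KK \<subseteq> U" "sv (U - KK) \<le> \<delta>"
      using open_outer[OF KKb \<delta>(1)] by (elim exE conjE)
    have Ub: "U \<in> sets borel" using U(1) by (rule borel_open)
    have KU: "K n \<subseteq> U" if "n < N" for n using U(2) that by (auto simp: KK_def)
    have "\<exists>h :: ('z, 'e) c0fun. norm h \<le> 1 \<and> (\<forall>z. z \<notin> U \<longrightarrow> apply_c0 h z = 0) \<and>
        (\<forall>n<N. \<forall>z\<in>K n. apply_c0 h z = x n)"
      by (rule disjoint_compacts_function) (use K(1) disj U(1) KU B(3) in simp_all)
    then obtain h :: "('z, 'e) c0fun" where h: "norm h \<le> 1" "\<forall>z. z \<notin> U \<longrightarrow> apply_c0 h z = 0"
      "\<forall>n<N. \<forall>z\<in>K n. apply_c0 h z = x n"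
      by (elim exE conjE)
    have hM: "apply_c0 h \<in> M_fun sE borel" by (rule apply_c0_in_M_fun)
    obtain t where t: "t \<in> S_fun borel" "\<forall>z\<in>space borel. norm (apply_c0 h z - t z) \<le> \<epsilon>"
      using S_fun_dense[OF sE hM e] by (elim bexE)
    have t': "norm (apply_c0 h z - t z) \<le> \<epsilon>" for z using t(2) by simp
    \<comment> \<open>\<open>h\<close> is compared with the sum of \<open>s\<close> and
      \<open>u\<close>: \<open>s\<close> equals \<open>h\<close> on \<open>KK\<close>,
      \<open>u\<close> is the approximant \<open>t\<close> kept on \<open>U - KK\<close>, where
      \<open>h\<close> is not prescribed, and off \<open>U\<close> all three vanish.\<close>
    define s where "s z = (\<Sum>n<N. indicator (K n) z *\<^sub>R x n)" for z
    have s: "S_integral borel \<mu> s = (\<Sum>n<N. \<mu> (K n) (x n))" "s \<in> S_fun borel"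
      using S_integral_sum_indicator[of "{..<N}" K x] Kb by (auto simp: s_def[abs_def])
    have s_in: "s z = x n" if n: "n < N" and z: "z \<in> K n" for n z
    proof -
      have "z \<in> K m \<longleftrightarrow> m = n" if "m < N" for m
        using disjoint_family_onD[OF disj, of m n] that n z by auto
      then have "s z = (\<Sum>m<N. if m = n then x n else 0)"
        unfolding s_def by (intro sum.cong) (auto simp: indicator_def)
      then show ?thesis using n by simp
    qed
    have s_out: "s z = 0" if "z \<notin> KK" for z
      unfolding s_def using that by (intro sum.neutral) (auto simp: KK_def indicator_def)
    define u where "u z = indicator (U - KK) z *\<^sub>R t z" for z
    have u: "u \<in> S_fun borel"
      unfolding u_def using Ub KKb by (intro S_fun_indicator t(1)) auto
    have tb: "norm (t z) \<le> 1 + \<epsilon>" for z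
      using norm_triangle_ineq2[of "t z" "apply_c0 h z"] t'[of z] norm_c0_le[of h z] h(1)
      by (simp add: norm_minus_commute)
    have Su: "norm (S_integral borel \<mu> u) \<le> \<epsilon>"
    proof -
      have "norm (S_integral borel \<mu> u) \<le> (1 + \<epsilon>) * sv (U - KK)"
        by (rule norm_S_integral_le[OF u]) (use e tb in \<open>auto simp: u_def indicator_def\<close>)
      also have "\<dots> \<le> (1 + \<epsilon>) * \<delta>" using U(3) e by (intro mult_left_mono) auto
      finally show ?thesis using \<delta>(2) by simp
    qed
    have us: "(\<lambda>z. s z + u z) \<in> S_fun borel" "S_integral borel \<mu> (\<lambda>z. s z + u z) = S_integral borel \<mu> s + S_integral borel \<mu> u"
      by (rule S_integral_add[OF s(2) u])+
    have "norm (t z - (s z + u z)) \<le> \<epsilon>" for z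
    proof (cases "z \<in> KK")
      case True
      then obtain n where n: "n < N" "z \<in> K n" by (auto simp: KK_def)
      then have "s z = apply_c0 h z" using s_in h(3) by simp
      then show ?thesis using t'[of z] True by (simp add: u_def norm_minus_commute)
    next
      case False
      then show ?thesis
        using s_out[OF False] t'[of z] h(2) e by (cases "z \<in> U") (auto simp: u_def)
    qed
    then have "norm (S_integral borel \<mu> t - S_integral borel \<mu> (\<lambda>z. s z + u z)) \<le> \<epsilon> * sv (space borel)"
      using e by (intro S_integral_close t(1) us(1)) auto
    then have 1: "norm (S_integral borel \<mu> t - (S_integral borel \<mu> s + S_integral borel \<mu> u)) \<le> \<epsilon> * sv UNIV"
      unfolding us(2) by simp
    have 2: "norm (integ (apply_c0 h) - S_integral borel \<mu> t) \<le> \<epsilon> * sv UNIV"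
      using i_integral_close[OF hM t(1), of \<epsilon>] e t' by simp
    have 3: "norm (integ (apply_c0 h)) \<le> b"
      using b[of h] mult_left_le[OF h(1) \<open>0 \<le> b\<close>] by linarith
    have "norm (\<mu> (B n) (x n) - \<mu> (K n) (x n)) \<le> \<epsilon>" if n: "n < N" for n
    proof -
      have "norm (\<mu> (B n - K n) (x n)) \<le> sv (B n - K n)"
        using B(2,3)[OF n] Kb[OF n] by (intro sv_upper sv_set_single) auto
      then show ?thesis
        using diff_subset[OF B(2)[OF n] Kb[OF n] K(2)[OF n]] K(3)[OF n] by simp
    qed
    then have "norm (\<Sum>n<N. \<mu> (B n) (x n) - \<mu> (K n) (x n)) \<le> (\<Sum>n<N. \<epsilon>)"
      by (intro sum_norm_le) auto
    then have 4: "norm ((\<Sum>n<N. \<mu> (B n) (x n)) - S_integral borel \<mu> s) \<le> \<epsilon> * real N"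
      by (simp add: sum_subtractf s(1) mult.commute)
    \<comment> \<open>Three errors, named so that the sum over the \<open>B n\<close> becomes one
      identity in them, to which the triangle inequality applies.\<close>
    define a1 where "a1 = (\<Sum>n<N. \<mu> (B n) (x n)) - S_integral borel \<mu> s"
    define a2 where "a2 = S_integral borel \<mu> t - (S_integral borel \<mu> s + S_integral borel \<mu> u)"
    define a3 where "a3 = integ (apply_c0 h) - S_integral borel \<mu> t"
    have "(\<Sum>n<N. \<mu> (B n) (x n)) = ((a1 - a2) + (integ (apply_c0 h) - a3)) - S_integral borel \<mu> u"
      by (simp add: a1_def a2_def a3_def)
    then have "c \<le> norm ((a1 - a2) + (integ (apply_c0 h) - a3)) + norm (S_integral borel \<mu> u)"
      unfolding B(1) by (simp only: norm_triangle_ineq4)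
    also have "\<dots> \<le> ((norm a1 + norm a2) + (norm (integ (apply_c0 h)) + norm a3)) + norm (S_integral borel \<mu> u)"
      by (intro add_mono norm_triangle_le norm_triangle_ineq4 order_refl)
    also have "\<dots> \<le> ((\<epsilon> * real N + \<epsilon> * sv UNIV) + (b + \<epsilon> * sv UNIV)) + \<epsilon>"
      using 1 2 3 4 Su unfolding a1_def a2_def a3_def by (intro add_mono)
    finally show "c \<le> b + \<epsilon> * (real N + 2 * sv UNIV + 1)"
      by (simp add: algebra_simps)
  qed
qed

lemma integral_operator:
  "\<exists>T :: ('z, 'e) c0fun \<Rightarrow>\<^sub>L 'f. T \<in> linops (c0_scale sE) sF \<and>
    (\<forall>f. blinfun_apply T f = integ (apply_c0 f)) \<and> ennreal (norm T) = semivariation borel \<mu>"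
proof -
  interpret E: normed_over sE by (rule sE)
  interpret F: normed_over sF by (rule sF)
  have mem: "apply_c0 f \<in> M_fun sE borel" for f :: "('z, 'e) c0fun" by (rule apply_c0_in_M_fun)
  have scale: "integ (apply_c0 (c0_scale sE c f)) = sF c (integ (apply_c0 f))" for c and f :: "('z, 'e) c0fun"
  proof -
    have eq: "apply_c0 (c0_scale sE c f) = (\<lambda>z. sE c (apply_c0 f z))"
      by (rule ext) (rule apply_c0_scale[OF sE])
    show ?thesis
      using i_integral_scale[OF mem[of f], of c] mem[of "c0_scale sE c f"] by (simp add: eq)
  qed
  have bound: "norm (integ (apply_c0 f)) \<le> norm f * sv UNIV" for f :: "('z, 'e) c0fun"
    using norm_i_integral_le[OF mem[of f], of UNIV "norm f"] norm_c0_le[of f] by simp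
  have bl: "bounded_linear (\<lambda>f :: ('z, 'e) c0fun. integ (apply_c0 f))"
  proof (rule bounded_linear_intro)
    show "integ (apply_c0 (f + g)) = integ (apply_c0 f) + integ (apply_c0 g)" for f g :: "('z, 'e) c0fun"
    proof -
      have eq: "apply_c0 (f + g) = (\<lambda>z. apply_c0 f z + apply_c0 g z)"
        by (rule ext) (simp add: plus_c0fun.rep_eq)
      show ?thesis
        using i_integral_add[OF mem[of f] mem[of g]] mem[of "f + g"] by (simp add: eq)
    qed
    show "integ (apply_c0 (r *\<^sub>R f)) = r *\<^sub>R integ (apply_c0 f)" for r and f :: "('z, 'e) c0fun"
    proof -
      have "r *\<^sub>R f = c0_scale sE (of_real r) f"
        by (simp add: normed_over.scale_of_real[OF normed_over_c0_scale[OF sE]])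
      then show ?thesis using scale[of "of_real r" f] by (simp add: F.scale_of_real)
    qed
    show "norm (integ (apply_c0 f)) \<le> norm f * sv UNIV" for f :: "('z, 'e) c0fun" by (rule bound)
  qed
  define T where "T = Blinfun (\<lambda>f :: ('z, 'e) c0fun. integ (apply_c0 f))"
  have T: "blinfun_apply T f = integ (apply_c0 f)" for f
    using bl by (simp add: T_def bounded_linear_Blinfun_apply)
  have "T \<in> linops (c0_scale sE) sF"
    by (rule linopsI[OF normed_over_c0_scale[OF sE] sF]) (simp add: T scale)
  moreover have "norm T = sv UNIV"
  proof (rule antisym)
    show "norm T \<le> sv UNIV"
      by (rule norm_blinfun_bound) (use bound sv_nonneg in \<open>auto simp: T mult.commute\<close>)
    show "sv UNIV \<le> norm T"
      by (rule sv_le_operator_norm) (use norm_blinfun[of T] in \<open>auto simp: T\<close>)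
  qed
  then have "ennreal (norm T) = semivariation borel \<mu>"
    by (simp add: semivariation_eq)
  ultimately show ?thesis using T by blast
qed

text \<open>By \<open>sv_le_operator_norm\<close> with \<open>b = 0\<close>, the semivariation of
  the whole space is zero.\<close>

lemma zero_if_integral_zero:
  assumes "\<And>f :: ('z, 'e) c0fun. integ (apply_c0 f) = 0" and A: "A \<in> sets borel"
  shows "\<mu> A = 0"
proof (rule blinfun_eqI)
  have sv0: "sv UNIV \<le> 0"
    by (rule sv_le_operator_norm) (use assms(1) in auto)
  fix x
  have "norm (\<mu> A x) \<le> norm x * sv UNIV"
    using sum_le_sv[of "{()}" "\<lambda>_. A" UNIV "\<lambda>_. x" "norm x"] A by (simp add: disjoint_family_on_def)
  also have "\<dots> \<le> 0" using sv0 by (simp add: mult_nonneg_nonpos)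
  finally show "\<mu> A x = (0 :: 'e \<Rightarrow>\<^sub>L 'f) x" by (simp add: blinfun.zero_left)
qed

end

section \<open>Differences of measures and uniqueness\<close>

lemma i_measure_diff:
  assumes sE: "normed_over sE" and sF: "normed_over sF"
    and m: "i_measure sE sF M \<mu>" and n: "i_measure sE sF M \<nu>"
  shows "i_measure sE sF M (\<lambda>A. \<mu> A - \<nu> A)"
  unfolding i_measure_def
proof (intro conjI ballI allI impI)
  interpret F: normed_over sF by (rule sF)
  fix A assume A: "A \<in> sets M"
  then have "\<mu> A \<in> linops sE sF" "\<nu> A \<in> linops sE sF"
    using m n by (auto simp: i_measure_def)
  then show "\<mu> A - \<nu> A \<in> linops sE sF"
    by (intro linopsI[OF sE sF]) (simp add: blinfun.diff_left linops_apply F.scale_right_diff_distrib)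
next
  fix A :: "nat \<Rightarrow> _" assume A: "range A \<subseteq> sets M" "disjoint_family A"
  then have "(\<lambda>n. \<mu> (A n) x) sums \<mu> (\<Union>n. A n) x" "(\<lambda>n. \<nu> (A n) x) sums \<nu> (\<Union>n. A n) x" for x
    using m n unfolding i_measure_def by blast+
  then show "(\<lambda>n. (\<mu> (A n) - \<nu> (A n)) x) sums (\<mu> (\<Union>n. A n) - \<nu> (\<Union>n. A n)) x" for x
    by (simp add: blinfun.diff_left sums_diff)
  have "independently_convergent (\<lambda>n. \<mu> (A n))" "independently_convergent (\<lambda>n. \<nu> (A n))"
    using A m n unfolding i_measure_def by blast+
  then show "independently_convergent (\<lambda>n. \<mu> (A n) - \<nu> (A n))"
    unfolding independently_convergent_def by (simp add: blinfun.diff_left summable_diff)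
qed

lemma regular_i_measure_diff:
  fixes \<mu> \<nu> :: "'z::t2_space set \<Rightarrow> 'e::banach \<Rightarrow>\<^sub>L 'f::banach"
  assumes sE: "normed_over sE" and sF: "normed_over sF"
    and m: "regular_i_measure sE sF \<mu>" and n: "regular_i_measure sE sF \<nu>"
  shows "regular_i_measure sE sF (\<lambda>A. \<mu> A - \<nu> A)"
  unfolding regular_i_measure_def
proof (intro conjI ballI)
  show "i_measure sE sF borel (\<lambda>A. \<mu> A - \<nu> A)"
    using m n by (intro i_measure_diff[OF sE sF]) (auto simp: regular_i_measure_def)
  fix A :: "'z set" assume A: "A \<in> sets borel"
  have "\<exists>C :: nat \<Rightarrow> 'z set. (\<forall>n. compact (C n)) \<and> (\<Union>n. C n) \<subseteq> A \<and>
      (\<forall>B\<in>sets borel. B \<subseteq> A - (\<Union>n. C n) \<longrightarrow> \<mu> B = 0)"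
    using m A unfolding regular_i_measure_def by blast
  then obtain C :: "nat \<Rightarrow> 'z set" where C: "\<forall>n. compact (C n)" "(\<Union>n. C n) \<subseteq> A"
      "\<forall>B\<in>sets borel. B \<subseteq> A - (\<Union>n. C n) \<longrightarrow> \<mu> B = 0"
    by (elim exE conjE)
  have "\<exists>C :: nat \<Rightarrow> 'z set. (\<forall>n. compact (C n)) \<and> (\<Union>n. C n) \<subseteq> A \<and>
      (\<forall>B\<in>sets borel. B \<subseteq> A - (\<Union>n. C n) \<longrightarrow> \<nu> B = 0)"
    using n A unfolding regular_i_measure_def by blast
  then obtain D :: "nat \<Rightarrow> 'z set" where D: "\<forall>n. compact (D n)" "(\<Union>n. D n) \<subseteq> A"
      "\<forall>B\<in>sets borel. B \<subseteq> A - (\<Union>n. D n) \<longrightarrow> \<nu> B = 0"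
    by (elim exE conjE)
  have U: "(\<Union>n. C n \<union> D n) = (\<Union>n. C n) \<union> (\<Union>n. D n)" by blast
  show "\<exists>C :: nat \<Rightarrow> 'z set. (\<forall>n. compact (C n)) \<and> (\<Union>n. C n) \<subseteq> A \<and>
      (\<forall>B\<in>sets borel. B \<subseteq> A - (\<Union>n. C n) \<longrightarrow> \<mu> B - \<nu> B = 0)"
  proof (intro exI[of _ "\<lambda>n. C n \<union> D n"] conjI allI ballI impI)
    show "compact (C n \<union> D n)" for n using C(1) D(1) by (intro compact_Un) auto
    show "(\<Union>n. C n \<union> D n) \<subseteq> A" unfolding U using C(2) D(2) by (rule Un_least)
    fix B :: "'z set" assume B: "B \<in> sets borel" "B \<subseteq> A - (\<Union>n. C n \<union> D n)"
    then have "B \<subseteq> A - (\<Union>n. C n)" "B \<subseteq> A - (\<Union>n. D n)" unfolding U by blast+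
    then show "\<mu> B - \<nu> B = 0" using C(3) D(3) B(1) by simp
  qed
qed

text \<open>The integral is defined by unique extension for each measure separately, so it is not
  visibly linear in the measure; this is transferred from countably valued functions by
  approximation.\<close>

lemma i_integral_diff_measure:
  assumes sE: "normed_over sE" and sF: "normed_over sF"
    and m: "i_measure sE sF M \<mu>" and n: "i_measure sE sF M \<nu>" and f: "f \<in> M_fun sE M"
  shows "i_integral sE M (\<lambda>A. \<mu> A - \<nu> A) f = i_integral sE M \<mu> f - i_integral sE M \<nu> f"
proof -
  interpret m: vector_i_measure sE sF M \<mu> by (rule vector_i_measure.intro[OF sE sF m])
  interpret n: vector_i_measure sE sF M \<nu> by (rule vector_i_measure.intro[OF sE sF n])
  interpret d: vector_i_measure sE sF M "\<lambda>A. \<mu> A - \<nu> A"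
    by (rule vector_i_measure.intro[OF sE sF i_measure_diff[OF sE sF m n]])
  have S: "S_integral M (\<lambda>A. \<mu> A - \<nu> A) s = S_integral M \<mu> s - S_integral M \<nu> s" if s: "s \<in> S_fun M" for s
  proof -
    obtain C where C: "\<And>z. z \<in> space M \<Longrightarrow> norm (s z) \<le> C" using S_funD(3)[OF s] by blast
    have C': "norm i \<le> C" if "i \<in> s ` space M" for i using that C by auto
    note sm = S_funD(1,2)[OF s]
    have "((\<lambda>i. \<mu> (s -` {i} \<inter> space M) ((\<lambda>x. x) i)) has_sum S_integral M \<mu> (\<lambda>z. (\<lambda>x. x) (s z))) (s ` space M)"
      by (rule m.S_integral_compose[OF sm(1) sm(2) C'])
    moreover have h2: "((\<lambda>i. \<nu> (s -` {i} \<inter> space M) ((\<lambda>x. x) i)) has_sum S_integral M \<nu> (\<lambda>z. (\<lambda>x. x) (s z))) (s ` space M)"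
      by (rule n.S_integral_compose[OF sm(1) sm(2) C'])
    moreover have "((\<lambda>i. - \<nu> (s -` {i} \<inter> space M) i) has_sum - S_integral M \<nu> s) (s ` space M)"
      using h2 by (simp add: has_sum_uminus)
    ultimately have "((\<lambda>i. \<mu> (s -` {i} \<inter> space M) i + - \<nu> (s -` {i} \<inter> space M) i) has_sum
        S_integral M \<mu> s + - S_integral M \<nu> s) (s ` space M)"
      by (intro has_sum_add) simp_all
    moreover have "((\<lambda>i. (\<mu> (s -` {i} \<inter> space M) - \<nu> (s -` {i} \<inter> space M)) ((\<lambda>x. x) i)) has_sum
        S_integral M (\<lambda>A. \<mu> A - \<nu> A) (\<lambda>z. (\<lambda>x. x) (s z))) (s ` space M)"
      by (rule d.S_integral_compose[OF sm(1) sm(2) C'])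
    ultimately show ?thesis by (simp add: blinfun.diff_left has_sum_unique)
  qed
  let ?D = "i_integral sE M (\<lambda>A. \<mu> A - \<nu> A) f" and ?m = "i_integral sE M \<mu> f" and ?n = "i_integral sE M \<nu> f"
  have "norm (?D - (?m - ?n)) \<le> 0"
  proof (rule le_if_le_add_small_mult)
    fix \<epsilon> :: real assume e: "0 < \<epsilon>"
    obtain s where s: "s \<in> S_fun M" "\<forall>z\<in>space M. norm (f z - s z) \<le> \<epsilon>"
      using S_fun_dense[OF sE f e] by (elim bexE)
    have 1: "norm (?D - (S_integral M \<mu> s - S_integral M \<nu> s)) \<le> \<epsilon> * d.sv (space M)"
      unfolding S[OF s(1), symmetric] using s e by (intro d.i_integral_close[OF f]) auto
    have 2: "norm (?m - S_integral M \<mu> s) \<le> \<epsilon> * m.sv (space M)"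
      using s e by (intro m.i_integral_close[OF f]) auto
    have 3: "norm (?n - S_integral M \<nu> s) \<le> \<epsilon> * n.sv (space M)"
      using s e by (intro n.i_integral_close[OF f]) auto
    have "?D - (?m - ?n) = (?D - (S_integral M \<mu> s - S_integral M \<nu> s)) -
        ((?m - S_integral M \<mu> s) - (?n - S_integral M \<nu> s))" by simp
    then have "norm (?D - (?m - ?n)) \<le> norm (?D - (S_integral M \<mu> s - S_integral M \<nu> s)) +
        norm ((?m - S_integral M \<mu> s) - (?n - S_integral M \<nu> s))"
      by (simp only: norm_triangle_ineq4)
    also have "\<dots> \<le> \<epsilon> * d.sv (space M) + (norm (?m - S_integral M \<mu> s) + norm (?n - S_integral M \<nu> s))"
      by (intro add_mono 1 norm_triangle_ineq4)
    also have "\<dots> \<le> \<epsilon> * d.sv (space M) + (\<epsilon> * m.sv (space M) + \<epsilon> * n.sv (space M))"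
      by (intro add_mono order_refl 2 3)
    finally show "norm (?D - (?m - ?n)) \<le> 0 + \<epsilon> * (d.sv (space M) + m.sv (space M) + n.sv (space M))"
      by (simp add: algebra_simps)
  qed
  then show ?thesis by simp
qed

lemma regular_measure_unique:
  fixes \<mu> \<nu> :: "'z::t2_space set \<Rightarrow> 'e::banach \<Rightarrow>\<^sub>L 'f::banach"
  assumes lc: "locally_compact_space (euclidean :: 'z topology)"
    and sE: "normed_over sE" and sF: "normed_over sF"
    and m: "regular_i_measure sE sF \<mu>" and n: "regular_i_measure sE sF \<nu>"
    and eq: "\<And>f :: ('z, 'e) c0fun. i_integral sE borel \<mu> (apply_c0 f) = i_integral sE borel \<nu> (apply_c0 f)"
    and A: "A \<in> sets borel"
  shows "\<mu> A = \<nu> A"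
proof -
  have im: "i_measure sE sF borel \<mu>" and i_n: "i_measure sE sF borel \<nu>"
    using m n by (auto simp: regular_i_measure_def)
  have reg: "regular_i_measure sE sF (\<lambda>A. \<mu> A - \<nu> A)"
    by (rule regular_i_measure_diff[OF sE sF m n])
  interpret regular_vector_measure sE sF "\<lambda>A. \<mu> A - \<nu> A"
    by (rule regular_vector_measure.intro[OF
          vector_i_measure.intro[OF sE sF i_measure_diff[OF sE sF im i_n]]
          regular_vector_measure_axioms.intro[OF lc reg]])
  have "\<mu> A - \<nu> A = 0"
  proof (rule zero_if_integral_zero[OF _ A])
    show "i_integral sE borel (\<lambda>A. \<mu> A - \<nu> A) (apply_c0 f) = 0" for f :: "('z, 'e) c0fun"
      using i_integral_diff_measure[OF sE sF im i_n apply_c0_in_M_fun[of f sE]] eq by simp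
  qed
  then show ?thesis by simp
qed

text \<open>Both sides are close to the integral of one function of finite range: \<open>T f\<close>
  through \<open>rep\<close>, the integral through its continuity.\<close>

lemma (in strongly_bounded_operator) integral_rep_measure:
  fixes sE :: "'k::real_or_complex \<Rightarrow> 'e \<Rightarrow> 'e"
  assumes sE: "normed_over sE" and sF: "normed_over sF" and T: "T \<in> linops (c0_scale sE) sF"
  shows "T f = i_integral sE borel rep_measure (apply_c0 f)"
proof -
  interpret vector_i_measure sE sF borel rep_measure
    by (rule vector_i_measure.intro[OF sE sF i_measure_rep_measure[OF sE sF T]])
  let ?I = "i_integral sE borel rep_measure (apply_c0 f)"
  have "norm (T f - ?I) \<le> 0"
  proof (rule le_if_le_add_small_mult)
    fix \<epsilon> :: real assume e: "0 < \<epsilon>"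
    obtain s where s: "finite (range s)" "\<forall>e. s -` {e} \<in> sets borel" "\<forall>z. norm (apply_c0 f z - s z) \<le> \<epsilon>"
      using c0_simple_approximation[OF e, of f] by (elim exE conjE)
    have S: "s \<in> S_fun borel"
      using s(1,2) by (simp add: S_fun_def finite_imp_bounded countable_finite)
    have 1: "norm (T f - S_integral borel rep_measure s) \<le> \<epsilon> * norm T"
      using s by (intro S_integral_rep_measure) auto
    have 2: "norm (?I - S_integral borel rep_measure s) \<le> \<epsilon> * sv UNIV"
      using i_integral_close[OF apply_c0_in_M_fun S, of \<epsilon>] s(3) e by simp
    show "norm (T f - ?I) \<le> 0 + \<epsilon> * (norm T + sv UNIV)"
      using norm_triangle_ineq4[of "T f - S_integral borel rep_measure s" "?I - S_integral borel rep_measure s"] 1 2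
      by (simp add: algebra_simps)
  qed
  then show ?thesis by simp
qed

text \<open>Disjointly supported functions in the unit ball have all finite sums in the unit ball,
  so the finite sums of the \<open>T (g n)\<close> are bounded by \<open>norm T\<close>. The
  assumption \<open>null\<close> is the common consequence of the two alternatives for the range
  space.\<close>

lemma strongly_bounded_operator_if_bounded_sums:
  fixes T :: "('z::t2_space, 'e::banach) c0fun \<Rightarrow>\<^sub>L 'f::banach"
  assumes lc: "locally_compact_space (euclidean :: 'z topology)"
    and null: "\<And>(z :: nat \<Rightarrow> 'f) C \<delta>. (\<And>F. finite F \<Longrightarrow> norm (sum z F) \<le> C) \<Longrightarrow> 0 < \<delta> \<Longrightarrow>
      \<exists>i. norm (z i) < \<delta>"
  shows "strongly_bounded_operator T"
proof
  show "locally_compact_space (euclidean :: 'z topology)" by (rule lc)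
  fix g :: "nat \<Rightarrow> ('z, 'e) c0fun" and \<delta> :: real
  assume g: "\<And>n. norm (g n) \<le> 1"
    "\<And>m n z. m < n \<Longrightarrow> apply_c0 (g m) z = 0 \<or> apply_c0 (g n) z = 0" and "0 < \<delta>"
  have sum: "apply_c0 (\<Sum>n\<in>F. g n) z = (\<Sum>n\<in>F. apply_c0 (g n) z)" for F z
    by (induction F rule: infinite_finite_induct) (auto simp: zero_c0fun.rep_eq plus_c0fun.rep_eq)
  have "norm (\<Sum>n\<in>F. T (g n)) \<le> norm T" if "finite F" for F
  proof -
    have "norm (\<Sum>n\<in>F. g n) \<le> 1"
    proof (rule norm_c0_least)
      fix z
      show "norm (apply_c0 (\<Sum>n\<in>F. g n) z) \<le> 1"
      proof (cases "\<exists>n\<in>F. apply_c0 (g n) z \<noteq> 0")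
        case True
        then obtain n where n: "n \<in> F" "apply_c0 (g n) z \<noteq> 0" by blast
        have "apply_c0 (g m) z = 0" if "m \<noteq> n" for m
          using g(2)[of m n z] g(2)[of n m z] n(2) that by (cases "m < n") auto
        then have "(\<Sum>m\<in>F. apply_c0 (g m) z) = (\<Sum>m\<in>F. if m = n then apply_c0 (g n) z else 0)"
          by (intro sum.cong) auto
        then show ?thesis
          using n(1) \<open>finite F\<close> norm_c0_le[of "g n" z] g(1)[of n] by (simp add: sum)
      next
        case False
        then show ?thesis by (simp add: sum)
      qed
    qed
    then show ?thesis
      using norm_blinfun[of T "\<Sum>n\<in>F. g n"] mult_left_le[of "norm (\<Sum>n\<in>F. g n)" "norm T"]
      by (simp add: blinfun.sum_right)
  qed
  then show "\<exists>n. norm (T (g n)) < \<delta>" using \<open>0 < \<delta>\<close> by (rule null)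
qed

theorem theorem1p4:
  fixes sE :: "'k::real_or_complex \<Rightarrow> 'e::banach \<Rightarrow> 'e"
    and sF :: "'k \<Rightarrow> 'f::banach \<Rightarrow> 'f"
    and sG :: "'k \<Rightarrow> 'g::banach \<Rightarrow> 'g"
  assumes "locally_compact_space (euclidean :: 'z::t2_space topology)"
    and "normed_over sE" and "normed_over sF" and "normed_over sG"
  shows
    "(weakly_sequentially_complete sF \<or>
        is_dual_of sF sG \<and> \<not> contains_real_linfty TYPE('f) \<longrightarrow>
      (\<forall>T :: ('z, 'e) c0fun \<Rightarrow>\<^sub>L 'f. T \<in> linops (c0_scale sE) sF \<longrightarrow>
        (\<exists>!\<mu> :: 'z set \<Rightarrow> 'e \<Rightarrow>\<^sub>L 'f. \<mu> \<in> extensional (sets borel) \<and>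
          regular_i_measure sE sF \<mu> \<and>
          (\<forall>f. blinfun_apply T f = i_integral sE borel \<mu> (apply_c0 f))))) \<and>
     (\<forall>\<mu> :: 'z set \<Rightarrow> 'e \<Rightarrow>\<^sub>L 'f. regular_i_measure sE sF \<mu> \<longrightarrow>
        (\<forall>f :: ('z, 'e) c0fun. apply_c0 f \<in> M_fun sE borel) \<and>
        (\<exists>T :: ('z, 'e) c0fun \<Rightarrow>\<^sub>L 'f. T \<in> linops (c0_scale sE) sF \<and>
          (\<forall>f. blinfun_apply T f = i_integral sE borel \<mu> (apply_c0 f)) \<and>
          ennreal (norm T) = semivariation borel \<mu>))"
proof (rule conjI; intro impI allI)
  note lc = assms(1) and sE = assms(2) and sF = assms(3) and sG = assms(4)
  fix T :: "('z, 'e) c0fun \<Rightarrow>\<^sub>L 'f"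
  assume F: "weakly_sequentially_complete sF \<or> is_dual_of sF sG \<and> \<not> contains_real_linfty TYPE('f)"
    and T: "T \<in> linops (c0_scale sE) sF"
  have null: "\<exists>i. norm (z i) < \<delta>"
    if "\<And>F. finite F \<Longrightarrow> norm (sum z F) \<le> C" "0 < \<delta>" for z :: "nat \<Rightarrow> 'f" and C \<delta>
    using F
  proof
    assume "weakly_sequentially_complete sF"
    from sF this that show ?thesis by (rule weakly_sequentially_complete_bounded_sums)
  next
    assume F: "is_dual_of sF sG \<and> \<not> contains_real_linfty TYPE('f)"
    from sF sG F[THEN conjunct1] F[THEN conjunct2] that show ?thesis
      by (rule dual_space_bounded_sums)
  qed
  interpret strongly_bounded_operator T
    using lc null by (rule strongly_bounded_operator_if_bounded_sums)
  show "\<exists>!\<mu> :: 'z set \<Rightarrow> 'e \<Rightarrow>\<^sub>L 'f. \<mu> \<in> extensional (sets borel) \<and> regular_i_measure sE sF \<mu> \<and>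
      (\<forall>f. blinfun_apply T f = i_integral sE borel \<mu> (apply_c0 f))"
  proof (rule ex1I[of _ rep_measure])
    show "rep_measure \<in> extensional (sets borel) \<and> regular_i_measure sE sF rep_measure \<and>
      (\<forall>f. blinfun_apply T f = i_integral sE borel rep_measure (apply_c0 f))"
      using regular_rep_measure[OF sE sF T] integral_rep_measure[OF sE sF T]
      by (simp add: rep_measure_def)
  next
    fix \<mu> :: "'z set \<Rightarrow> 'e \<Rightarrow>\<^sub>L 'f"
    assume \<mu>: "\<mu> \<in> extensional (sets borel) \<and> regular_i_measure sE sF \<mu> \<and>
      (\<forall>f. blinfun_apply T f = i_integral sE borel \<mu> (apply_c0 f))"
    show "\<mu> = rep_measure"
    \<comment> \<open>Both measures are extensional, so agreement on the Borel sets
      suffices.\<close>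
    proof (rule extensionalityI[of _ "sets borel"])
      fix A :: "'z set" assume A: "A \<in> sets borel"
      show "\<mu> A = rep_measure A"
      proof (rule regular_measure_unique[OF lc sE sF _ regular_rep_measure[OF sE sF T] _ A])
        show "i_integral sE borel \<mu> (apply_c0 f) = i_integral sE borel rep_measure (apply_c0 f)"
          for f :: "('z, 'e) c0fun"
          using \<mu> integral_rep_measure[OF sE sF T, of f] by simp
      qed (use \<mu> in simp)
    qed (use \<mu> in \<open>auto simp: rep_measure_def\<close>)
  qed
next
  fix \<mu> :: "'z set \<Rightarrow> 'e \<Rightarrow>\<^sub>L 'f"
  assume reg: "regular_i_measure sE sF \<mu>"
  then have "i_measure sE sF borel \<mu>" by (simp add: regular_i_measure_def)
  then interpret regular_vector_measure sE sF \<mu>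
    by (intro regular_vector_measure.intro vector_i_measure.intro
        regular_vector_measure_axioms.intro assms reg)
  show "(\<forall>f :: ('z, 'e) c0fun. apply_c0 f \<in> M_fun sE borel) \<and>
      (\<exists>T :: ('z, 'e) c0fun \<Rightarrow>\<^sub>L 'f. T \<in> linops (c0_scale sE) sF \<and>
        (\<forall>f. blinfun_apply T f = i_integral sE borel \<mu> (apply_c0 f)) \<and>
        ennreal (norm T) = semivariation borel \<mu>)"
    using integral_operator apply_c0_in_M_fun by (intro conjI allI)
qed

end
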